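(* For real $x>1/4$ let $$f_{13}(x)=\frac{(60x^2-43x+8)\,\Gamma(4x)\,\Gamma(x)^8}{16(4x-1)\,\Gamma(2x)^6}.$$ Then the following series converge and $$\sum_{k=1}^\infty f_{13}'(k)=-8\zeta(3),\qquad \sum_{k=1}^\infty f_{13}''(k)=24\zeta(4),\qquad \sum_{k=1}^\infty f_{13}^{(3)}(k)=-48\zeta(5),$$ $$\frac1{48}\sum_{k=1}^\infty f_{13}^{(4)}(k)=16\zeta(3)^2-25\zeta(6),\qquad \frac1{2880}\sum_{k=1}^\infty f_{13}^{(5)}(k)=19\zeta(7)-14\zeta(3)\zeta(4),$$ $$\frac1{5760}\sum_{k=1}^\infty f_{13}^{(6)}(k)=32\zeta(5,3)+168\zeta(3)\zeta(5)-215\zeta(8),$$ $$\frac1{13440}\sum_{k=1}^\infty f_{13}^{(7)}(k)=2489\zeta(9)-1860\zeta(3)\zeta(6)-32\zeta(3)^3-126\zeta(4)\zeta(5).$$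
   Context: $\Gamma$ is Euler's gamma function and $f^{(m)}$ (also $f',f''$) is the $m$-th derivative with respect to $x$. $\zeta(s)=\sum_{n\ge1}n^{-s}$ is the Riemann zeta function and $\zeta(5,3)=\sum_{k_1>k_2>0}\frac{1}{k_1^5k_2^3}$. *)

theory Defs
  imports "HOL-Analysis.Analysis"
begin

text \<open>Meaningful for \<open>s > 1\<close>, where the Dirichlet series converges.\<close>

definition zeta :: "real \<Rightarrow> real" where
  "zeta s = (\<Sum>n. real (Suc n) powr (- s))"

text \<open>The first exponent belongs to the larger summation index.\<close>

definition double_zeta :: "nat \<Rightarrow> nat \<Rightarrow> real" where
  "double_zeta a b =
     (\<Sum>\<^sub>\<infinity>(k1, k2)\<in>{(k1, k2). k1 > k2 \<and> k2 > 0}. 1 / (real k1 ^ a * real k2 ^ b))"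

text \<open>Only the values at \<open>x > 1/4\<close> are meaningful. This set is open and contains all positive integers,
  so derivatives at positive integers do not see the totalised values elsewhere.\<close>

definition f13 :: "real \<Rightarrow> real" where
  "f13 x = (60 * x\<^sup>2 - 43 * x + 8) * Gamma (4 * x) * Gamma x ^ 8
           / (16 * (4 * x - 1) * Gamma (2 * x) ^ 6)"

end

theory Submission
  imports Defs "HOL-Complex_Analysis.Complex_Analysis" "HOL-Real_Asymp.Real_Asymp"
begin

text \<open>Write \<open>F b c d e\<close> for \<open>wz_summand b c d e\<close>. It satisfies the closedness relation
  \<open>F b c d e - F b (c+1) d e = F c b d e - F c (b+1) d e\<close>, and \<open>f13 (x+1)\<close> is the sum of
  \<open>F x x x x\<close>, \<open>F x (x+1) x x\<close>, \<open>F x (x+1) (x+1) x\<close> and \<open>F x (x+1) (x+1) (x+1)\<close>. Telescoping turns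
  \<open>\<Sum>k\<ge>1. f13 (k+x)\<close> into a sum of two series, each of which is a quotient of Gamma values times a series
  whose terms are \<open>\<psi> (x/j) / j\<^sup>2\<close> times \<open>\<Prod>i<j. \<phi> (x/i)\<close> for rational functions \<open>\<phi>\<close>, \<open>\<psi>\<close> with \<open>\<phi> t = 1 + O(t\<^sup>2)\<close>.
  The Gamma quotients are infinite products of the same kind, so all Taylor coefficients at \<open>x = 0\<close> are
  polynomials in multiple zeta values with rational coefficients. Up to weight 9 the stuffle and shuffle
  products and Hoffman's relation reduce these polynomials to the right-hand sides.\<close>

text \<open>The telescoping of the first series leaves a contribution at infinity:
  \<open>wz_summand x (x + j) d e\<close> tends to the positive number
  \<open>wz_limit x d e\<close>. The second series is chosen because its own telescoping produces
  exactly these limits, so that they cancel in \<open>accel_sum\<close>. That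
  \<open>accel_sum (x + n)\<close> tends to 0 then needs bounds uniform in x. All this works with
  positive Gamma values, hence for real x >= 0 only, a one-sided neighbourhood of the expansion
  point. Taylor expansion and termwise differentiation are therefore carried out for holomorphic
  functions on the disc of radius 1/8, and the two sides are matched there by analytic continuation.
  That radius keeps every factor 1 + c t with |c| <= 4 away from 0. The missing linear term of phi
  keeps the exponent 1 out of the multiple zeta values in the Taylor coefficients, so that all of
  them converge. The number pi never enters: zeta(4) and zeta(6) become rational multiples of powers
  of zeta(2) by the same relations as the other values.\<close>

unbundle no vec_syntax and fps_syntax

subsection \<open>Multiple zeta values and the stuffle product\<close>

fun hsum :: "nat list \<Rightarrow> nat \<Rightarrow> real" where
  "hsum [] n = 1"
| "hsum (a # u) n = (\<Sum>k\<in>{1..<n}. hsum u k / real k ^ a)"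

lemma hsum_Suc: "hsum (a # u) (Suc n) = hsum (a # u) n + (if n = 0 then 0 else hsum u n / real n ^ a)"
  by (cases n) (auto simp: sum.atLeastLessThan_Suc)

declare hsum.simps(2) [simp del]

lemma hsum_0 [simp]: "hsum (a # u) 0 = 0" and hsum_1 [simp]: "hsum (a # u) (Suc 0) = 0"
  by (auto simp: hsum.simps(2))

fun stuffle :: "nat list \<Rightarrow> nat list \<Rightarrow> nat list list" where
  "stuffle [] v = [v]"
| "stuffle u [] = [u]"
| "stuffle (a # u) (b # v) = map (Cons a) (stuffle u (b # v)) @ map (Cons b) (stuffle (a # u) v)
     @ map (Cons (a + b)) (stuffle u v)"

lemma stuffle_Nil2 [simp]: "stuffle u [] = [u]"
  by (cases u) auto

lemma sum_list_hsum_Cons_Suc: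
  "(\<Sum>w\<leftarrow>map (Cons a) ws. hsum w (Suc n)) =
     (\<Sum>w\<leftarrow>map (Cons a) ws. hsum w n) + (if n = 0 then 0 else (\<Sum>w\<leftarrow>ws. hsum w n) / real n ^ a)"
  by (induction ws) (auto simp: hsum_Suc add_divide_distrib)

text \<open>Raising n by one turns the product into (A + x)(B + y), and the three new terms x B, A y
  and x y are the three branches of \<open>stuffle\<close>. So induction on n for all u and v
  suffices.\<close>

lemma hsum_stuffle: "hsum u n * hsum v n = (\<Sum>w\<leftarrow>stuffle u v. hsum w n)"
proof (induction n arbitrary: u v)
  case 0
  show ?case by (cases u; cases v) (auto simp: o_def)
next
  case (Suc n)
  show ?case
  proof (cases "u = [] \<or> v = []")
    case False
    then obtain a u' b v' where uv: "u = a # u'" "v = b # v'"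
      by (metis list.exhaust)
    let ?A = "hsum (a # u') n" and ?B = "hsum (b # v') n"
    let ?x = "if n = 0 then 0 else hsum u' n / real n ^ a"
    let ?y = "if n = 0 then 0 else hsum v' n / real n ^ b"
    have "hsum u (Suc n) * hsum v (Suc n) = ?A * ?B + ?x * ?B + ?A * ?y + ?x * ?y"
      by (simp add: uv hsum_Suc algebra_simps)
    also have "?x * ?B = (if n = 0 then 0 else (\<Sum>w\<leftarrow>stuffle u' (b # v'). hsum w n) / real n ^ a)"
      by (simp add: Suc.IH [symmetric])
    also have "?A * ?y = (if n = 0 then 0 else (\<Sum>w\<leftarrow>stuffle (a # u') v'. hsum w n) / real n ^ b)"
      by (simp add: Suc.IH [symmetric])
    also have "?x * ?y = (if n = 0 then 0 else (\<Sum>w\<leftarrow>stuffle u' v'. hsum w n) / real n ^ (a + b))"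
      by (simp add: Suc.IH [symmetric] power_add)
    also have "?A * ?B = (\<Sum>w\<leftarrow>stuffle (a # u') (b # v'). hsum w n)"
      by (rule Suc.IH)
    finally show ?thesis
      unfolding uv stuffle.simps map_append sum_list_append sum_list_hsum_Cons_Suc by simp
  qed auto
qed

lemma hsum_Nil [simp]: "hsum [] = (\<lambda>_. 1)"
  by auto

text \<open>The first entry of an index belongs to the largest summation variable, as in \<open>\<zeta>(5,3)\<close>.\<close>

definition mzv :: "nat list \<Rightarrow> real" where
  "mzv u = lim (hsum u)"

fun admissible :: "nat list \<Rightarrow> bool" where
  "admissible [] = True"
| "admissible (a # u) = (a \<ge> 2 \<and> 0 \<notin> set u)"

section \<open>Growth of multiple harmonic sums and convergence\<close>

lemma hsum_nonneg: "hsum u n \<ge> 0"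
  by (induction u arbitrary: n) (auto simp: hsum.simps(2) intro!: sum_nonneg)

lemma hsum_mono: "m \<le> n \<Longrightarrow> hsum u m \<le> hsum u n"
  by (cases u) (auto simp: hsum.simps(2) hsum_nonneg intro!: sum_mono2)

lemma harm_le_powr:
  assumes "d > 0" "n > 0"
  shows "harm n \<le> (1 + 1 / d) * real n powr d"
proof -
  have "harm n \<le> 1 + ln (real n)"
    using assms(2)
  proof (induction n)
    case (Suc n)
    show ?case
    proof (cases "n = 0")
      case False
      have "1 / real (Suc n) \<le> ln (real (Suc n)) - ln (real n)"
        using ln_diff_le[of "real n" "real (Suc n)"] False by (simp add: field_simps)
      with Suc False show ?thesis by (simp add: harm_Suc inverse_eq_divide)
    qed (simp add: harm_Suc harm_expand)
  qed simp
  also have "ln (real n) \<le> real n powr d / d"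
    using assms by (intro ln_powr_bound) auto
  also have "(1::real) \<le> real n powr d"
    using assms by (intro ge_one_powr_ge_zero) auto
  finally show ?thesis by (simp add: ring_distribs)
qed

lemma hsum_le_harm:
  assumes "0 \<notin> set u"
  shows "hsum u n \<le> harm n ^ length u"
  using assms
proof (induction u arbitrary: n)
  case (Cons a u)
  have "hsum (a # u) n \<le> (\<Sum>k\<in>{1..<n}. harm n ^ length u * (1 / real k))"
    unfolding hsum.simps(2)
  proof (rule sum_mono)
    fix k assume k: "k \<in> {1..<n}"
    have "hsum u k \<le> harm k ^ length u" using Cons by auto
    also have "\<dots> \<le> harm n ^ length u"
      using k by (intro power_mono harm_mono) (auto intro: harm_nonneg)
    finally have "hsum u k / real k ^ a \<le> harm n ^ length u / real k ^ 1"
      using k Cons.prems power_increasing[of 1 a "real k"] neq0_conv[of a]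
      by (intro frac_le zero_le_power hsum_nonneg) (auto intro: harm_nonneg)
    thus "hsum u k / real k ^ a \<le> harm n ^ length u * (1 / real k)" by simp
  qed
  also have "\<dots> = harm n ^ length u * (\<Sum>k\<in>{1..<n}. 1 / real k)"
    by (simp add: sum_distrib_left)
  also have "\<dots> \<le> harm n ^ length u * harm n"
    unfolding harm_def inverse_eq_divide
    by (intro mult_left_mono sum_mono2 zero_le_power sum_nonneg) auto
  finally show ?case by (simp add: mult.commute)
qed auto

text \<open>The growth is at most a power of log n. The cruder n^(1/2) is enough for convergence:
  division by k^a with a >= 2 leaves k^(-3/2).\<close>

lemma hsum_le_powr:
  assumes "0 \<notin> set u"
  obtains C where "C > 0" "\<And>n. n > 0 \<Longrightarrow> hsum u n \<le> C * real n powr (1/2)"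
proof -
  define r where "r = real (length u) + 1"
  \<comment> \<open>Makes \<open>d * length u\<close> less than 1/2; the 1 added in r avoids
    division by zero for the empty list.\<close>
  define d where "d = 1 / (2 * r)"
  have r: "r > 0" and d: "d > 0" by (auto simp: r_def d_def)
  show ?thesis
  proof
    show "(1 + 1 / d) ^ length u > 0" using d by (intro zero_less_power) (auto simp: field_simps)
    fix n :: nat assume n: "n > 0"
    have "hsum u n \<le> harm n ^ length u" by (rule hsum_le_harm[OF assms])
    also have "\<dots> \<le> ((1 + 1 / d) * real n powr d) ^ length u"
      using d n by (intro power_mono harm_le_powr harm_nonneg) auto
    also have "\<dots> = (1 + 1 / d) ^ length u * real n powr (d * length u)"
      using n by (simp add: power_mult_distrib powr_realpow[symmetric] powr_powr)
    also have "\<dots> \<le> (1 + 1 / d) ^ length u * real n powr (1 / 2)"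
      using n d by (intro mult_left_mono powr_mono) (auto simp: d_def r_def field_simps)
    finally show "hsum u n \<le> (1 + 1 / d) ^ length u * real n powr (1 / 2)" .
  qed
qed

lemma summable_hsum:
  assumes "admissible (a # u)"
  shows "summable (\<lambda>k. hsum u (Suc k) / real (Suc k) ^ a)"
proof -
  from assms have u: "0 \<notin> set u" and a: "a \<ge> 2" by auto
  obtain C where C: "C > 0" "\<And>n. n > 0 \<Longrightarrow> hsum u n \<le> C * real n powr (1/2)"
    using hsum_le_powr[OF u] by blast
  have "summable (\<lambda>k. C * real (Suc k) powr (-3/2))"
    by (intro summable_mult) (subst summable_Suc_iff, simp add: summable_real_powr_iff)
  then show ?thesis
  proof (rule summable_comparison_test')
    fix k :: nat
    have "hsum u (Suc k) / real (Suc k) ^ a \<le> C * real (Suc k) powr (1/2) / real (Suc k) ^ 2"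
      using a C(1) C(2)[of "Suc k"] power_increasing[of 2 a "real (Suc k)"]
      by (intro frac_le) (auto simp: hsum_nonneg)
    also have "\<dots> = C * (real (Suc k) powr (1/2) / real (Suc k) powr 2)"
      by (simp add: powr_numeral)
    also have "\<dots> = C * real (Suc k) powr (-3/2)"
      unfolding powr_diff[symmetric] by simp
    finally show "norm (hsum u (Suc k) / real (Suc k) ^ a) \<le> C * real (Suc k) powr (-3/2)"
      by (simp add: hsum_nonneg)
  qed
qed

lemma hsum_Cons_conv_lessThan: "hsum (a # u) (Suc n) = (\<Sum>k<n. hsum u (Suc k) / real (Suc k) ^ a)"
  by (induction n) (auto simp: hsum_Suc)

lemma hsum_tendsto:
  assumes "admissible u"
  shows "hsum u \<longlonglongrightarrow> mzv u"
proof (cases u)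
  case (Cons a v)
  have "(\<lambda>n. hsum u (Suc n)) \<longlonglongrightarrow> (\<Sum>k. hsum v (Suc k) / real (Suc k) ^ a)"
    unfolding Cons hsum_Cons_conv_lessThan
    using summable_hsum assms Cons by (intro summable_LIMSEQ) auto
  then show ?thesis
    unfolding mzv_def by (subst (asm) filterlim_sequentially_Suc) (simp add: limI)
qed (auto simp: mzv_def)

lemma mzv_Nil [simp]: "mzv [] = 1"
  by (simp add: mzv_def)

lemma mzv_sums:
  assumes "admissible (a # u)"
  shows "(\<lambda>k. hsum u (Suc k) / real (Suc k) ^ a) sums mzv (a # u)"
  unfolding sums_def hsum_Cons_conv_lessThan[symmetric]
  using hsum_tendsto[OF assms] by (subst filterlim_sequentially_Suc)

lemma zero_notin_stuffle:
  assumes "0 \<notin> set u" "0 \<notin> set v"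
  shows "\<forall>w\<in>set (stuffle u v). 0 \<notin> set w"
  using assms
proof (induction u v rule: stuffle.induct)
  case (3 a u b v)
  have "\<forall>w\<in>set (stuffle u (b # v)). 0 \<notin> set w" "\<forall>w\<in>set (stuffle (a # u) v). 0 \<notin> set w"
    "\<forall>w\<in>set (stuffle u v). 0 \<notin> set w"
    by (rule 3(1) 3(2) 3(3); use "3.prems" in simp)+
  moreover have "a \<noteq> 0" "b \<noteq> 0" using "3.prems" by auto
  ultimately show ?case by (simp add: ball_Un)
qed auto

lemma admissible_stuffle:
  assumes "admissible u" "admissible v" "w \<in> set (stuffle u v)"
  shows "admissible w"
proof (cases "u = [] \<or> v = []")
  case False
  then obtain a u' b v' where uv: "u = a # u'" "v = b # v'"
    by (metis list.exhaust)
  have *: "0 \<notin> set u'" "0 \<notin> set v'" "a \<ge> 2" "b \<ge> 2" "0 \<notin> set u" "0 \<notin> set v"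
    using assms(1,2) by (auto simp: uv)
  show ?thesis
    using assms(3) * zero_notin_stuffle[OF *(1,6)] zero_notin_stuffle[OF *(5,2)]
      zero_notin_stuffle[OF *(1,2)]
    unfolding uv stuffle.simps set_append set_map Un_iff image_iff
    by (elim disjE bexE) simp_all
qed (use assms in auto)

lemma tendsto_sum_list:
  assumes "\<And>w. w \<in> set ws \<Longrightarrow> ((\<lambda>n. f w n :: real) \<longlongrightarrow> g w) F"
  shows "((\<lambda>n. \<Sum>w\<leftarrow>ws. f w n) \<longlongrightarrow> (\<Sum>w\<leftarrow>ws. g w)) F"
  using assms by (induction ws) (auto intro!: tendsto_add)

theorem mzv_stuffle:
  assumes "admissible u" "admissible v"
  shows "mzv u * mzv v = (\<Sum>w\<leftarrow>stuffle u v. mzv w)"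
proof (rule LIMSEQ_unique)
  show "(\<lambda>n. hsum u n * hsum v n) \<longlonglongrightarrow> mzv u * mzv v"
    by (intro tendsto_mult hsum_tendsto assms)
  show "(\<lambda>n. hsum u n * hsum v n) \<longlonglongrightarrow> (\<Sum>w\<leftarrow>stuffle u v. mzv w)"
    unfolding hsum_stuffle using assms
    by (intro tendsto_sum_list hsum_tendsto) (auto intro: admissible_stuffle)
qed

subsection \<open>The shuffle product\<close>

text \<open>\<open>wcoeff w n\<close> is the \<open>n\<close>-th Taylor coefficient of the multiple polylogarithm of the word \<open>w\<close>, that is, of the
  iterated integral in which \<open>True\<close> stands for \<open>dt / (1 - t)\<close> and \<open>False\<close> for \<open>dt / t\<close>.\<close>

fun wcoeff :: "bool list \<Rightarrow> nat \<Rightarrow> real" where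
  "wcoeff [] n = (if n = 0 then 1 else 0)"
| "wcoeff (False # w) n = wcoeff w n / real n"
| "wcoeff (True # w) n = (\<Sum>m<n. wcoeff w m) / real n"

definition polylog_fps :: "bool list \<Rightarrow> real fps" where
  "polylog_fps w = Abs_fps (wcoeff w)"

lemma polylog_fps_nth [simp]: "polylog_fps w $ n = wcoeff w n"
  by (simp add: polylog_fps_def)

fun shuffle :: "bool list \<Rightarrow> bool list \<Rightarrow> bool list list" where
  "shuffle [] v = [v]"
| "shuffle u [] = [u]"
| "shuffle (x # u) (y # v) = map (Cons x) (shuffle u (y # v)) @ map (Cons y) (shuffle (x # u) v)"

text \<open>Words whose innermost form is dt/(1 - t). The word \<open>[False]\<close> would be log
  t, which has no power series at 0; with x / 0 = 0 its coefficients are all 0, and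
  \<open>theta_polylog\<close> would fail for it.\<close>

definition closed_word :: "bool list \<Rightarrow> bool" where
  "closed_word w \<longleftrightarrow> w = [] \<or> last w"

lemma closed_word_Nil [simp]: "closed_word []"
  by (simp add: closed_word_def)

lemma closed_word_Cons: "closed_word (x # w) \<longleftrightarrow> closed_word w \<and> (w = [] \<longrightarrow> x)"
  by (auto simp: closed_word_def)

lemma shuffle_closed_word:
  assumes "closed_word u" "closed_word v"
  shows "\<forall>w\<in>set (shuffle u v). closed_word w \<and> (w = [] \<longrightarrow> u = [] \<and> v = [])"
  using assms
proof (induction u v rule: shuffle.induct)
  case (3 x u y v)
  have "\<forall>w\<in>set (shuffle u (y # v)). closed_word w \<and> (w = [] \<longrightarrow> u = [] \<and> y # v = [])"
    by (rule 3(1)) (use "3.prems" in \<open>simp_all add: closed_word_Cons\<close>)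
  moreover have "\<forall>w\<in>set (shuffle (x # u) v). closed_word w \<and> (w = [] \<longrightarrow> x # u = [] \<and> v = [])"
    by (rule 3(2)) (use "3.prems" in \<open>simp_all add: closed_word_Cons\<close>)
  ultimately show ?case by (simp add: ball_Un closed_word_Cons)
qed auto

text \<open>The Euler operator t d/dt. It turns the two differential forms into the power series
  t/(1 - t) and 1, which are the values of \<open>letter_fps\<close>.\<close>

definition theta :: "real fps \<Rightarrow> real fps" where
  "theta f = fps_X * fps_deriv f"

lemma theta_nth [simp]: "theta f $ n = real n * f $ n"
  by (cases n) (auto simp: theta_def)

lemma theta_mult: "theta (f * g) = theta f * g + f * theta g"
  by (simp add: theta_def algebra_simps)

lemma theta_eqI:
  assumes "theta f = theta g" "f $ 0 = g $ 0"
  shows "f = g"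
proof (rule fps_ext)
  fix n
  have "theta f $ n = theta g $ n" using assms by simp
  then show "f $ n = g $ n" using assms(2) by (cases "n = 0") auto
qed

definition letter_fps :: "bool \<Rightarrow> real fps" where
  "letter_fps x = (if x then Abs_fps (\<lambda>n. if n = 0 then 0 else 1) else 1)"

lemma wcoeff_0: "w \<noteq> [] \<Longrightarrow> wcoeff w 0 = 0"
  by (cases "(w, 0::nat)" rule: wcoeff.cases) auto

lemma theta_polylog:
  assumes "closed_word (x # w)"
  shows "theta (polylog_fps (x # w)) = polylog_fps w * letter_fps x"
proof (rule fps_ext)
  fix n
  show "theta (polylog_fps (x # w)) $ n = (polylog_fps w * letter_fps x) $ n"
  proof (cases x)
    case True
    have "(polylog_fps w * letter_fps x) $ n =
        (\<Sum>i\<in>{0..n}. wcoeff w i * (if n - i = 0 then 0 else 1))"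
      by (simp add: fps_mult_nth letter_fps_def True)
    also have "\<dots> = (\<Sum>i<n. wcoeff w i)"
      by (intro sum.mono_neutral_cong_right) auto
    finally show ?thesis using True by simp
  next
    case False
    then have "w \<noteq> []" using assms by (auto simp: closed_word_Cons)
    then show ?thesis using False by (cases "n = 0") (auto simp: letter_fps_def wcoeff_0)
  qed
qed

lemma theta_polylog_sum:
  assumes "\<forall>w\<in>set ws. closed_word (x # w)"
  shows "theta (\<Sum>w\<leftarrow>map (Cons x) ws. polylog_fps w) = (\<Sum>w\<leftarrow>ws. polylog_fps w) * letter_fps x"
  using assms
proof (induction ws)
  case (Cons w ws)
  have "theta (f + g) = theta f + theta g" for f g
    by (simp add: theta_def algebra_simps)
  with Cons show ?case by (simp add: theta_polylog distrib_right)
qed (simp add: theta_def)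

lemma sum_list_polylog_nth: "(\<Sum>w\<leftarrow>ws. polylog_fps w) $ n = (\<Sum>w\<leftarrow>ws. wcoeff w n)"
  by (induction ws) auto

text \<open>Applying \<open>theta\<close> removes the outermost form of an iterated integral, so the
  Leibniz rule for a product of two polylogarithms is the recursion of \<open>shuffle\<close>. The
  constant terms, which \<open>theta\<close> forgets, vanish for nonempty words.\<close>

lemma polylog_shuffle:
  assumes "closed_word u" "closed_word v"
  shows "polylog_fps u * polylog_fps v = (\<Sum>w\<leftarrow>shuffle u v. polylog_fps w)"
  using assms
proof (induction u v rule: shuffle.induct)
  case (1 v)
  have "polylog_fps [] = 1" by (rule fps_ext) simp
  then show ?case by simp
next
  case (2 x u)
  have "polylog_fps [] = 1" by (rule fps_ext) simp
  then show ?case by simp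
next
  case (3 x u y v)
  have uv: "closed_word u" "closed_word v" using "3.prems" by (auto simp: closed_word_Cons)
  have c: "\<forall>w\<in>set (shuffle u (y # v)). closed_word (x # w)"
    "\<forall>w\<in>set (shuffle (x # u) v). closed_word (y # w)"
    using shuffle_closed_word[OF uv(1) "3.prems"(2)] shuffle_closed_word[OF "3.prems"(1) uv(2)]
    by (auto simp: closed_word_Cons)
  have IH: "polylog_fps u * polylog_fps (y # v) = (\<Sum>w\<leftarrow>shuffle u (y # v). polylog_fps w)"
    "polylog_fps (x # u) * polylog_fps v = (\<Sum>w\<leftarrow>shuffle (x # u) v. polylog_fps w)"
    using "3.IH" "3.prems" uv by blast+
  show ?case
  proof (rule theta_eqI)
    have "theta (polylog_fps (x # u) * polylog_fps (y # v)) =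
        polylog_fps u * polylog_fps (y # v) * letter_fps x + polylog_fps (x # u) * polylog_fps v * letter_fps y"
      by (simp add: theta_mult theta_polylog[OF "3.prems"(1)] theta_polylog[OF "3.prems"(2)] mult_ac)
    also have "\<dots> = theta (\<Sum>w\<leftarrow>shuffle (x # u) (y # v). polylog_fps w)"
      unfolding IH theta_polylog_sum[OF c(1), symmetric] theta_polylog_sum[OF c(2), symmetric]
      by (simp add: theta_def algebra_simps)
    finally show "theta (polylog_fps (x # u) * polylog_fps (y # v)) =
        theta (\<Sum>w\<leftarrow>shuffle (x # u) (y # v). polylog_fps w)" .
    have "(\<Sum>w\<leftarrow>shuffle (x # u) (y # v). wcoeff w 0) = (\<Sum>w\<leftarrow>shuffle (x # u) (y # v). 0)"
      using shuffle_closed_word[OF "3.prems"]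
      by (intro arg_cong[of _ _ sum_list] map_cong refl wcoeff_0) auto
    then show "(polylog_fps (x # u) * polylog_fps (y # v)) $ 0 =
        (\<Sum>w\<leftarrow>shuffle (x # u) (y # v). polylog_fps w) $ 0"
      unfolding sum_list_polylog_nth by (simp add: wcoeff_0)
  qed
qed

section \<open>Translation between words and indices, and evaluation of polylogarithms at 1\<close>

fun index_of :: "bool list \<Rightarrow> nat list" where
  "index_of [] = []"
| "index_of (True # w) = 1 # index_of w"
| "index_of (False # w) = (case index_of w of [] \<Rightarrow> [] | a # u \<Rightarrow> Suc a # u)"

fun word_of :: "nat list \<Rightarrow> bool list" where
  "word_of [] = []"
| "word_of (a # u) = replicate (a - 1) False @ True # word_of u"

lemma index_of_replicate:
  "index_of (replicate k False @ True # w) = Suc k # index_of w"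
  by (induction k) auto

lemma index_of_word_of: "0 \<notin> set u \<Longrightarrow> index_of (word_of u) = u"
  by (induction u) (auto simp: index_of_replicate)

lemma closed_word_word_of: "closed_word (word_of u)"
proof (induction u)
  case (Cons a u)
  have "closed_word (replicate k False @ True # word_of u)" for k
    using Cons by (induction k) (auto simp: closed_word_Cons)
  then show ?case by simp
qed auto

text \<open>The n-th coefficient freezes the largest summation variable at n. The clause on
  \<open>hd w\<close> supplies the exponent a >= 2 that makes the series converge at t = 1.\<close>

lemma wcoeff_index_of:
  assumes "closed_word w" "w \<noteq> []"
  obtains a u where "index_of w = a # u" "a \<ge> 1" "0 \<notin> set u" "\<not> hd w \<longrightarrow> a \<ge> 2"
    "\<And>n. wcoeff w n = (if n = 0 then 0 else hsum u n / real n ^ a)"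
proof -
  have "\<exists>a u. index_of w = a # u \<and> a \<ge> 1 \<and> 0 \<notin> set u \<and> (\<not> hd w \<longrightarrow> a \<ge> 2) \<and>
      (\<forall>n. wcoeff w n = (if n = 0 then 0 else hsum u n / real n ^ a))"
    using assms
  proof (induction w)
    case (Cons x w)
    show ?case
    proof (cases "w = []")
      case True
      then have "x" using Cons.prems by (simp add: closed_word_Cons)
      moreover have "(\<Sum>m<n. if m = 0 then 1 else 0 :: real) = 1" if "n > 0" for n :: nat
        using that by (subst sum.delta) auto
      ultimately show ?thesis using True by auto
    next
      case False
      with Cons obtain a u where *: "index_of w = a # u" "a \<ge> 1" "0 \<notin> set u"
        "\<And>n. wcoeff w n = (if n = 0 then 0 else hsum u n / real n ^ a)"
        by (auto simp: closed_word_Cons)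
      show ?thesis
      proof (cases x)
        case True
        have "(\<Sum>m<n. wcoeff w m) = hsum (a # u) n" if "n > 0" for n
          unfolding hsum.simps(2) *(4) using that
          by (intro sum.mono_neutral_cong_right) auto
        then show ?thesis using True * by auto
      next
        case False
        then show ?thesis using * by auto
      qed
    qed
  qed auto
  then show ?thesis using that by blast
qed

lemma wcoeff_sums:
  assumes "closed_word w" "w = [] \<or> \<not> hd w"
  shows "wcoeff w sums mzv (index_of w)"
proof (cases "w = []")
  case True
  show ?thesis using sums_finite[of "{0}" "wcoeff []"] by (simp add: True)
next
  case False
  from wcoeff_index_of[OF assms(1) this] obtain a u where *: "index_of w = a # u"
    "0 \<notin> set u" "\<not> hd w \<longrightarrow> a \<ge> 2"
    "\<And>n. wcoeff w n = (if n = 0 then 0 else hsum u n / real n ^ a)" by metis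
  have "(\<lambda>n. wcoeff w (Suc n)) sums mzv (index_of w)"
    using mzv_sums[of a u] * False assms(2) by simp
  then show ?thesis by (subst (asm) sums_Suc_iff) (simp add: *(4))
qed

lemma wcoeff_nonneg: "wcoeff w n \<ge> 0"
  by (induction w n rule: wcoeff.induct) (auto intro!: sum_nonneg divide_nonneg_nonneg)

lemma sums_sum_list:
  assumes "\<And>w. w \<in> set ws \<Longrightarrow> (f w :: nat \<Rightarrow> real) sums g w"
  shows "(\<lambda>n. \<Sum>w\<leftarrow>ws. f w n) sums (\<Sum>w\<leftarrow>ws. g w)"
  using assms by (induction ws) (auto intro!: sums_add)

lemma hd_word_of: "admissible u \<Longrightarrow> word_of u = [] \<or> \<not> hd (word_of u)"
  by (cases u) (auto simp: hd_append)

lemma shuffle_hd: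
  assumes "u = [] \<or> \<not> hd u" "v = [] \<or> \<not> hd v"
  shows "\<forall>w\<in>set (shuffle u v). w = [] \<or> \<not> hd w"
  using assms by (cases "(u, v)" rule: shuffle.cases) auto

text \<open>This is \<open>polylog_shuffle\<close> evaluated at t = 1. The coefficients are
  nonnegative, so the Cauchy product of the two convergent series sums to the product of their
  values.\<close>

theorem mzv_shuffle:
  assumes "admissible u" "admissible v"
  shows "mzv u * mzv v = (\<Sum>w\<leftarrow>shuffle (word_of u) (word_of v). mzv (index_of w))"
proof (rule sums_unique2)
  let ?u = "word_of u" and ?v = "word_of v"
  have ind: "index_of ?u = u" "index_of ?v = v"
    using assms by (auto intro!: index_of_word_of elim: admissible.elims)
  have su: "wcoeff ?u sums mzv u" and sv: "wcoeff ?v sums mzv v"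
    using wcoeff_sums[OF closed_word_word_of hd_word_of] assms ind by metis+
  have "(\<lambda>n. \<Sum>i\<le>n. wcoeff ?u i * wcoeff ?v (n - i)) sums (mzv u * mzv v)"
    using Cauchy_product_sums[of "wcoeff ?u" "wcoeff ?v"] su sv
    by (simp add: sums_iff wcoeff_nonneg)
  then show "(\<lambda>n. (polylog_fps ?u * polylog_fps ?v) $ n) sums (mzv u * mzv v)"
    by (simp add: fps_mult_nth atLeast0AtMost)
  show "(\<lambda>n. (polylog_fps ?u * polylog_fps ?v) $ n) sums
      (\<Sum>w\<leftarrow>shuffle ?u ?v. mzv (index_of w))"
    unfolding polylog_shuffle[OF closed_word_word_of closed_word_word_of] sum_list_polylog_nth
    using shuffle_closed_word[OF closed_word_word_of closed_word_word_of]
      shuffle_hd[OF hd_word_of hd_word_of] assms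
    by (intro sums_sum_list wcoeff_sums) blast+
qed

subsection \<open>Hoffman's relation\<close>

lemma hsum_one_diff_eq:
  assumes "m < N"
  shows "hsum [1] N - hsum [1] (N - m) = (\<Sum>k\<in>{N - m..<N}. 1 / real k)"
proof -
  have "sum (\<lambda>k. 1 / real k) {1..<N} = sum (\<lambda>k. 1 / real k) {1..<N - m} + sum (\<lambda>k. 1 / real k) {N - m..<N}"
    using assms by (subst sum.atLeastLessThan_concat) auto
  then show ?thesis by (simp add: hsum.simps(2))
qed

text \<open>The m reciprocals from 1/(N - m) to 1/(N - 1) are compared one by one with those from 1
  to 1/m. The bound does not depend on N and can therefore serve in a majorant.\<close>

lemma hsum_one_diff_le:
  assumes "m < N"
  shows "hsum [1] N - hsum [1] (N - m) \<le> hsum [1] (Suc m)"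
proof -
  have "hsum [1] N - hsum [1] (N - m) = (\<Sum>k\<in>{1..<Suc m}. 1 / real (k + (N - m - 1)))"
    unfolding hsum_one_diff_eq[OF assms]
    by (rule sum.reindex_bij_witness[of _ "\<lambda>k. k + (N - m - 1)" "\<lambda>k. k - (N - m - 1)"])
      (use assms in auto)
  also have "\<dots> \<le> (\<Sum>k\<in>{1..<Suc m}. 1 / real k)"
    by (intro sum_mono frac_le) auto
  finally show ?thesis by (simp add: hsum.simps(2))
qed

lemma hsum_one_diff_tendsto: "(\<lambda>N. hsum [1] N - hsum [1] (N - m)) \<longlonglongrightarrow> 0"
proof (rule Lim_transform_eventually)
  have "(\<lambda>N. 1 / (real N - real (Suc i))) \<longlonglongrightarrow> 0" for i
    by real_asymp
  then have "(\<lambda>N. \<Sum>i<m. 1 / (real N - real (Suc i))) \<longlonglongrightarrow> (\<Sum>i<m. 0)"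
    by (intro tendsto_sum)
  then show "(\<lambda>N. \<Sum>i<m. 1 / (real N - real (Suc i))) \<longlonglongrightarrow> 0" by simp
  show "\<forall>\<^sub>F N in sequentially. (\<Sum>i<m. 1 / (real N - real (Suc i))) = hsum [1] N - hsum [1] (N - m)"
    using eventually_gt_at_top[of m]
  proof eventually_elim
    case (elim N)
    show ?case
      unfolding hsum_one_diff_eq[OF elim]
      by (rule sum.reindex_bij_witness[of _ "\<lambda>k. N - Suc k" "\<lambda>i. N - Suc i"])
        (use elim in \<open>auto simp: of_nat_diff\<close>)
  qed
qed

text \<open>This is the majorant for the interchange of limits in \<open>mzv_hoffman\<close>. The
  product of \<open>hsum v\<close> and \<open>hsum [1]\<close> is expanded by the stuffle product,
  which leaves the leading exponent a untouched; passing from m to \<open>Suc m\<close> in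
  \<open>hsum [1]\<close> adds a series with leading exponent \<open>Suc a\<close>.\<close>

lemma summable_hsum_mult_one:
  assumes "admissible (a # v)"
  shows "summable (\<lambda>m. hsum v m / real m ^ a * hsum [1] (Suc m))" (is "summable ?M")
proof -
  let ?ws = "map (Cons a) (stuffle [1] v)"
  have adm: "admissible (a # w)" if "w \<in> set (stuffle [1] v)" for w
    using that zero_notin_stuffle[of "[1]" v] assms by auto
  have s1: "summable (\<lambda>n. \<Sum>w\<leftarrow>stuffle [1] v. hsum w (Suc n) / real (Suc n) ^ a)"
    by (rule sums_summable, rule sums_sum_list, rule mzv_sums, rule adm)
  have s2: "summable (\<lambda>n. hsum v (Suc n) / real (Suc n) ^ (Suc a))"
    using assms by (intro summable_hsum) auto
  have div: "(\<Sum>w\<leftarrow>ws. hsum w n / x) = (\<Sum>w\<leftarrow>ws. hsum w n) / x" for ws n x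
    by (induction ws) (auto simp: add_divide_distrib)
  have "(\<Sum>w\<leftarrow>stuffle [1] v. hsum w (Suc n) / real (Suc n) ^ a) + hsum v (Suc n) / real (Suc n) ^ (Suc a)
      = ?M (Suc n)" for n
    unfolding div hsum_stuffle[symmetric]
    by (simp add: hsum_Suc[of "Suc 0" "[]" "Suc n"] field_simps del: of_nat_Suc)
  with summable_add[OF s1 s2] have "summable (\<lambda>n. ?M (Suc n))" by simp
  then show ?thesis by (subst (asm) summable_Suc_iff)
qed

text \<open>The stuffle product truncates the product of the divergent \<open>\<zeta>(1)\<close> and \<open>\<zeta>(u)\<close> to index pairs in a square, the shuffle
  product to pairs in a triangle; both contain the same divergent term, which is the head of the two lists,
  and the difference between square and triangle tends to 0.\<close>

lemma mzv_hoffman: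
  assumes "admissible u" "u \<noteq> []"
  shows "(\<Sum>w\<leftarrow>tl (shuffle [True] (word_of u)). mzv (index_of w)) = (\<Sum>w\<leftarrow>tl (stuffle [1] u). mzv w)"
proof -
  obtain a v where u: "u = a # v" "a \<ge> 2" "0 \<notin> set v"
    using assms by (cases u) auto
  define c where "c = wcoeff (word_of u)"
  have c: "c n = (if n = 0 then 0 else hsum v n / real n ^ a)" for n
  proof -
    have "word_of u \<noteq> []" by (simp add: u)
    from wcoeff_index_of[OF closed_word_word_of this] obtain a' v' where
      "index_of (word_of u) = a' # v'"
      "\<And>n. wcoeff (word_of u) n = (if n = 0 then 0 else hsum v' n / real n ^ a')" by metis
    moreover have "index_of (word_of u) = u" using u by (intro index_of_word_of) auto
    ultimately show ?thesis using u by (simp add: c_def)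
  qed
  have c_sum: "(\<Sum>m<n. c m) = hsum u n" if "n > 0" for n
    unfolding u hsum.simps(2) c using that by (intro sum.mono_neutral_cong_right) auto
  define y where "y = hd (word_of u)"
  define t where "t = tl (word_of u)"
  have wu: "word_of u = y # t" by (simp add: y_def t_def u)
  have y: "\<not> y" using hd_word_of[OF assms(1)] by (simp add: wu)
  have cl: "closed_word (y # t)" using closed_word_word_of[of u] wu by simp
  \<comment> \<open>The Cauchy coefficients of the shuffle side; their partial sums run over the
    triangle m + i < N.\<close>
  define d where "d n = (\<Sum>i\<le>n. wcoeff [True] i * c (n - i))" for n
  have d: "d n = (\<Sum>w\<leftarrow>tl (shuffle [True] (word_of u)). wcoeff w n) + wcoeff (True # word_of u) n" for n
  proof -
    have "d n = (polylog_fps [True] * polylog_fps (word_of u)) $ n"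
      by (simp add: d_def c_def fps_mult_nth atLeast0AtMost)
    also have "\<dots> = (\<Sum>w\<leftarrow>shuffle [True] (word_of u). wcoeff w n)"
      by (subst polylog_shuffle) (auto simp: closed_word_word_of closed_word_Cons sum_list_polylog_nth)
    finally show ?thesis by (simp add: wu)
  qed
  have lim1: "(\<lambda>N. (\<Sum>n<N. \<Sum>w\<leftarrow>tl (shuffle [True] (word_of u)). wcoeff w n))
      \<longlonglongrightarrow> (\<Sum>w\<leftarrow>tl (shuffle [True] (word_of u)). mzv (index_of w))"
  proof -
    have "closed_word w \<and> (w = [] \<or> \<not> hd w)" if "w \<in> set (tl (shuffle [True] (word_of u)))" for w
    proof -
      have "w \<in> set (map (Cons y) (shuffle [True] t))" using that by (simp add: wu)
      then obtain w' where w': "w = y # w'" "w' \<in> set (shuffle [True] t)" by auto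
      have "w \<in> set (shuffle [True] (y # t))" using w' by simp
      moreover have "closed_word [True]" by (simp add: closed_word_Cons)
      ultimately have "closed_word w" using shuffle_closed_word[OF _ cl] by blast
      then show ?thesis using w' y by simp
    qed
    then show ?thesis
      unfolding sums_def[symmetric] by (intro sums_sum_list wcoeff_sums) auto
  qed
  have lim2: "(\<lambda>N. (\<Sum>w\<leftarrow>tl (stuffle [1] u). hsum w N)) \<longlonglongrightarrow> (\<Sum>w\<leftarrow>tl (stuffle [1] u). mzv w)"
  proof (intro tendsto_sum_list hsum_tendsto)
    fix w assume "w \<in> set (tl (stuffle [1] u))"
    then consider w' where "w = a # w'" "w' \<in> set (stuffle [1] v)" | "w = Suc a # v"
      by (auto simp: u)
    then show "admissible w"
      using zero_notin_stuffle[of "[1]" v] u by cases auto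
  qed
  \<comment> \<open>Row m of the square minus row m of the triangle: the inner variable runs over
    \<open>{N - m..<N}\<close>. The value 0 for m >= N turns the finite sum over m into a series, to
    which Tannery's theorem applies.\<close>
  define e where "e m N = (if m < N then c m * (hsum [1] N - hsum [1] (N - m)) else 0)" for m N
  have e: "hsum [1] N * hsum u N - (\<Sum>n<N. d n) = (\<Sum>m<N. e m N)" if "N > 0" for N
  proof -
    have T: "wcoeff [True] i = (if i = 0 then 0 else 1 / real i)" for i
    proof -
      have "(\<Sum>m<i. if m = 0 then 1 else 0 :: real) = 1" if "i > 0"
        using that by (subst sum.delta) auto
      then show ?thesis by simp
    qed
    have h1: "(\<Sum>i<n. wcoeff [True] i) = hsum [1] n" for n
      unfolding hsum.simps(2) T by (intro sum.mono_neutral_cong_right) auto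
    have "d n = (\<Sum>i\<le>n. c i * wcoeff [True] (n - i))" for n
      unfolding d_def
      by (rule sum.reindex_bij_witness[of _ "\<lambda>i. n - i" "\<lambda>i. n - i"])
        (auto simp: mult.commute simp del: wcoeff.simps)
    then have "(\<Sum>n<N. d n) = (\<Sum>n<N. \<Sum>i\<le>n. c i * wcoeff [True] (n - i))" by simp
    also have "\<dots> = (\<Sum>(m, i)\<in>{(m, i). m + i < N}. c m * wcoeff [True] i)"
      by (rule sum.triangle_reindex[symmetric])
    also have "{(m, i). m + i < N} = (SIGMA m:{..<N}. {..<N - m})"
      by auto
    also have "(\<Sum>(m, i)\<in>(SIGMA m:{..<N}. {..<N - m}). c m * wcoeff [True] i) =
        (\<Sum>m<N. \<Sum>i<N - m. c m * wcoeff [True] i)"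
      by (rule sum.Sigma[symmetric]) auto
    also have "\<dots> = (\<Sum>m<N. c m * hsum [1] (N - m))"
      by (simp only: sum_distrib_left[symmetric] h1)
    finally show ?thesis
      unfolding c_sum[OF that, symmetric]
      by (simp add: e_def sum_distrib_right sum_subtractf right_diff_distrib mult.commute)
  qed
  have e_lim: "(\<lambda>N. \<Sum>m. e m N) \<longlonglongrightarrow> (\<Sum>m. 0)"
  proof -
    define M where "M m = hsum v m / real m ^ a * hsum [1] (Suc m)" for m
    have "norm (e m N) \<le> M m" for m N
    proof (cases "m < N \<and> m > 0")
      case True
      then have "hsum [1] N - hsum [1] (N - m) \<le> hsum [1] (Suc m)"
        by (intro hsum_one_diff_le) auto
      moreover have "hsum [1] (N - m) \<le> hsum [1] N" by (intro hsum_mono) auto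
      ultimately show ?thesis
        using True by (simp add: e_def M_def c abs_mult divide_right_mono mult_left_mono hsum_nonneg)
    qed (auto simp: e_def M_def c hsum_nonneg)
    moreover have "(\<lambda>N. e m N) \<longlonglongrightarrow> 0" for m
    proof (rule Lim_transform_eventually)
      show "(\<lambda>N. c m * (hsum [1] N - hsum [1] (N - m))) \<longlonglongrightarrow> 0"
        using tendsto_mult[OF tendsto_const hsum_one_diff_tendsto, of "c m" m] by simp
      show "\<forall>\<^sub>F N in sequentially. c m * (hsum [1] N - hsum [1] (N - m)) = e m N"
        using eventually_gt_at_top[of m] by eventually_elim (simp add: e_def)
    qed
    moreover have "summable M"
      unfolding M_def using summable_hsum_mult_one assms by (simp add: u)
    ultimately show ?thesis
      using tannerys_theorem[of e "\<lambda>_. 0" sequentially M] by (simp add: case_prod_unfold)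
  qed
  have "(\<lambda>N. (\<Sum>w\<leftarrow>tl (stuffle [1] u). hsum w N) - (\<Sum>n<N. \<Sum>w\<leftarrow>tl (shuffle [True] (word_of u)). wcoeff w n))
      \<longlonglongrightarrow> 0"
  proof (rule Lim_transform_eventually)
    show "(\<lambda>N. \<Sum>m. e m N) \<longlonglongrightarrow> 0" using e_lim by simp
    show "\<forall>\<^sub>F N in sequentially. (\<Sum>m. e m N) = (\<Sum>w\<leftarrow>tl (stuffle [1] u). hsum w N)
        - (\<Sum>n<N. \<Sum>w\<leftarrow>tl (shuffle [True] (word_of u)). wcoeff w n)"
      using eventually_gt_at_top[of 0]
    proof eventually_elim
      case (elim N)
      have "(\<Sum>m. e m N) = (\<Sum>m<N. e m N)"
        by (intro suminf_finite) (auto simp: e_def)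
      also have "\<dots> = hsum [1] N * hsum u N - (\<Sum>n<N. d n)" by (rule e[OF elim, symmetric])
      also have "hsum [1] N * hsum u N = (\<Sum>w\<leftarrow>tl (stuffle [1] u). hsum w N) + hsum (1 # u) N"
        unfolding hsum_stuffle by (simp add: u)
      also have "(\<Sum>n<N. d n) = (\<Sum>n<N. \<Sum>w\<leftarrow>tl (shuffle [True] (word_of u)). wcoeff w n)
          + (\<Sum>n<N. wcoeff (True # word_of u) n)"
        by (simp only: d sum.distrib)
      also have "(\<Sum>n<N. wcoeff (True # word_of u) n) = hsum (1 # u) N"
      proof -
        have "wcoeff (True # word_of u) n = (if n = 0 then 0 else hsum u n / real n ^ 1)" for n
          using c_sum[of n] by (simp add: c_def)
        then show ?thesis
          unfolding hsum.simps(2) using elim by (intro sum.mono_neutral_cong_right) auto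
      qed
      finally show ?case by simp
    qed
  qed
  from LIMSEQ_unique[OF this tendsto_diff[OF lim2 lim1]] show ?thesis by simp
qed

subsection \<open>Telescoping the series\<close>

text \<open>Symmetric in c, d and e, while b is the direction of summation. The offset between 2 + b
  + c and 1 + c + d separates the two roles: the function decays like b^(-2) in b, but has the
  nonzero limit \<open>wz_limit\<close> as one of the other arguments grows.\<close>

definition wz_summand :: "real \<Rightarrow> real \<Rightarrow> real \<Rightarrow> real \<Rightarrow> real" where
  "wz_summand b c d e = (Gamma (1 + b) * Gamma (1 + c) * Gamma (1 + d) * Gamma (1 + e))\<^sup>2 * Gamma (2 + b + c + d + e)
     / (Gamma (2 + b + c) * Gamma (2 + b + d) * Gamma (2 + b + e)
        * Gamma (1 + c + d) * Gamma (1 + c + e) * Gamma (1 + d + e))"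

lemma Gamma_real_rec: "z > 0 \<Longrightarrow> w = z + 1 \<Longrightarrow> Gamma w = z * Gamma (z :: real)"
  using Gamma_plus1[of z] nonpos_Ints_nonpos[of z] by force

lemma wz_summand_commute: "wz_summand b c d e = wz_summand b d c e" "wz_summand b c d e = wz_summand b c e d"
  by (simp_all add: wz_summand_def add_ac mult_ac)

text \<open>Discrete closedness of a 1-form: a step in c is traded for a step in b. By the recursion
  of Gamma all four terms are rational multiples of one quantity N / M, which leaves an identity of
  rational functions.\<close>

lemma wz_summand_closed:
  assumes "b \<ge> 0" "c \<ge> 0" "d \<ge> 0" "e \<ge> 0"
  shows "wz_summand b c d e - wz_summand b (c + 1) d e = wz_summand c b d e - wz_summand c (b + 1) d e"
proof -
  define N where "N = (Gamma (1 + b) * Gamma (1 + c) * Gamma (1 + d) * Gamma (1 + e))\<^sup>2 * Gamma (2 + b + c + d + e)"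
  define M where "M = Gamma (2 + b + c) * Gamma (1 + b + d) * Gamma (1 + b + e) * Gamma (1 + c + d)
    * Gamma (1 + c + e) * Gamma (1 + d + e)"
  have r: "Gamma (2 + b + d) = (1 + b + d) * Gamma (1 + b + d)" "Gamma (2 + b + e) = (1 + b + e) * Gamma (1 + b + e)"
    "Gamma (2 + c + d) = (1 + c + d) * Gamma (1 + c + d)" "Gamma (2 + c + e) = (1 + c + e) * Gamma (1 + c + e)"
    "Gamma (2 + b) = (1 + b) * Gamma (1 + b)" "Gamma (2 + c) = (1 + c) * Gamma (1 + c)"
    "Gamma (3 + b + c + d + e) = (2 + b + c + d + e) * Gamma (2 + b + c + d + e)"
    "Gamma (3 + b + c) = (2 + b + c) * Gamma (2 + b + c)"
    by (rule Gamma_real_rec; use assms in simp)+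
  have pos: "1 + b + d > 0" "1 + b + e > 0" "1 + c + d > 0" "1 + c + e > 0" "2 + b + c > 0"
    using assms by auto
  have 1: "wz_summand b c d e = N / M * (1 / ((1 + b + d) * (1 + b + e)))"
    unfolding wz_summand_def r N_def M_def by simp
  have 2: "wz_summand b (c + 1) d e = N / M * ((1 + c)\<^sup>2 * (2 + b + c + d + e)
      / ((2 + b + c) * (1 + b + d) * (1 + b + e) * (1 + c + d) * (1 + c + e)))"
  proof -
    have a: "1 + (c + 1) = 2 + c" "2 + b + (c + 1) + d + e = 3 + b + c + d + e" "2 + b + (c + 1) = 3 + b + c"
      "2 + c + d = 1 + (c + 1) + d" by auto
    have "1 + (c + 1) + d = 2 + c + d" "1 + (c + 1) + e = 2 + c + e" by auto
    then show ?thesis unfolding wz_summand_def a(1-3) by (simp add: r N_def M_def power_mult_distrib mult_ac)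
  qed
  have 3: "wz_summand c b d e = N / M * (1 / ((1 + c + d) * (1 + c + e)))"
  proof -
    have g: "2 + c + b + d + e = 2 + b + c + d + e" "2 + c + b = 2 + b + c" by auto
    show ?thesis unfolding wz_summand_def g by (simp add: r N_def M_def power_mult_distrib mult_ac)
  qed
  have 4: "wz_summand c (b + 1) d e = N / M * ((1 + b)\<^sup>2 * (2 + b + c + d + e)
      / ((2 + b + c) * (1 + b + d) * (1 + b + e) * (1 + c + d) * (1 + c + e)))"
  proof -
    have a: "1 + (b + 1) = 2 + b" "2 + c + (b + 1) + d + e = 3 + b + c + d + e" "2 + c + (b + 1) = 3 + b + c" by auto
    have "1 + (b + 1) + d = 2 + b + d" "1 + (b + 1) + e = 2 + b + e" by auto
    then show ?thesis unfolding wz_summand_def a by (simp add: r N_def M_def power_mult_distrib mult_ac)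
  qed
  have "1 / ((1 + b + d) * (1 + b + e)) - (1 + c)\<^sup>2 * (2 + b + c + d + e)
      / ((2 + b + c) * (1 + b + d) * (1 + b + e) * (1 + c + d) * (1 + c + e)) =
      1 / ((1 + c + d) * (1 + c + e)) - (1 + b)\<^sup>2 * (2 + b + c + d + e)
      / ((2 + b + c) * (1 + b + d) * (1 + b + e) * (1 + c + d) * (1 + c + e))"
    using pos by (simp add: divide_simps) algebra
  then show ?thesis unfolding 1 2 3 4 right_diff_distrib[symmetric] by (rule arg_cong)
qed

text \<open>This is the origin of the polynomial 60 x^2 - 43 x + 8. The four values share the factor
  Gamma(1+x)^8 Gamma(2+4x) / Gamma(1+2x)^6, and their rational cofactors add up to that polynomial,
  taken at x + 1, over 8 (1+2x)^5.\<close>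

lemma f13_eq_wz_summands:
  assumes "x \<ge> 0"
  shows "f13 (x + 1) = wz_summand x x x x + wz_summand x (x + 1) x x + wz_summand x (x + 1) (x + 1) x
    + wz_summand x (x + 1) (x + 1) (x + 1)"
proof -
  define g where "g = Gamma (1 + x)"
  define h where "h = Gamma (1 + 2 * x)"
  define k where "k = Gamma (2 + 4 * x)"
  have nz: "g > 0" "h > 0" "k > 0"
    unfolding g_def h_def k_def by (rule Gamma_real_pos; use assms in simp)+
  have r1: "Gamma (2 + x) = (1 + x) * g" and r2: "Gamma (2 + 2 * x) = (1 + 2 * x) * h"
    and r4: "Gamma (3 + 4 * x) = (2 + 4 * x) * k"
    unfolding g_def h_def k_def by (rule Gamma_real_rec; use assms in simp)+
  have r3: "Gamma (3 + 2 * x) = (2 + 2 * x) * ((1 + 2 * x) * h)"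
    unfolding r2[symmetric] by (rule Gamma_real_rec; use assms in simp)
  have r5: "Gamma (4 + 4 * x) = (3 + 4 * x) * ((2 + 4 * x) * k)"
    unfolding r4[symmetric] by (rule Gamma_real_rec; use assms in simp)
  have r6: "Gamma (5 + 4 * x) = (4 + 4 * x) * ((3 + 4 * x) * ((2 + 4 * x) * k))"
    unfolding r5[symmetric] by (rule Gamma_real_rec; use assms in simp)
  have pos: "1 + 2 * x > 0" "2 + 2 * x > 0" "3 + 4 * x > 0" using assms by auto
  have 0: "f13 (x + 1) = (60 * (x + 1)\<^sup>2 - 43 * (x + 1) + 8) * ((3 + 4 * x) * ((2 + 4 * x) * k)) * g ^ 8
      / (16 * (4 * (x + 1) - 1) * ((1 + 2 * x) * h) ^ 6)"
  proof -
    have "4 * (x + 1) = 4 + 4 * x" "x + 1 = 1 + x" "2 * (x + 1) = 2 + 2 * x" by auto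
    then show ?thesis unfolding f13_def by (simp only: r5 r2 g_def)
  qed
  have a: "1 + (x + 1) = 2 + x" "2 + x + x = 2 + 2 * x" "1 + x + x = 1 + 2 * x" "2 + x + (x + 1) = 3 + 2 * x"
    "1 + (x + 1) + x = 2 + 2 * x" "1 + (x + 1) + (x + 1) = 3 + 2 * x"
    "2 + 2 * x + x + x = 2 + 4 * x" "3 + 2 * x + x + x = 3 + 4 * x" "3 + 2 * x + (x + 1) + x = 4 + 4 * x"
    "3 + 2 * x + (x + 1) + (x + 1) = 5 + 4 * x"
    by auto
  have 1: "wz_summand x x x x = g ^ 8 * k / h ^ 6 * (1 / (1 + 2 * x) ^ 3)"
    unfolding wz_summand_def a r2 g_def[symmetric] h_def[symmetric] k_def[symmetric]
    by (simp add: power_mult_distrib field_simps eval_nat_numeral)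
  have 2: "wz_summand x (x + 1) x x = g ^ 8 * k / h ^ 6 * ((1 + x)\<^sup>2 * (2 + 4 * x) / ((2 + 2 * x) * (1 + 2 * x) ^ 5))"
    unfolding wz_summand_def a r1 r2 r3 r4 g_def[symmetric] h_def[symmetric]
    by (simp add: power_mult_distrib field_simps eval_nat_numeral)
  have 3: "wz_summand x (x + 1) (x + 1) x = g ^ 8 * k / h ^ 6 * ((1 + x) ^ 4 * ((3 + 4 * x) * (2 + 4 * x))
      / ((2 + 2 * x) ^ 3 * (1 + 2 * x) ^ 6))"
    unfolding wz_summand_def a r1 r2 r3 r5 g_def[symmetric] h_def[symmetric]
    by (simp add: power_mult_distrib field_simps eval_nat_numeral)
  have 4: "wz_summand x (x + 1) (x + 1) (x + 1) = g ^ 8 * k / h ^ 6 * ((1 + x) ^ 6 * ((4 + 4 * x) * ((3 + 4 * x) * (2 + 4 * x)))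
      / ((2 + 2 * x) ^ 6 * (1 + 2 * x) ^ 6))"
    unfolding wz_summand_def a r1 r2 r3 r6 g_def[symmetric] h_def[symmetric]
    by (simp add: power_mult_distrib field_simps eval_nat_numeral)
  define s where "s = 1 + x"
  define t where "t = 1 + 2 * x"
  have st: "2 + 2 * x = 2 * s" "4 + 4 * x = 4 * s" "2 + 4 * x = 2 * t" "s \<noteq> 0" "t \<noteq> 0"
    using assms by (auto simp: s_def t_def)
  have "(60 * (x + 1)\<^sup>2 - 43 * (x + 1) + 8) * ((3 + 4 * x) * (2 + 4 * x)) / (16 * (4 * (x + 1) - 1) * (1 + 2 * x) ^ 6)
    = 1 / (1 + 2 * x) ^ 3 + (1 + x)\<^sup>2 * (2 + 4 * x) / ((2 + 2 * x) * (1 + 2 * x) ^ 5)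
      + (1 + x) ^ 4 * ((3 + 4 * x) * (2 + 4 * x)) / ((2 + 2 * x) ^ 3 * (1 + 2 * x) ^ 6)
      + (1 + x) ^ 6 * ((4 + 4 * x) * ((3 + 4 * x) * (2 + 4 * x))) / ((2 + 2 * x) ^ 6 * (1 + 2 * x) ^ 6)" (is "?L = ?R")
  proof -
    have "?L = (60 * (x + 1)\<^sup>2 - 43 * (x + 1) + 8) / (8 * t ^ 5)"
    proof -
      have "4 * (x + 1) - 1 = 3 + 4 * x" by simp
      then show ?thesis using pos st(5) unfolding t_def[symmetric] st by (simp add: divide_simps eval_nat_numeral)
    qed
    also have "\<dots> = 1 / t ^ 3 + s / t ^ 4 + s * (3 + 4 * x) / (4 * t ^ 5) + s * (3 + 4 * x) / (8 * t ^ 5)"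
      using st(5) by (simp add: divide_simps) (simp add: s_def t_def algebra_simps eval_nat_numeral)
    also have "\<dots> = ?R"
      using st(4,5) unfolding st t_def[symmetric] s_def[symmetric]
      by (simp add: divide_simps eval_nat_numeral)
    finally show ?thesis .
  qed
  moreover have "f13 (x + 1) = g ^ 8 * k / h ^ 6 * ?L"
    unfolding 0 power_mult_distrib
    by (simp only: times_divide_eq_left times_divide_eq_right divide_divide_eq_left mult_ac)
  ultimately show ?thesis unfolding 1 2 3 4 by (simp only: distrib_left)
qed

text \<open>Up to a factor free of j, the terms of the hypergeometric series 3F2 at 1 with upper
  parameters 1+c+d, 1+c+e, 1+d+e and lower parameters 2+c+d+e, 2+c+d+e.\<close>

definition thomae_summand :: "real \<Rightarrow> real \<Rightarrow> real \<Rightarrow> nat \<Rightarrow> real" where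
  "thomae_summand c d e j = (Gamma (1 + c) * Gamma (1 + d) * Gamma (1 + e))\<^sup>2
     * Gamma (1 + c + d + real j) * Gamma (1 + c + e + real j) * Gamma (1 + d + e + real j)
     / (Gamma (1 + c + d) * Gamma (1 + c + e) * Gamma (1 + d + e)
        * Gamma (1 + real j) * (Gamma (2 + c + d + e + real j))\<^sup>2)"

text \<open>A certificate in the sense of Wilf and Zeilberger: a rational multiple of the summand
  whose difference in j is the effect of a step in c. It vanishes at j = 0, so only its limit at
  infinity enters the telescoped sum.\<close>

definition thomae_cert :: "real \<Rightarrow> real \<Rightarrow> real \<Rightarrow> nat \<Rightarrow> real" where
  "thomae_cert c d e j = thomae_summand c d e j
     * (real j * (real j + 2 + 2 * c + d + e) / ((1 + c + d) * (1 + c + e)))"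

text \<open>The common limit of \<open>wz_summand c (b + real j) d e\<close> and
  \<open>thomae_cert c d e j\<close> for large j. This coincidence is the reason for combining the
  two series.\<close>

definition wz_limit :: "real \<Rightarrow> real \<Rightarrow> real \<Rightarrow> real" where
  "wz_limit c d e = (Gamma (1 + c) * Gamma (1 + d) * Gamma (1 + e))\<^sup>2
     / (Gamma (2 + c + d) * Gamma (2 + c + e) * Gamma (1 + d + e))"

lemma thomae_summand_commute: "thomae_summand c d e = thomae_summand d c e" "thomae_summand c d e = thomae_summand c e d"
  by (auto simp add: thomae_summand_def add_ac mult_ac)

text \<open>All terms are rational multiples of \<open>thomae_summand c d e j\<close>, so the claim
  is an identity of rational functions.\<close>

lemma thomae_summand_diff:
  assumes "c \<ge> 0" "d \<ge> 0" "e \<ge> 0"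
  shows "thomae_summand c d e j - thomae_summand (c + 1) d e j = thomae_cert c d e (Suc j) - thomae_cert c d e j"
proof -
  define y where "y = real j"
  have y: "y \<ge> 0" by (simp add: y_def)
  have r: "Gamma (2 + c + d + y) = (1 + c + d + y) * Gamma (1 + c + d + y)"
    "Gamma (2 + c + e + y) = (1 + c + e + y) * Gamma (1 + c + e + y)"
    "Gamma (2 + d + e + y) = (1 + d + e + y) * Gamma (1 + d + e + y)"
    "Gamma (2 + c + d) = (1 + c + d) * Gamma (1 + c + d)" "Gamma (2 + c + e) = (1 + c + e) * Gamma (1 + c + e)"
    "Gamma (2 + c) = (1 + c) * Gamma (1 + c)" "Gamma (2 + y) = (1 + y) * Gamma (1 + y)"
    "Gamma (3 + c + d + e + y) = (2 + c + d + e + y) * Gamma (2 + c + d + e + y)"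
    by (rule Gamma_real_rec; use assms y in simp)+
  have pos: "1 + c + d > 0" "1 + c + e > 0" "1 + y > 0" "2 + c + d + e + y > 0"
    using assms y by auto
  let ?t = "thomae_summand c d e j"
  have 1: "thomae_summand (c + 1) d e j = ?t * ((1 + c)\<^sup>2 * (1 + c + d + y) * (1 + c + e + y)
      / ((1 + c + d) * (1 + c + e) * (2 + c + d + e + y)\<^sup>2))"
  proof -
    have a: "1 + (c + 1) = 2 + c" "2 + (c + 1) + d + e = 3 + c + d + e" by auto
    show ?thesis unfolding thomae_summand_def a y_def[symmetric] r
      by (simp add: power_mult_distrib mult_ac)
  qed
  have 2: "thomae_cert c d e (Suc j) = ?t * ((1 + c + d + y) * (1 + c + e + y) * (1 + d + e + y)
      / ((1 + y) * (2 + c + d + e + y)\<^sup>2) * ((1 + y) * (y + 3 + 2 * c + d + e) / ((1 + c + d) * (1 + c + e))))"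
  proof -
    have a: "real (Suc j) = 1 + y" by (simp add: y_def)
    have b: "1 + c + d + (1 + y) = 2 + c + d + y" "1 + c + e + (1 + y) = 2 + c + e + y"
      "1 + d + e + (1 + y) = 2 + d + e + y" "1 + (1 + y) = 2 + y" "2 + c + d + e + (1 + y) = 3 + c + d + e + y"
      "1 + y + 2 + 2 * c + d + e = y + 3 + 2 * c + d + e" by auto
    show ?thesis unfolding thomae_cert_def thomae_summand_def a b y_def[symmetric] r
      by (simp add: power_mult_distrib mult_ac)
  qed
  have "1 - (1 + c)\<^sup>2 * (1 + c + d + y) * (1 + c + e + y) / ((1 + c + d) * (1 + c + e) * (2 + c + d + e + y)\<^sup>2)
    = (1 + c + d + y) * (1 + c + e + y) * (1 + d + e + y)
      / ((1 + y) * (2 + c + d + e + y)\<^sup>2) * ((1 + y) * (y + 3 + 2 * c + d + e) / ((1 + c + d) * (1 + c + e)))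
     - y * (y + 2 + 2 * c + d + e) / ((1 + c + d) * (1 + c + e))"
    using pos by (simp add: divide_simps) algebra
  from arg_cong[OF this, of "\<lambda>z. ?t * z"] show ?thesis
    unfolding 1 2 thomae_cert_def[of c d e j] y_def[symmetric]
    by (simp add: right_diff_distrib)
qed

section \<open>Asymptotics of Gamma quotients and limits of the boundary terms\<close>

lemma Gamma_over_powr_tendsto:
  fixes z :: real
  assumes "z > 0"
  shows "(\<lambda>j. Gamma (z + real j) / (fact j * real j powr (z - 1))) \<longlonglongrightarrow> 1"
proof -
  have G: "Gamma z \<noteq> 0" using Gamma_real_pos[OF assms] by simp
  have nz: "z \<notin> \<int>\<^sub>\<le>\<^sub>0" using assms nonpos_Ints_nonpos[of z] by force
  have "(\<lambda>n. Gamma z / Gamma_series' z n) \<longlonglongrightarrow> Gamma z / Gamma z"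
    using G by (intro tendsto_intros Gamma_series'_LIMSEQ)
  then show ?thesis
  proof (rule Lim_transform_eventually [OF tendsto_eq_rhs])
    show "\<forall>\<^sub>F n in sequentially. Gamma z / Gamma_series' z n = Gamma (z + real n) / (fact n * real n powr (z - 1))"
      using eventually_gt_at_top[of 0]
    proof eventually_elim
      case (elim n)
      then have n: "fact n = real n * fact (n - 1)" by (simp add: fact_reduce)
      have "Gamma_series' z n = fact (n - 1) * real n powr z / (Gamma (z + real n) / Gamma z)"
        using elim nz by (simp add: Gamma_series'_def pochhammer_Gamma powr_def)
      then show ?case unfolding n using elim G by (simp add: powr_diff)
    qed
  qed (use G in simp)
qed

text \<open>With three Gamma factors above and three below, the factorials in the asymptotics of the
  single factors cancel and only a power of j is left. Its exponent is 0 or 2 in the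
  applications.\<close>

lemma Gamma_ratio_tendsto:
  fixes a1 a2 a3 b1 b2 b3 :: real
  assumes "a1 > 0" "a2 > 0" "a3 > 0" "b1 > 0" "b2 > 0" "b3 > 0"
  shows "(\<lambda>j. Gamma (a1 + real j) * Gamma (a2 + real j) * Gamma (a3 + real j)
     / (Gamma (b1 + real j) * Gamma (b2 + real j) * Gamma (b3 + real j))
     * real j powr (b1 + b2 + b3 - a1 - a2 - a3)) \<longlonglongrightarrow> 1"
proof -
  define g where "g z j = Gamma (z + real j) / (fact j * real j powr (z - 1))" for z :: real and j
  have lim: "z > 0 \<Longrightarrow> g z \<longlonglongrightarrow> 1" for z
    unfolding g_def by (rule Gamma_over_powr_tendsto)
  have "(\<lambda>j. g a1 j * g a2 j * g a3 j / (g b1 j * g b2 j * g b3 j)) \<longlonglongrightarrow> 1 * 1 * 1 / (1 * 1 * 1)"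
    by (intro tendsto_intros lim assms) auto
  then show ?thesis
  proof (rule Lim_transform_eventually [OF tendsto_eq_rhs])
    show "\<forall>\<^sub>F j in sequentially. g a1 j * g a2 j * g a3 j / (g b1 j * g b2 j * g b3 j) =
      Gamma (a1 + real j) * Gamma (a2 + real j) * Gamma (a3 + real j)
     / (Gamma (b1 + real j) * Gamma (b2 + real j) * Gamma (b3 + real j))
     * real j powr (b1 + b2 + b3 - a1 - a2 - a3)"
      using eventually_gt_at_top[of 0]
    proof eventually_elim
      case (elim j)
      have "Gamma (b + real j) \<noteq> 0" if "b > 0" for b
        using that by (intro less_imp_neq[THEN not_sym] Gamma_real_pos) auto
      then have "Gamma (b1 + real j) \<noteq> 0" "Gamma (b2 + real j) \<noteq> 0" "Gamma (b3 + real j) \<noteq> 0"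
        using assms by auto
      then show ?case using elim by (simp add: g_def powr_diff powr_add field_simps)
    qed
  qed simp
qed

lemma wz_summand_tendsto:
  assumes "b \<ge> 0" "c \<ge> 0" "d \<ge> 0" "e \<ge> 0"
  shows "(\<lambda>j. wz_summand c (b + real j) d e) \<longlonglongrightarrow> wz_limit c d e"
proof -
  have "(\<lambda>j. wz_limit c d e * (Gamma (1 + b + real j) * Gamma (1 + b + real j) * Gamma (2 + c + b + d + e + real j)
     / (Gamma (2 + c + b + real j) * Gamma (1 + b + d + real j) * Gamma (1 + b + e + real j))
     * real j powr (2 + c + b + (1 + b + d) + (1 + b + e) - (1 + b) - (1 + b) - (2 + c + b + d + e))))
     \<longlonglongrightarrow> wz_limit c d e * 1"
    using assms by (intro tendsto_intros Gamma_ratio_tendsto) auto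
  then show ?thesis
  proof (rule Lim_transform_eventually [OF tendsto_eq_rhs])
    show "\<forall>\<^sub>F j in sequentially. wz_limit c d e * (Gamma (1 + b + real j) * Gamma (1 + b + real j) * Gamma (2 + c + b + d + e + real j)
     / (Gamma (2 + c + b + real j) * Gamma (1 + b + d + real j) * Gamma (1 + b + e + real j))
     * real j powr (2 + c + b + (1 + b + d) + (1 + b + e) - (1 + b) - (1 + b) - (2 + c + b + d + e)))
     = wz_summand c (b + real j) d e"
      using eventually_gt_at_top[of 0]
    proof eventually_elim
      case (elim j)
      have "2 + c + b + (1 + b + d) + (1 + b + e) - (1 + b) - (1 + b) - (2 + c + b + d + e) = 0" by simp
      then show ?case using elim
        by (simp add: wz_summand_def wz_limit_def power_mult_distrib power2_eq_square add_ac mult_ac)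
    qed
  qed simp
qed

lemma wz_summand_tendsto_2:
  assumes "b \<ge> 0" "c \<ge> 0" "d \<ge> 0" "e \<ge> 0"
  obtains L where "(\<lambda>j. wz_summand (b + real j) c d e * real j ^ 2) \<longlonglongrightarrow> L"
proof -
  define L where "L = (Gamma (1 + c) * Gamma (1 + d) * Gamma (1 + e))\<^sup>2 / (Gamma (1 + c + d) * Gamma (1 + c + e) * Gamma (1 + d + e))"
  have "(\<lambda>j. L * (Gamma (1 + b + real j) * Gamma (1 + b + real j) * Gamma (2 + b + c + d + e + real j)
     / (Gamma (2 + b + c + real j) * Gamma (2 + b + d + real j) * Gamma (2 + b + e + real j))
     * real j powr (2 + b + c + (2 + b + d) + (2 + b + e) - (1 + b) - (1 + b) - (2 + b + c + d + e))))
     \<longlonglongrightarrow> L * 1"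
    using assms by (intro tendsto_intros Gamma_ratio_tendsto) auto
  then have "(\<lambda>j. wz_summand (b + real j) c d e * real j ^ 2) \<longlonglongrightarrow> L * 1"
  proof (rule Lim_transform_eventually)
    show "\<forall>\<^sub>F j in sequentially. L * (Gamma (1 + b + real j) * Gamma (1 + b + real j) * Gamma (2 + b + c + d + e + real j)
     / (Gamma (2 + b + c + real j) * Gamma (2 + b + d + real j) * Gamma (2 + b + e + real j))
     * real j powr (2 + b + c + (2 + b + d) + (2 + b + e) - (1 + b) - (1 + b) - (2 + b + c + d + e)))
     = wz_summand (b + real j) c d e * real j ^ 2"
      using eventually_gt_at_top[of 0]
    proof eventually_elim
      case (elim j)
      have "2 + b + c + (2 + b + d) + (2 + b + e) - (1 + b) - (1 + b) - (2 + b + c + d + e) = 2" by simp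
      then show ?case using elim
        by (simp add: wz_summand_def L_def power_mult_distrib power2_eq_square[of "Gamma _"] powr_numeral add_ac mult_ac)
    qed
  qed
  with that show ?thesis by blast
qed

lemma thomae_cert_tendsto:
  assumes "c \<ge> 0" "d \<ge> 0" "e \<ge> 0"
  shows "thomae_cert c d e \<longlonglongrightarrow> wz_limit c d e"
proof -
  have r: "Gamma (2 + c + d) = (1 + c + d) * Gamma (1 + c + d)" "Gamma (2 + c + e) = (1 + c + e) * Gamma (1 + c + e)"
    by (rule Gamma_real_rec; use assms in simp)+
  have "(\<lambda>j. wz_limit c d e * (Gamma (1 + c + d + real j) * Gamma (1 + c + e + real j) * Gamma (1 + d + e + real j)
     / (Gamma (1 + real j) * Gamma (2 + c + d + e + real j) * Gamma (2 + c + d + e + real j))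
     * real j powr (1 + (2 + c + d + e) + (2 + c + d + e) - (1 + c + d) - (1 + c + e) - (1 + d + e)))
     * ((real j + 2 + 2 * c + d + e) / real j))
     \<longlonglongrightarrow> wz_limit c d e * 1 * 1"
  proof (intro tendsto_mult tendsto_const Gamma_ratio_tendsto)
    show "(\<lambda>j. (real j + 2 + 2 * c + d + e) / real j) \<longlonglongrightarrow> 1" by real_asymp
  qed (use assms in auto)
  then show ?thesis
  proof (rule Lim_transform_eventually [OF tendsto_eq_rhs])
    show "\<forall>\<^sub>F j in sequentially. wz_limit c d e * (Gamma (1 + c + d + real j) * Gamma (1 + c + e + real j) * Gamma (1 + d + e + real j)
     / (Gamma (1 + real j) * Gamma (2 + c + d + e + real j) * Gamma (2 + c + d + e + real j))
     * real j powr (1 + (2 + c + d + e) + (2 + c + d + e) - (1 + c + d) - (1 + c + e) - (1 + d + e)))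
     * ((real j + 2 + 2 * c + d + e) / real j) = thomae_cert c d e j"
      using eventually_gt_at_top[of 0]
    proof eventually_elim
      case (elim j)
      have "1 + (2 + c + d + e) + (2 + c + d + e) - (1 + c + d) - (1 + c + e) - (1 + d + e) = 2" by simp
      then show ?case using elim
        by (simp add: thomae_cert_def thomae_summand_def wz_limit_def r power2_eq_square powr_numeral mult_ac)
    qed
  qed simp
qed

lemma summable_of_tendsto_mult_square:
  fixes f :: "nat \<Rightarrow> real"
  assumes "(\<lambda>j. f j * real j ^ 2) \<longlonglongrightarrow> L"
  shows "summable f"
proof -
  from assms have "Bseq (\<lambda>j. f j * real j ^ 2)" by (intro convergent_imp_Bseq convergentI)
  then obtain K where K: "K > 0" "\<And>j. norm (f j * real j ^ 2) \<le> K" by (auto elim: BseqE)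
  have "summable (\<lambda>j. K * (1 / real j ^ 2))"
    by (intro summable_mult) (use inverse_power_summable[of 2, where 'a = real] in \<open>simp add: inverse_eq_divide\<close>)
  then show ?thesis
  proof (rule summable_comparison_test'[where N = 1])
    fix j :: nat assume "j \<ge> 1"
    then show "norm (f j) \<le> K * (1 / real j ^ 2)"
      using K(2)[of j] by (simp add: abs_mult field_simps)
  qed
qed

lemma summable_wz_summand:
  assumes "b \<ge> 0" "c \<ge> 0" "d \<ge> 0" "e \<ge> 0"
  shows "summable (\<lambda>j. wz_summand (b + real j) c d e)"
  using wz_summand_tendsto_2[OF assms] summable_of_tendsto_mult_square by metis

lemma wz_summand_tendsto_0:
  assumes "b \<ge> 0" "c \<ge> 0" "d \<ge> 0" "e \<ge> 0"
  shows "(\<lambda>j. wz_summand (b + real j) c d e) \<longlonglongrightarrow> 0"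
  using summable_wz_summand[OF assms] by (rule summable_LIMSEQ_zero)

lemma summable_thomae_summand:
  assumes "c \<ge> 0" "d \<ge> 0" "e \<ge> 0"
  shows "summable (thomae_summand c d e)"
proof (rule summable_of_tendsto_mult_square)
  have "(\<lambda>j. thomae_cert c d e j * ((1 + c + d) * (1 + c + e)) * (real j / (real j + 2 + 2 * c + d + e)))
      \<longlonglongrightarrow> wz_limit c d e * ((1 + c + d) * (1 + c + e)) * 1"
    by (intro tendsto_mult tendsto_const thomae_cert_tendsto assms) real_asymp
  moreover have "thomae_cert c d e j * ((1 + c + d) * (1 + c + e)) * (real j / (real j + 2 + 2 * c + d + e))
      = thomae_summand c d e j * real j ^ 2" for j
  proof -
    have *: "t * (y * q / p) * p * (y / q) = t * y ^ 2" if "p \<noteq> 0" "q \<noteq> 0" for t y p q :: real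
      using that by (simp add: power2_eq_square)
    show ?thesis unfolding thomae_cert_def by (rule *) (use assms in auto)
  qed
  ultimately show "(\<lambda>j. thomae_summand c d e j * real j ^ 2) \<longlonglongrightarrow> wz_limit c d e * ((1 + c + d) * (1 + c + e)) * 1"
    by simp
qed

section \<open>Telescoping under a simultaneous unit shift of all arguments\<close>

definition wz_boundary :: "real \<Rightarrow> nat \<Rightarrow> real" where
  "wz_boundary x j = wz_summand (x + real j) x x x + wz_summand x (x + real (Suc j)) x x
     + wz_summand x (x + real (Suc j)) (x + 1) x + wz_summand x (x + real (Suc j)) (x + 1) (x + 1)"

definition thomae_boundary :: "real \<Rightarrow> nat \<Rightarrow> real" where
  "thomae_boundary x j = thomae_cert x x x j + thomae_cert x (x + 1) x j + thomae_cert x (x + 1) (x + 1) j"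

text \<open>At first argument x + j + 1, the other three are raised from x to x + 1 one at a time,
  and \<open>wz_summand_closed\<close> turns each step into a difference in j. The first term of
  \<open>wz_boundary\<close> accounts for the summation over the first argument starting one step
  later.\<close>

lemma wz_summand_diag_diff:
  assumes "x \<ge> 0"
  shows "wz_summand (x + real j) x x x - wz_summand (x + 1 + real j) (x + 1) (x + 1) (x + 1)
    = wz_boundary x j - wz_boundary x (Suc j)"
proof -
  define b where "b = x + real (Suc j)"
  have b: "b \<ge> 0" "x + 1 + real j = b" "b + 1 = x + real (Suc (Suc j))" using assms by (auto simp: b_def)
  have 1: "wz_summand b x x x - wz_summand b (x + 1) x x = wz_summand x b x x - wz_summand x (b + 1) x x"
    using assms b by (intro wz_summand_closed) auto
  have 2: "wz_summand b x (x + 1) x - wz_summand b (x + 1) (x + 1) x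
      = wz_summand x b (x + 1) x - wz_summand x (b + 1) (x + 1) x"
    using assms b by (intro wz_summand_closed) auto
  have 3: "wz_summand b x (x + 1) (x + 1) - wz_summand b (x + 1) (x + 1) (x + 1)
      = wz_summand x b (x + 1) (x + 1) - wz_summand x (b + 1) (x + 1) (x + 1)"
    using assms b by (intro wz_summand_closed) auto
  have 4: "wz_summand b x (x + 1) x = wz_summand b (x + 1) x x"
    "wz_summand b x (x + 1) (x + 1) = wz_summand b (x + 1) (x + 1) x"
    by (metis wz_summand_commute)+
  show ?thesis
    unfolding wz_boundary_def b(2) b_def[symmetric] b(3)[symmetric] using 1 2 3 4 by linarith
qed

lemma thomae_summand_diag_diff:
  assumes "x \<ge> 0"
  shows "thomae_summand x x x j - thomae_summand (x + 1) (x + 1) (x + 1) j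
    = thomae_boundary x (Suc j) - thomae_boundary x j"
proof -
  have "thomae_summand x x x j - thomae_summand (x + 1) x x j = thomae_cert x x x (Suc j) - thomae_cert x x x j"
    "thomae_summand x (x + 1) x j - thomae_summand (x + 1) (x + 1) x j
      = thomae_cert x (x + 1) x (Suc j) - thomae_cert x (x + 1) x j"
    "thomae_summand x (x + 1) (x + 1) j - thomae_summand (x + 1) (x + 1) (x + 1) j
      = thomae_cert x (x + 1) (x + 1) (Suc j) - thomae_cert x (x + 1) (x + 1) j"
    by (rule thomae_summand_diff; use assms in simp)+
  moreover have "thomae_summand x (x + 1) x = thomae_summand (x + 1) x x"
    "thomae_summand x (x + 1) (x + 1) = thomae_summand (x + 1) (x + 1) x"
    by (metis thomae_summand_commute)+
  ultimately show ?thesis unfolding thomae_boundary_def by simp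
qed

text \<open>The value at x minus the value at x + 1 is \<open>f13 (x + 1)\<close> minus three values
  of \<open>wz_limit\<close> for the first series, and the sum of the same three values for the
  second.\<close>

definition accel_sum :: "real \<Rightarrow> real" where
  "accel_sum x = (\<Sum>j. wz_summand (x + real j) x x x) + (\<Sum>j. thomae_summand x x x j)"

lemma accel_sum_diff:
  assumes "x \<ge> 0"
  shows "accel_sum x - accel_sum (x + 1) = f13 (x + 1)"
proof -
  let ?a = "\<lambda>j. wz_summand (x + real j) x x x - wz_summand (x + 1 + real j) (x + 1) (x + 1) (x + 1)
      + (thomae_summand x x x j - thomae_summand (x + 1) (x + 1) (x + 1) j)"
  have s: "summable (\<lambda>j. wz_summand (x + real j) x x x)"
    "summable (\<lambda>j. wz_summand (x + 1 + real j) (x + 1) (x + 1) (x + 1))"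
    "summable (thomae_summand x x x)" "summable (thomae_summand (x + 1) (x + 1) (x + 1))"
    by (intro summable_wz_summand summable_thomae_summand; use assms in simp)+
  have "?a sums (accel_sum x - accel_sum (x + 1))"
    using sums_add[OF sums_diff[OF s(1,2)[THEN summable_sums]] sums_diff[OF s(3,4)[THEN summable_sums]]]
    by (simp add: accel_sum_def algebra_simps)
  moreover have "?a sums f13 (x + 1)"
  proof -
    let ?L = "wz_limit x x x + wz_limit x (x + 1) x + wz_limit x (x + 1) (x + 1)"
    let ?q = "\<lambda>j. thomae_boundary x j - wz_boundary x j"
    have "thomae_boundary x \<longlonglongrightarrow> ?L"
      unfolding thomae_boundary_def using assms by (intro tendsto_add thomae_cert_tendsto) auto
    moreover have "(\<lambda>j. wz_boundary x j) \<longlonglongrightarrow> 0 + ?L"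
    proof -
      have "(\<lambda>j. wz_summand x (x + real (Suc j)) d e) \<longlonglongrightarrow> wz_limit x d e" if "d \<ge> 0" "e \<ge> 0" for d e
        using wz_summand_tendsto[of "x + 1" x d e] assms that by (simp add: add_ac)
      then have "(\<lambda>j. wz_boundary x j) \<longlonglongrightarrow> 0 + wz_limit x x x + wz_limit x (x + 1) x + wz_limit x (x + 1) (x + 1)"
        unfolding wz_boundary_def using assms
        by (intro tendsto_add wz_summand_tendsto_0) auto
      then show ?thesis by (simp add: add_ac)
    qed
    ultimately have "?q \<longlonglongrightarrow> ?L - (0 + ?L)" by (rule tendsto_diff)
    then have "?q \<longlonglongrightarrow> 0" by simp
    from telescope_sums[OF this] have "(\<lambda>j. ?q (Suc j) - ?q j) sums (0 - ?q 0)" .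
    moreover have "?q (Suc j) - ?q j = ?a j" for j
      using wz_summand_diag_diff[OF assms, of j] thomae_summand_diag_diff[OF assms, of j] by simp
    \<comment> \<open>At j = 0 the certificates vanish, and \<open>wz_boundary\<close> consists of
      the four values that make up \<open>f13 (x + 1)\<close>.\<close>
    moreover have "0 - ?q 0 = f13 (x + 1)"
      by (simp add: f13_eq_wz_summands[OF assms] wz_boundary_def thomae_boundary_def thomae_cert_def)
    ultimately show ?thesis by simp
  qed
  ultimately show ?thesis by (rule sums_unique2)
qed

subsection \<open>Decay of the remainder\<close>

lemma wz_summand_pos:
  assumes "b \<ge> 0" "c \<ge> 0" "d \<ge> 0" "e \<ge> 0"
  shows "wz_summand b c d e > 0"
  unfolding wz_summand_def using assms
  by (intro divide_pos_pos mult_pos_pos zero_less_power Gamma_real_pos) auto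

lemma wz_summand_Suc:
  assumes "b \<ge> 0" "c \<ge> 0" "d \<ge> 0" "e \<ge> 0"
  shows "wz_summand (b + 1) c d e = wz_summand b c d e
     * ((1 + b)\<^sup>2 * (2 + b + c + d + e) / ((2 + b + c) * (2 + b + d) * (2 + b + e)))"
proof -
  have r: "Gamma (1 + (b + 1)) = (1 + b) * Gamma (1 + b)"
    "Gamma (2 + (b + 1) + c + d + e) = (2 + b + c + d + e) * Gamma (2 + b + c + d + e)"
    "Gamma (2 + (b + 1) + c) = (2 + b + c) * Gamma (2 + b + c)"
    "Gamma (2 + (b + 1) + d) = (2 + b + d) * Gamma (2 + b + d)"
    "Gamma (2 + (b + 1) + e) = (2 + b + e) * Gamma (2 + b + e)"
    by (rule Gamma_real_rec; use assms in simp)+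
  show ?thesis unfolding wz_summand_def r by (simp add: power_mult_distrib mult_ac)
qed

text \<open>Two instances of the inequality between arithmetic and geometric means, verified by
  explicit polynomials: s - 1 - x taken twice and s + 2x have mean s - 2/3; then s - 2/3 taken three
  times and s + 1 taken twice have mean s.\<close>

lemma am_gm_bound:
  fixes x s :: real
  assumes "x \<ge> 0" "s \<ge> 2 + 2 * x"
  shows "(s - 1 - x)\<^sup>2 * (s + 2 * x) * (s + 1)\<^sup>2 \<le> s ^ 5"
proof -
  have "(s - 1 - x)\<^sup>2 * (s + 2 * x) \<le> (s - 2 / 3) ^ 3"
  proof -
    have "(s - 2 / 3) ^ 3 - (s - 1 - x)\<^sup>2 * (s + 2 * x) = (x + 1 / 3)\<^sup>2 * (3 * s - 2 * x - 8 / 3)"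
      by (simp add: power2_eq_square power3_eq_cube field_simps)
    moreover have "\<dots> \<ge> 0" using assms by (intro mult_nonneg_nonneg) auto
    ultimately show ?thesis by linarith
  qed
  then have "(s - 1 - x)\<^sup>2 * (s + 2 * x) * (s + 1)\<^sup>2 \<le> (s - 2 / 3) ^ 3 * (s + 1)\<^sup>2"
    by (rule mult_right_mono) simp
  also have "\<dots> \<le> s ^ 5"
  proof -
    have "s ^ 5 - (s - 2 / 3) ^ 3 * (s + 1)\<^sup>2 = (45 * s ^ 3 - 10 * s\<^sup>2 - 20 * s + 8) / 27"
      by (simp add: eval_nat_numeral field_simps)
    moreover have "45 * s ^ 3 - 10 * s\<^sup>2 - 20 * s + 8 \<ge> 0"
    proof -
      have "s \<ge> 2" using assms by simp
      moreover from this have "s * s \<ge> 2 * 2" by (intro mult_mono) auto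
      ultimately have "4 * s \<le> s * s * s" "2 * (s * s) \<le> s * (s * s)" by (intro mult_right_mono; simp)+
      then show ?thesis using \<open>s \<ge> 2\<close> unfolding power2_eq_square power3_eq_cube by linarith
    qed
    ultimately have "s ^ 5 - (s - 2 / 3) ^ 3 * (s + 1)\<^sup>2 \<ge> 0" by simp
    then show ?thesis by (simp only: diff_ge_0_iff_ge)
  qed
  finally show ?thesis .
qed

text \<open>With s = 2 + 2x + j the ratio of consecutive terms is at most s^2 / (s + 1)^2, and the
  product of these quotients telescopes. The explicit constant makes the bound usable uniformly in
  x.\<close>

lemma wz_summand_diag_le:
  assumes "x \<ge> 0"
  shows "wz_summand (x + real j) x x x \<le> wz_summand x x x x * (2 + 2 * x)\<^sup>2 / (2 + 2 * x + real j)\<^sup>2"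
proof (induction j)
  case 0
  then show ?case using assms by simp
next
  case (Suc j)
  define s where "s = 2 + 2 * x + real j"
  have s: "s \<ge> 2 + 2 * x" "s > 0" using assms by (auto simp: s_def)
  have "wz_summand (x + real (Suc j)) x x x = wz_summand (x + real j) x x x
      * ((s - 1 - x)\<^sup>2 * (s + 2 * x) / s ^ 3)"
    using wz_summand_Suc[of "x + real j" x x x] assms
    by (simp add: s_def add_ac power3_eq_cube)
  also have "\<dots> \<le> wz_summand x x x x * (2 + 2 * x)\<^sup>2 / s\<^sup>2 * (s\<^sup>2 / (s + 1)\<^sup>2)"
  proof (rule mult_mono)
    show "(s - 1 - x)\<^sup>2 * (s + 2 * x) / s ^ 3 \<le> s\<^sup>2 / (s + 1)\<^sup>2"
    proof -
      have "(s - 1 - x)\<^sup>2 * (s + 2 * x) / s ^ 3 = (s - 1 - x)\<^sup>2 * (s + 2 * x) * (s + 1)\<^sup>2 / (s ^ 3 * (s + 1)\<^sup>2)"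
        using s(2) by simp
      also have "\<dots> \<le> s ^ 5 / (s ^ 3 * (s + 1)\<^sup>2)"
        using am_gm_bound[OF assms s(1)] s(2) by (intro divide_right_mono) auto
      also have "s ^ 5 = s ^ 3 * s\<^sup>2" by (simp flip: power_add)
      also have "s ^ 3 * s\<^sup>2 / (s ^ 3 * (s + 1)\<^sup>2) = s\<^sup>2 / (s + 1)\<^sup>2"
        using s(2) by (intro mult_divide_mult_cancel_left) auto
      finally show ?thesis .
    qed
    show "wz_summand (x + real j) x x x \<le> wz_summand x x x x * (2 + 2 * x)\<^sup>2 / s\<^sup>2"
      using Suc by (simp add: s_def)
  qed (use assms s wz_summand_pos[of x x x x] in \<open>auto intro!: mult_nonneg_nonneg divide_nonneg_nonneg\<close>)
  also have "\<dots> = wz_summand x x x x * (2 + 2 * x)\<^sup>2 / (s + 1)\<^sup>2"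
    using s by simp
  also have "s + 1 = 2 + 2 * x + real (Suc j)" by (simp add: s_def)
  finally show ?case .
qed

text \<open>Splitting off (1 + 3x + j)^2 leaves a Gamma quotient v in which the powers of j balance.
  It tends to 1 and increases, hence is at most 1.\<close>

lemma thomae_summand_diag_le:
  assumes "x \<ge> 0"
  shows "thomae_summand x x x j \<le> Gamma (1 + x) ^ 6 / Gamma (1 + 2 * x) ^ 3 / (real (Suc j))\<^sup>2"
proof -
  define v where "v j = Gamma (1 + 2 * x + real j) ^ 3 / (Gamma (1 + real j) * Gamma (1 + 3 * x + real j) ^ 2)" for j
  have "v \<longlonglongrightarrow> 1"
  proof (rule Lim_transform_eventually)
    show "(\<lambda>j. Gamma (1 + 2 * x + real j) * Gamma (1 + 2 * x + real j) * Gamma (1 + 2 * x + real j)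
     / (Gamma (1 + real j) * Gamma (1 + 3 * x + real j) * Gamma (1 + 3 * x + real j))
     * real j powr (1 + (1 + 3 * x) + (1 + 3 * x) - (1 + 2 * x) - (1 + 2 * x) - (1 + 2 * x))) \<longlonglongrightarrow> 1"
      using assms by (intro Gamma_ratio_tendsto) auto
    show "\<forall>\<^sub>F j in sequentially. Gamma (1 + 2 * x + real j) * Gamma (1 + 2 * x + real j) * Gamma (1 + 2 * x + real j)
     / (Gamma (1 + real j) * Gamma (1 + 3 * x + real j) * Gamma (1 + 3 * x + real j))
     * real j powr (1 + (1 + 3 * x) + (1 + 3 * x) - (1 + 2 * x) - (1 + 2 * x) - (1 + 2 * x)) = v j"
      using eventually_gt_at_top[of 0]
      by eventually_elim (simp add: v_def power2_eq_square power3_eq_cube)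
  qed
  have pos: "v j > 0" for j
    unfolding v_def using assms by (intro divide_pos_pos mult_pos_pos zero_less_power Gamma_real_pos) auto
  have "incseq v"
  proof (rule incseq_SucI)
    fix j
    define y where "y = real j"
    have y: "y \<ge> 0" by (simp add: y_def)
    have r: "Gamma (1 + 2 * x + real (Suc j)) = (1 + 2 * x + y) * Gamma (1 + 2 * x + y)"
      "Gamma (1 + real (Suc j)) = (1 + y) * Gamma (1 + y)"
      "Gamma (1 + 3 * x + real (Suc j)) = (1 + 3 * x + y) * Gamma (1 + 3 * x + y)"
      by (rule Gamma_real_rec; use assms in \<open>simp add: y_def\<close>)+
    have "v (Suc j) = v j * ((1 + 2 * x + y) ^ 3 / ((1 + y) * (1 + 3 * x + y)\<^sup>2))"
      unfolding v_def r by (simp add: power_mult_distrib y_def mult_ac)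
    moreover have "(1 + 2 * x + y) ^ 3 / ((1 + y) * (1 + 3 * x + y)\<^sup>2) \<ge> 1"
    proof -
      \<comment> \<open>The arithmetic-geometric inequality in explicit form: 1 + 2x + y is the mean
        of 1 + y, 1 + 3x + y and 1 + 3x + y.\<close>
      have "(1 + 2 * x + y) ^ 3 - (1 + y) * (1 + 3 * x + y)\<^sup>2 = x\<^sup>2 * (3 * (1 + y) + 8 * x)"
        by (simp add: power2_eq_square power3_eq_cube algebra_simps)
      moreover have "\<dots> \<ge> 0" using assms y by simp
      moreover have "(1 + y) * (1 + 3 * x + y)\<^sup>2 > 0" using assms y by simp
      ultimately show ?thesis by (simp add: le_divide_eq)
    qed
    ultimately show "v j \<le> v (Suc j)"
      using pos[of j] mult_left_mono[of 1 "(1 + 2 * x + y) ^ 3 / ((1 + y) * (1 + 3 * x + y)\<^sup>2)" "v j"] by simp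
  qed
  then have v1: "v j \<le> 1" using \<open>v \<longlonglongrightarrow> 1\<close> by (rule incseq_le)
  have r: "Gamma (2 + 3 * x + real j) = (1 + 3 * x + real j) * Gamma (1 + 3 * x + real j)"
    by (rule Gamma_real_rec; use assms in simp)
  have "thomae_summand x x x j = Gamma (1 + x) ^ 6 / Gamma (1 + 2 * x) ^ 3 / (1 + 3 * x + real j)\<^sup>2 * v j"
  proof -
    have a: "1 + x + x = 1 + 2 * x" "2 + x + x + x = 2 + 3 * x" by auto
    show ?thesis unfolding thomae_summand_def v_def a r
      by (simp add: power_mult_distrib mult_ac eval_nat_numeral)
  qed
  also have "\<dots> \<le> Gamma (1 + x) ^ 6 / Gamma (1 + 2 * x) ^ 3 / (1 + 3 * x + real j)\<^sup>2 * 1"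
    using assms v1 Gamma_real_pos[of "1 + x"] Gamma_real_pos[of "1 + 2 * x"]
    by (intro mult_left_mono divide_nonneg_nonneg zero_le_power) auto
  also have "\<dots> \<le> Gamma (1 + x) ^ 6 / Gamma (1 + 2 * x) ^ 3 / (real (Suc j))\<^sup>2 * 1"
    using assms Gamma_real_pos[of "1 + x"] Gamma_real_pos[of "1 + 2 * x"]
    by (intro mult_right_mono divide_left_mono divide_nonneg_nonneg zero_le_power power_mono mult_pos_pos zero_less_power) auto
  finally show ?thesis by simp
qed

text \<open>The estimates s / (3 + 2x) \<le> 1/2, (3 + 4x)(5 + 4x) / t^2 \<le> 15 (its value at x =
  0) and 4 + 2x \<le> 2 (2 + 2x) combine to 1/8 * 15 * 1/8 * 4 = 15/16. Any constant below 1 gives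
  the decay.\<close>

lemma wz_summand_diag_shift:
  assumes "x \<ge> 0"
  shows "wz_summand (x + 1) (x + 1) (x + 1) (x + 1) * (2 + 2 * (x + 1))\<^sup>2
    \<le> 15 / 16 * (wz_summand x x x x * (2 + 2 * x)\<^sup>2)"
proof -
  have r1: "Gamma (2 + x) = (1 + x) * Gamma (1 + x)" and r2: "Gamma (2 + 2 * x) = (1 + 2 * x) * Gamma (1 + 2 * x)"
    and r4: "Gamma (3 + 4 * x) = (2 + 4 * x) * Gamma (2 + 4 * x)"
    by (rule Gamma_real_rec; use assms in simp)+
  have r3: "Gamma (3 + 2 * x) = (2 + 2 * x) * Gamma (2 + 2 * x)"
    and r5: "Gamma (4 + 4 * x) = (3 + 4 * x) * Gamma (3 + 4 * x)"
    by (rule Gamma_real_rec; use assms in simp)+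
  have r7: "Gamma (4 + 2 * x) = (3 + 2 * x) * Gamma (3 + 2 * x)"
    and r6: "Gamma (5 + 4 * x) = (4 + 4 * x) * Gamma (4 + 4 * x)"
    by (rule Gamma_real_rec; use assms in simp)+
  have r8: "Gamma (6 + 4 * x) = (5 + 4 * x) * Gamma (5 + 4 * x)"
    by (rule Gamma_real_rec; use assms in simp)
  define w where "w = wz_summand x x x x"
  define s where "s = 1 + x"
  define t where "t = 1 + 2 * x"
  have st: "2 + 2 * x = 2 * s" "4 + 4 * x = 4 * s" "2 + 4 * x = 2 * t" "s > 0" "t > 0" "1 + x = s" "1 + 2 * x = t"
    using assms by (auto simp: s_def t_def)
  have w: "w > 0" using wz_summand_pos[of x x x x] assms by (simp add: w_def)
  have "wz_summand (x + 1) (x + 1) (x + 1) (x + 1) = w * ((1 + x) ^ 8 * ((2 + 4 * x) * (3 + 4 * x) * (4 + 4 * x) * (5 + 4 * x))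
     / (((2 + 2 * x) * (3 + 2 * x)) ^ 3 * ((1 + 2 * x) * (2 + 2 * x)) ^ 3))"
  proof -
    have a: "2 + (x + 1) + (x + 1) + (x + 1) + (x + 1) = 6 + 4 * x" "2 + x + x + x + x = 2 + 4 * x" by auto
    have b: "1 + (x + 1) = 2 + x" "2 + (x + 1) + (x + 1) = 4 + 2 * x" "2 + x + (x + 1) = 3 + 2 * x"
      "2 + x + x = 2 + 2 * x" "1 + x + x = 1 + 2 * x" by auto
    show ?thesis unfolding w_def wz_summand_def a unfolding b r8 r7 r6 r5 r4 r3 r2 r1
      by (simp add: power_mult_distrib eval_nat_numeral mult_ac)
  qed
  also have "(1 + x) ^ 8 * ((2 + 4 * x) * (3 + 4 * x) * (4 + 4 * x) * (5 + 4 * x))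
     / (((2 + 2 * x) * (3 + 2 * x)) ^ 3 * ((1 + 2 * x) * (2 + 2 * x)) ^ 3)
     = s ^ 3 * ((3 + 4 * x) * (5 + 4 * x)) / (8 * t\<^sup>2 * (3 + 2 * x) ^ 3)"
    using st(4,5) assms unfolding st by (simp add: divide_simps eval_nat_numeral)
  finally have "wz_summand (x + 1) (x + 1) (x + 1) (x + 1) * (2 + 2 * (x + 1))\<^sup>2
      = w * ((s / (3 + 2 * x)) ^ 3 * ((3 + 4 * x) * (5 + 4 * x) / t\<^sup>2) * (1 / 8)) * (2 + 2 * (x + 1))\<^sup>2"
    by (simp add: power_divide)
  also have "\<dots> \<le> w * ((1 / 2) ^ 3 * 15 * (1 / 8)) * (2 * (2 + 2 * x))\<^sup>2"
  proof (intro mult_mono mult_left_mono power_mono)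
    show "(3 + 4 * x) * (5 + 4 * x) / t\<^sup>2 \<le> 15"
    proof -
      have "15 * t\<^sup>2 - (3 + 4 * x) * (5 + 4 * x) = 28 * x + 44 * x\<^sup>2"
        by (simp add: t_def power2_eq_square algebra_simps)
      also have "\<dots> \<ge> 0" using assms by simp
      finally have "(3 + 4 * x) * (5 + 4 * x) \<le> 15 * t\<^sup>2" by (simp only: diff_ge_0_iff_ge)
      then show ?thesis using st(5) by (simp add: divide_le_eq)
    qed
    show "s / (3 + 2 * x) \<le> 1 / 2" using assms by (simp add: s_def field_simps)
  qed (use assms st w in auto)
  also have "\<dots> = 15 / 16 * (w * (2 + 2 * x)\<^sup>2)"
    by (simp only: power_mult_distrib[of 2 "2 + 2 * x"]) (simp add: power3_eq_cube)
  finally show ?thesis by (simp add: w_def)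
qed

definition accel_bound :: "real \<Rightarrow> real" where
  "accel_bound x = wz_summand x x x x * (2 + 2 * x)\<^sup>2 + Gamma (1 + x) ^ 6 / Gamma (1 + 2 * x) ^ 3"

lemma accel_bound_shift:
  assumes "x \<ge> 0"
  shows "accel_bound (x + 1) \<le> 15 / 16 * accel_bound x"
proof -
  define h where "h = Gamma (1 + x) ^ 6 / Gamma (1 + 2 * x) ^ 3"
  have h: "h > 0"
    unfolding h_def using assms by (intro divide_pos_pos zero_less_power Gamma_real_pos) auto
  have r1: "Gamma (1 + (x + 1)) = (1 + x) * Gamma (1 + x)" and r2: "Gamma (2 + 2 * x) = (1 + 2 * x) * Gamma (1 + 2 * x)"
    by (rule Gamma_real_rec; use assms in simp)+
  have r3: "Gamma (1 + 2 * (x + 1)) = (2 + 2 * x) * Gamma (2 + 2 * x)"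
    by (rule Gamma_real_rec; use assms in simp)
  have "Gamma (1 + (x + 1)) ^ 6 / Gamma (1 + 2 * (x + 1)) ^ 3 = h * ((1 + x) ^ 6 / ((2 + 2 * x) * (1 + 2 * x)) ^ 3)"
    unfolding r1 r3 r2 h_def by (simp add: power_mult_distrib mult_ac)
  also have "(1 + x) ^ 6 / ((2 + 2 * x) * (1 + 2 * x)) ^ 3 = ((1 + x) / (1 + 2 * x)) ^ 3 / 8"
  proof -
    have "s ^ 6 / (2 * s * t) ^ 3 = (s / t) ^ 3 / 8" if "s > 0" "t > 0" for s t :: real
      using that by (simp add: power_mult_distrib power_divide divide_simps eval_nat_numeral)
    from this[of "1 + x" "1 + 2 * x"] show ?thesis using assms by (simp add: distrib_left)
  qed
  also have "h * (((1 + x) / (1 + 2 * x)) ^ 3 / 8) \<le> h * (1 / 8)"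
    using assms h by (intro mult_left_mono divide_right_mono power_le_one) (auto simp: field_simps)
  also have "\<dots> \<le> 15 / 16 * h" using h by simp
  finally have "Gamma (1 + (x + 1)) ^ 6 / Gamma (1 + 2 * (x + 1)) ^ 3 \<le> 15 / 16 * h" .
  then show ?thesis using wz_summand_diag_shift[OF assms] unfolding accel_bound_def h_def by argo
qed

lemma thomae_summand_pos:
  assumes "c \<ge> 0" "d \<ge> 0" "e \<ge> 0"
  shows "thomae_summand c d e j > 0"
  unfolding thomae_summand_def using assms
  by (intro divide_pos_pos mult_pos_pos zero_less_power Gamma_real_pos) auto

lemma accel_sum_nonneg:
  assumes "x \<ge> 0"
  shows "accel_sum x \<ge> 0"
  unfolding accel_sum_def using assms
  by (intro add_nonneg_nonneg suminf_nonneg summable_wz_summand summable_thomae_summand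
      less_imp_le[OF wz_summand_pos] less_imp_le[OF thomae_summand_pos]) auto

lemma accel_sum_le:
  assumes "x \<ge> 0"
  shows "accel_sum x \<le> accel_bound x * (\<Sum>j. 1 / (real (Suc j))\<^sup>2)"
proof -
  have s: "summable (\<lambda>j. 1 / (real (Suc j))\<^sup>2)"
    using inverse_power_summable[of 2, where 'a = real] by (subst summable_Suc_iff) (simp add: inverse_eq_divide)
  have "(\<Sum>j. wz_summand (x + real j) x x x) \<le> (\<Sum>j. wz_summand x x x x * (2 + 2 * x)\<^sup>2 * (1 / (real (Suc j))\<^sup>2))"
  proof (intro suminf_le summable_mult s summable_wz_summand assms)
    fix j
    have "wz_summand (x + real j) x x x \<le> wz_summand x x x x * (2 + 2 * x)\<^sup>2 / (2 + 2 * x + real j)\<^sup>2"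
      by (rule wz_summand_diag_le[OF assms])
    also have "\<dots> \<le> wz_summand x x x x * (2 + 2 * x)\<^sup>2 / (real (Suc j))\<^sup>2"
      using assms wz_summand_pos[of x x x x]
      by (intro divide_left_mono power_mono mult_nonneg_nonneg mult_pos_pos zero_less_power) auto
    finally show "wz_summand (x + real j) x x x \<le> wz_summand x x x x * (2 + 2 * x)\<^sup>2 * (1 / (real (Suc j))\<^sup>2)"
      by simp
  qed
  moreover have "(\<Sum>j. thomae_summand x x x j) \<le>
      (\<Sum>j. Gamma (1 + x) ^ 6 / Gamma (1 + 2 * x) ^ 3 * (1 / (real (Suc j))\<^sup>2))"
    using thomae_summand_diag_le[OF assms]
    by (intro suminf_le summable_mult s summable_thomae_summand assms) simp
  ultimately show ?thesis
    unfolding accel_sum_def accel_bound_def distrib_right suminf_mult[OF s] by linarith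
qed

text \<open>Telescoping of \<open>accel_sum_diff\<close>. The remainder vanishes because
  \<open>accel_bound\<close> shrinks by the factor 15/16 at each unit step.\<close>

lemma f13_sums_accel_sum:
  assumes "x \<ge> 0"
  shows "(\<lambda>k. f13 (x + real (Suc k))) sums accel_sum x"
proof -
  define C where "C = (\<Sum>j. 1 / (real (Suc j))\<^sup>2)"
  have bound: "accel_bound (x + real n) \<le> (15 / 16) ^ n * accel_bound x" for n
  proof (induction n)
    case (Suc n)
    have "accel_bound (x + real n + 1) \<le> 15 / 16 * accel_bound (x + real n)"
      using assms by (intro accel_bound_shift) auto
    with Suc show ?case by (simp add: add_ac)
  qed simp
  have "C \<ge> 0" unfolding C_def
    using inverse_power_summable[of 2, where 'a = real]
    by (intro suminf_nonneg) (subst summable_Suc_iff, simp_all add: inverse_eq_divide)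
  have "(\<lambda>n. accel_sum (x + real n)) \<longlonglongrightarrow> 0"
  proof (rule tendsto_sandwich[where f = "\<lambda>_. 0" and h = "\<lambda>n. (15 / 16) ^ n * accel_bound x * C"])
    show "(\<lambda>n. (15 / 16) ^ n * accel_bound x * C) \<longlonglongrightarrow> 0"
      by (intro tendsto_mult_left_zero LIMSEQ_power_zero) auto
    show "\<forall>\<^sub>F n in sequentially. accel_sum (x + real n) \<le> (15 / 16) ^ n * accel_bound x * C"
    proof (intro always_eventually allI)
      fix n
      have "accel_sum (x + real n) \<le> accel_bound (x + real n) * C"
        unfolding C_def using assms by (intro accel_sum_le) auto
      also have "\<dots> \<le> (15 / 16) ^ n * accel_bound x * C"
        using \<open>C \<ge> 0\<close> bound by (intro mult_right_mono) auto
      finally show "accel_sum (x + real n) \<le> (15 / 16) ^ n * accel_bound x * C" .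
    qed
    show "\<forall>\<^sub>F n in sequentially. 0 \<le> accel_sum (x + real n)"
      using assms by (intro always_eventually allI accel_sum_nonneg) simp
  qed simp
  from telescope_sums'[OF this] have "(\<lambda>n. accel_sum (x + real n) - accel_sum (x + real (Suc n))) sums (accel_sum x - 0)"
    by simp
  moreover have "accel_sum (x + real n) - accel_sum (x + real (Suc n)) = f13 (x + real (Suc n))" for n
    using accel_sum_diff[of "x + real n"] assms by (simp add: add_ac)
  ultimately show ?thesis by simp
qed

subsection \<open>Power series coefficients of infinite products\<close>

text \<open>Only parts of size at least 2 are listed: the series to be multiplied have no linear
  term, and every list obtained in this way is an admissible index.\<close>

function compositions :: "nat \<Rightarrow> nat list list" where
  "compositions m = (if m = 0 then [[]]
     else concat (map (\<lambda>k. map (Cons k) (compositions (m - k))) [2..<Suc m]))"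
  by auto
termination by (relation "Wellfounded.measure id") auto

declare compositions.simps [simp del]

lemma compositions_0 [simp]: "compositions 0 = [[]]"
  by (simp add: compositions.simps)

lemma compositions_part_ge_2:
  assumes "c \<in> set (compositions m)" "k \<in> set c"
  shows "k \<ge> 2"
  using assms
proof (induction m arbitrary: c rule: compositions.induct)
  case (1 m)
  show ?case
  proof (cases "m = 0")
    case m: False
    with "1.prems" obtain i d where id: "i \<in> {2..<Suc m}" "d \<in> set (compositions (m - i))" "c = i # d"
      by (subst (asm) compositions.simps) auto
    show ?thesis
    proof (cases "k = i")
      case False
      have "i \<in> set [2..<Suc m]" using id by (simp del: upt_Suc)
      from "1.IH"[OF m this id(2)] show ?thesis using "1.prems"(2) id(3) False by simp
    qed (use id in simp)
  qed (use "1.prems" in auto)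
qed

lemma admissible_composition:
  assumes "c \<in> set (compositions m)"
  shows "admissible c" "k \<ge> 2 \<Longrightarrow> admissible (k # c)"
proof -
  have *: "k \<in> set c \<Longrightarrow> k \<ge> 2" for k using compositions_part_ge_2[OF assms] .
  then have "0 \<notin> set c" by force
  then show "k \<ge> 2 \<Longrightarrow> admissible (k # c)" by simp
  show "admissible c" using * by (cases c) force+
qed

text \<open>With multiple zeta values for F this is the coefficient of t^m in the product over i >=
  1 of the series with terms a_k (t/i)^k: a part k of the composition stands for a factor that
  contributes a_k.\<close>

definition weight_sum :: "(nat \<Rightarrow> real) \<Rightarrow> nat \<Rightarrow> (nat list \<Rightarrow> real) \<Rightarrow> real" where
  "weight_sum a m F = (\<Sum>c\<leftarrow>compositions m. prod_list (map a c) * F c)"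

lemma weight_sum_0 [simp]: "weight_sum a 0 F = F []"
  by (simp add: weight_sum_def)

lemma weight_sum_rec:
  assumes "m > 0"
  shows "weight_sum a m F = (\<Sum>k=2..m. a k * weight_sum a (m - k) (\<lambda>c. F (k # c)))"
proof -
  have concat: "(\<Sum>c\<leftarrow>concat css. f c) = (\<Sum>cs\<leftarrow>css. \<Sum>c\<leftarrow>cs. f c)" for f :: "nat list \<Rightarrow> real" and css
    by (induction css) auto
  have "weight_sum a m F = (\<Sum>k\<leftarrow>[2..<Suc m]. a k * weight_sum a (m - k) (\<lambda>c. F (k # c)))"
    unfolding weight_sum_def using assms
    by (subst compositions.simps)
      (simp add: concat o_def sum_list_const_mult mult.assoc del: upt_Suc)
  then show ?thesis
    by (simp only: interv_sum_list_conv_sum_set_nat set_upt atLeastLessThanSuc_atLeastAtMost)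
qed

lemma weight_sum_add: "weight_sum a m (\<lambda>c. F c + G c) = weight_sum a m F + weight_sum a m G"
  by (simp add: weight_sum_def distrib_left sum_list_addf)

lemma weight_sum_divide: "weight_sum a m (\<lambda>c. F c / x) = weight_sum a m F / x"
proof -
  have "(\<Sum>c\<leftarrow>cs. g c * (F c / x)) = (\<Sum>c\<leftarrow>cs. g c * F c) / x" for cs and g :: "nat list \<Rightarrow> real"
    by (induction cs) (auto simp: add_divide_distrib)
  then show ?thesis by (simp add: weight_sum_def)
qed

text \<open>The largest summation variable is either below n or equal to n with some exponent k. The
  conditions on a supply the summands k = 0 and k = 1, so that the right-hand side is a Cauchy
  product with the factor of index n.\<close>

lemma weight_sum_hsum_Suc:
  assumes "a 0 = 1" "a 1 = 0" "n > 0"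
  shows "weight_sum a m (\<lambda>c. hsum c (Suc n)) =
    (\<Sum>k\<le>m. weight_sum a (m - k) (\<lambda>c. hsum c n) * (a k / real n ^ k))"
proof (cases "m = 0")
  case False
  then have "weight_sum a m (\<lambda>c. hsum c (Suc n)) =
      (\<Sum>k=2..m. a k * (weight_sum a (m - k) (\<lambda>c. hsum (k # c) n) + weight_sum a (m - k) (\<lambda>c. hsum c n) / real n ^ k))"
    using assms(3) by (simp add: weight_sum_rec hsum_Suc weight_sum_add weight_sum_divide)
  also have "\<dots> = weight_sum a m (\<lambda>c. hsum c n) + (\<Sum>k=2..m. weight_sum a (m - k) (\<lambda>c. hsum c n) * (a k / real n ^ k))"
    using False by (simp add: weight_sum_rec[of m] distrib_left sum.distrib mult_ac)
  also have "(\<Sum>k=2..m. weight_sum a (m - k) (\<lambda>c. hsum c n) * (a k / real n ^ k)) =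
      (\<Sum>k=1..m. weight_sum a (m - k) (\<lambda>c. hsum c n) * (a k / real n ^ k))"
    using assms(2) by (intro sum.mono_neutral_left) (auto simp: numeral_2_eq_2 not_less_eq_eq le_Suc_eq)
  also have "weight_sum a m (\<lambda>c. hsum c n) + \<dots> = (\<Sum>k=0..m. weight_sum a (m - k) (\<lambda>c. hsum c n) * (a k / real n ^ k))"
    using assms(1) by (subst (2) sum.atLeast_Suc_atMost) auto
  finally show ?thesis by (simp add: atLeast0AtMost)
qed (use assms in simp)

definition scaled_fps :: "(nat \<Rightarrow> real) \<Rightarrow> nat \<Rightarrow> complex fps" where
  "scaled_fps a i = Abs_fps (\<lambda>m. of_real (a m / real (Suc i) ^ m))"

lemma prod_scaled_fps_nth:
  assumes "a 0 = 1" "a 1 = 0"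
  shows "(\<Prod>i<n. scaled_fps a i) $ m = of_real (weight_sum a m (\<lambda>c. hsum c (Suc n)))"
proof (induction n arbitrary: m)
  case 0
  show ?case
  proof (cases "m = 0")
    case False
    have "weight_sum a m (\<lambda>c. hsum c (Suc 0)) = 0"
      using False by (simp add: weight_sum_rec) (simp add: weight_sum_def)
    then show ?thesis using False by simp
  qed simp
next
  case (Suc n)
  have "(\<Prod>i<Suc n. scaled_fps a i) $ m = (\<Sum>k\<le>m. scaled_fps a n $ k * (\<Prod>i<n. scaled_fps a i) $ (m - k))"
    by (simp add: mult.commute[of _ "scaled_fps a n"] fps_mult_nth atLeast0AtMost)
  also have "\<dots> = of_real (\<Sum>k\<le>m. weight_sum a (m - k) (\<lambda>c. hsum c (Suc n)) * (a k / real (Suc n) ^ k))"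
    unfolding Suc.IH by (simp add: scaled_fps_def mult.commute del: of_nat_Suc)
  also have "\<dots> = of_real (weight_sum a m (\<lambda>c. hsum c (Suc (Suc n))))"
    by (subst weight_sum_hsum_Suc[OF assms]) auto
  finally show ?case .
qed

lemma weight_sum_tendsto:
  assumes "\<And>c. c \<in> set (compositions m) \<Longrightarrow> ((\<lambda>n. F n c) \<longlongrightarrow> G c) fl"
  shows "((\<lambda>n. weight_sum a m (F n)) \<longlongrightarrow> weight_sum a m G) fl"
  unfolding weight_sum_def by (intro tendsto_sum_list tendsto_mult tendsto_const assms)

lemma weight_sum_sums:
  assumes "\<And>c. c \<in> set (compositions m) \<Longrightarrow> (\<lambda>n. F n c) sums G c"
  shows "(\<lambda>n. weight_sum a m (F n)) sums weight_sum a m G"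
  unfolding weight_sum_def by (intro sums_sum_list sums_mult assms)

text \<open>By the theorem of Weierstrass, derivatives of a uniformly convergent sequence of
  holomorphic functions converge, and with them the Taylor coefficients at 0.\<close>

lemma has_fps_expansion_uniform_limit:
  fixes f :: "nat \<Rightarrow> complex \<Rightarrow> complex" and F :: "nat \<Rightarrow> complex fps"
  assumes ulim: "uniform_limit (ball 0 r) f g sequentially" and r: "r > 0"
    and holo: "\<And>n. f n holomorphic_on ball 0 r"
    and exp: "\<And>n. f n has_fps_expansion F n"
    and lim: "\<And>m. (\<lambda>n. F n $ m) \<longlonglongrightarrow> L m"
  shows "g holomorphic_on ball 0 r" "g has_fps_expansion Abs_fps L"
proof -
  show holo_g: "g holomorphic_on ball 0 r"
  proof (rule holomorphic_uniform_sequence[where f = f, OF open_ball holo])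
    fix x :: complex assume "x \<in> ball 0 r"
    then obtain d where "d > 0" "cball x d \<subseteq> ball 0 r"
      using open_contains_cball[of "ball 0 r :: complex set"] open_ball by blast
    then show "\<exists>d>0. cball x d \<subseteq> ball 0 r \<and> uniform_limit (cball x d) f g sequentially"
      using uniform_limit_on_subset[OF ulim] by blast
  qed
  have g: "g has_fps_expansion fps_expansion g 0"
    using r by (intro has_fps_expansion_fps_expansion[of "ball 0 r"] holo_g) auto
  have "fps_expansion g 0 = Abs_fps L"
  proof (rule fps_ext)
    fix m
    have "(\<lambda>n. (deriv ^^ m) (f n) 0) \<longlonglongrightarrow> (deriv ^^ m) g 0"
      using r by (intro higher_deriv_complex_uniform_limit[OF ulim]) (auto intro: holo always_eventually)
    then have "(\<lambda>n. (deriv ^^ m) (f n) 0 / fact m) \<longlonglongrightarrow> (deriv ^^ m) g 0 / fact m"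
      by (intro tendsto_divide tendsto_const) auto
    then have "(\<lambda>n. F n $ m) \<longlonglongrightarrow> fps_expansion g 0 $ m"
      using fps_nth_fps_expansion[OF exp] fps_nth_fps_expansion[OF g] by simp
    then show "fps_expansion g 0 $ m = Abs_fps L $ m"
      using LIMSEQ_unique lim by auto
  qed
  with g show "g has_fps_expansion Abs_fps L" by simp
qed

text \<open>The quadratic bound makes the product of the phi(z/i) converge uniformly, and
  \<open>a 1 = 0\<close> keeps divergent sums with exponent 1 out of its coefficients.\<close>

locale quadratic_product =
  fixes phi :: "complex \<Rightarrow> complex" and a :: "nat \<Rightarrow> real" and C :: real
  assumes holo: "phi holomorphic_on cball 0 (1 / 8)"
    and expansion: "phi has_fps_expansion Abs_fps (\<lambda>m. of_real (a m))"
    and bound: "\<And>t. norm t \<le> 1 / 8 \<Longrightarrow> norm (phi t - 1) \<le> C * norm t ^ 2"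
    and a0: "a 0 = 1" and a1: "a 1 = 0"
begin

definition partial :: "nat \<Rightarrow> complex \<Rightarrow> complex" where
  "partial n z = (\<Prod>i<n. phi (z / of_nat (Suc i)))"

lemma C_nonneg: "C \<ge> 0"
  using order_trans[OF norm_ge_zero bound[of "1 / 8"]] by (simp add: zero_le_mult_iff)

lemma norm_div_Suc_le: "norm (z :: complex) \<le> 1 / 8 \<Longrightarrow> norm (z / of_nat (Suc i)) \<le> 1 / 8"
proof -
  have "norm (z / of_nat (Suc i)) \<le> norm z / 1"
    unfolding norm_divide norm_of_nat by (intro frac_le) auto
  then show "norm z \<le> 1 / 8 \<Longrightarrow> norm (z / of_nat (Suc i)) \<le> 1 / 8" by simp
qed

lemma factor_holo: "(\<lambda>z. phi (z / of_nat (Suc i))) holomorphic_on cball 0 (1 / 8)"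
  by (rule holomorphic_on_compose_gen[OF _ holo, unfolded o_def])
    (use norm_div_Suc_le in \<open>auto intro!: holomorphic_intros simp del: of_nat_Suc\<close>)

lemma factor_bound: "norm z \<le> 1 / 8 \<Longrightarrow> norm (phi (z / of_nat (Suc i)) - 1) \<le> C * (1 / real (Suc i) ^ 2)"
proof -
  assume z: "norm z \<le> 1 / 8"
  have "norm (phi (z / of_nat (Suc i)) - 1) \<le> C * norm (z / of_nat (Suc i)) ^ 2"
    using z by (intro bound norm_div_Suc_le)
  also have "\<dots> = C * (norm z ^ 2 / real (Suc i) ^ 2)"
    by (simp add: norm_divide power_divide del: of_nat_Suc)
  also have "\<dots> \<le> C * (1 / real (Suc i) ^ 2)"
    using z C_nonneg by (intro mult_left_mono divide_right_mono power_le_one) auto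
  finally show ?thesis .
qed

lemma summable_inverse_squares: "summable (\<lambda>i. 1 / real (Suc i) ^ 2)"
  using inverse_power_summable[of 2, where 'a = real] by (subst summable_Suc_iff) (simp add: inverse_eq_divide)

lemma partial_holo: "partial n holomorphic_on cball 0 (1 / 8)"
  unfolding partial_def by (intro holomorphic_on_prod factor_holo)

lemma partial_bound:
  obtains M where "M > 0" "\<And>n z. norm z \<le> 1 / 8 \<Longrightarrow> norm (partial n z) \<le> M"
proof
  let ?M = "exp (\<Sum>i. C * (1 / real (Suc i) ^ 2))"
  show "?M > 0" by simp
  fix n :: nat and z :: complex assume z: "norm z \<le> 1 / 8"
  have "norm (partial n z) = (\<Prod>i<n. norm (phi (z / of_nat (Suc i))))"
    by (simp add: partial_def prod_norm)
  also have "\<dots> \<le> (\<Prod>i<n. exp (C * (1 / real (Suc i) ^ 2)))"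
  proof (rule prod_mono, safe)
    fix i
    have "norm (phi (z / of_nat (Suc i))) \<le> 1 + norm (phi (z / of_nat (Suc i)) - 1)"
      using norm_triangle_ineq[of 1 "phi (z / of_nat (Suc i)) - 1"] by simp
    also have "\<dots> \<le> 1 + C * (1 / real (Suc i) ^ 2)" using factor_bound[OF z] by simp
    also have "\<dots> \<le> exp (C * (1 / real (Suc i) ^ 2))" by (rule exp_ge_add_one_self)
    finally show "norm (phi (z / of_nat (Suc i))) \<le> exp (C * (1 / real (Suc i) ^ 2))" .
  qed auto
  also have "\<dots> = exp (\<Sum>i<n. C * (1 / real (Suc i) ^ 2))" by (simp add: exp_sum)
  also have "\<dots> \<le> ?M"
    unfolding exp_le_cancel_iff
    using C_nonneg by (intro sum_le_suminf summable_mult summable_inverse_squares) auto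
  finally show "norm (partial n z) \<le> ?M" .
qed

lemma partial_uniformly_convergent: "uniformly_convergent_on (cball 0 (1 / 8)) partial"
  unfolding partial_def
proof (rule uniformly_convergent_on_prod')
  show "continuous_on (cball 0 (1 / 8)) (\<lambda>z. phi (z / of_nat (Suc n)))" for n
    by (rule holomorphic_on_imp_continuous_on[OF factor_holo])
  show "uniformly_convergent_on (cball 0 (1 / 8)) (\<lambda>N z. \<Sum>n<N. norm (phi (z / of_nat (Suc n)) - 1))"
    by (rule Weierstrass_m_test'[OF _ summable_mult[OF summable_inverse_squares, of C]])
      (use factor_bound in \<open>auto simp del: of_nat_Suc\<close>)
qed auto

lemma factor_expansion: "(\<lambda>z. phi (z / of_nat (Suc i))) has_fps_expansion scaled_fps a i"
proof -
  have "(phi \<circ> (\<lambda>z. (1 / of_nat (Suc i)) * z)) has_fps_expansion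
      (Abs_fps (\<lambda>m. of_real (a m)) oo (fps_const (1 / of_nat (Suc i)) * fps_X))"
    by (intro has_fps_expansion_compose expansion has_fps_expansion_cmult_left has_fps_expansion_fps_X) simp
  also have "Abs_fps (\<lambda>m. of_real (a m)) oo (fps_const (1 / of_nat (Suc i)) * fps_X) = scaled_fps a i"
    by (rule fps_ext) (simp add: scaled_fps_def fps_compose_linear power_divide del: of_nat_Suc)
  finally show ?thesis by (simp add: o_def)
qed

lemma partial_expansion: "partial n has_fps_expansion (\<Prod>i<n. scaled_fps a i)"
  unfolding partial_def by (intro has_fps_expansion_prod factor_expansion)

lemma product_expansion:
  obtains g where "g holomorphic_on ball 0 (1 / 8)"
    "g has_fps_expansion Abs_fps (\<lambda>m. of_real (weight_sum a m mzv))"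
    "\<And>z. norm z < 1 / 8 \<Longrightarrow> (\<lambda>n. partial n z) \<longlonglongrightarrow> g z"
proof -
  obtain g where g: "uniform_limit (cball 0 (1 / 8)) partial g sequentially"
    using partial_uniformly_convergent by (auto simp: uniformly_convergent_on_def)
  have g': "uniform_limit (ball 0 (1 / 8)) partial g sequentially"
    by (rule uniform_limit_on_subset[OF g]) auto
  have coeff: "(\<lambda>n. (\<Prod>i<n. scaled_fps a i) $ m) \<longlonglongrightarrow> of_real (weight_sum a m mzv)" for m
    unfolding prod_scaled_fps_nth[OF a0 a1]
    by (intro tendsto_of_real weight_sum_tendsto LIMSEQ_Suc hsum_tendsto admissible_composition)
  have h: "partial n holomorphic_on ball 0 (1 / 8)" for n
    by (rule holomorphic_on_subset[OF partial_holo]) auto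
  from has_fps_expansion_uniform_limit[OF g' _ h partial_expansion coeff]
  show ?thesis
    by (intro that[of g] tendsto_uniform_limitI[OF g']) auto
qed

text \<open>In term n the largest summation variable is n + 1, since \<open>partial n\<close>
  involves only smaller ones. The coefficient of psi contributes (n + 1)^(-k), and the square in the
  denominator raises this exponent to k + 2, which makes the index admissible.\<close>

lemma weighted_sum_expansion:
  assumes psi: "psi holomorphic_on cball 0 (1 / 8)"
    and psi_exp: "psi has_fps_expansion Abs_fps (\<lambda>m. of_real (b m))"
  obtains h where "h holomorphic_on ball 0 (1 / 8)"
    "h has_fps_expansion Abs_fps (\<lambda>m. of_real (\<Sum>k\<le>m. b k * weight_sum a (m - k) (\<lambda>c. mzv ((k + 2) # c))))"
    "\<And>z. norm z < 1 / 8 \<Longrightarrow> (\<lambda>n. psi (z / of_nat (Suc n)) / of_nat (Suc n) ^ 2 * partial n z) sums h z"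
proof -
  define s where "s n z = psi (z / of_nat (Suc n)) / of_nat (Suc n) ^ 2 * partial n z" for n z
  have psi_holo: "(\<lambda>z. psi (z / of_nat (Suc i))) holomorphic_on cball 0 (1 / 8)" for i
    by (rule holomorphic_on_compose_gen[OF _ psi, unfolded o_def])
      (use norm_div_Suc_le in \<open>auto intro!: holomorphic_intros simp del: of_nat_Suc\<close>)
  have s_holo: "s n holomorphic_on ball 0 (1 / 8)" for n
    unfolding s_def
    by (intro holomorphic_intros holomorphic_on_subset[OF psi_holo] holomorphic_on_subset[OF partial_holo]) auto
  have "compact (psi ` cball 0 (1 / 8))"
    by (intro compact_continuous_image holomorphic_on_imp_continuous_on[OF psi]) auto
  then obtain K where K: "K > 0" "\<And>t. norm t \<le> 1 / 8 \<Longrightarrow> norm (psi t) \<le> K"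
    using compact_imp_bounded[of "psi ` cball 0 (1 / 8)"] unfolding bounded_pos by auto
  obtain M where M: "M > 0" "\<And>n z. norm z \<le> 1 / 8 \<Longrightarrow> norm (partial n z) \<le> M"
    using partial_bound by blast
  have "uniformly_convergent_on (ball 0 (1 / 8)) (\<lambda>N z. \<Sum>n<N. s n z)"
  proof (rule Weierstrass_m_test')
    show "summable (\<lambda>n. K * M * (1 / real (Suc n) ^ 2))"
      by (intro summable_mult summable_inverse_squares)
    fix n and z :: complex assume "z \<in> ball 0 (1 / 8)"
    then have z: "norm z \<le> 1 / 8" by simp
    have "norm (s n z) = norm (psi (z / of_nat (Suc n))) * norm (partial n z) * (1 / real (Suc n) ^ 2)"
      by (simp add: s_def norm_mult norm_divide norm_power del: of_nat_Suc)
    also have "\<dots> \<le> K * M * (1 / real (Suc n) ^ 2)"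
      using K(1) M(1) K(2)[OF norm_div_Suc_le[OF z]] M(2)[OF z]
      by (intro mult_mono) (auto simp del: of_nat_Suc)
    finally show "norm (s n z) \<le> K * M * (1 / real (Suc n) ^ 2)" .
  qed
  then obtain h where h: "uniform_limit (ball 0 (1 / 8)) (\<lambda>N z. \<Sum>n<N. s n z) h sequentially"
    by (auto simp: uniformly_convergent_on_def)
  have psi_scaled: "(\<lambda>z. psi (z / of_nat (Suc i))) has_fps_expansion scaled_fps b i" for i
  proof -
    have "(psi \<circ> (\<lambda>z. (1 / of_nat (Suc i)) * z)) has_fps_expansion
        (Abs_fps (\<lambda>m. of_real (b m)) oo (fps_const (1 / of_nat (Suc i)) * fps_X))"
      by (intro has_fps_expansion_compose psi_exp has_fps_expansion_cmult_left has_fps_expansion_fps_X) simp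
    also have "Abs_fps (\<lambda>m. of_real (b m)) oo (fps_const (1 / of_nat (Suc i)) * fps_X) = scaled_fps b i"
      by (rule fps_ext) (simp add: scaled_fps_def fps_compose_linear power_divide del: of_nat_Suc)
    finally show ?thesis by (simp add: o_def)
  qed
  define F where "F n = fps_const (1 / of_nat (Suc n) ^ 2) * (scaled_fps b n * (\<Prod>i<n. scaled_fps a i))" for n
  have s_exp: "s n has_fps_expansion F n" for n
  proof -
    have "(\<lambda>z. 1 / of_nat (Suc n) ^ 2 * (psi (z / of_nat (Suc n)) * partial n z)) has_fps_expansion F n"
      unfolding F_def by (intro has_fps_expansion_cmult_left has_fps_expansion_mult psi_scaled partial_expansion)
    then show ?thesis by (simp add: s_def[abs_def] field_simps)
  qed
  have coeff: "(\<lambda>N. (\<Sum>n<N. F n) $ m) \<longlonglongrightarrow>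
      of_real (\<Sum>k\<le>m. b k * weight_sum a (m - k) (\<lambda>c. mzv ((k + 2) # c)))" for m
  proof -
    have F: "F n $ m = of_real (\<Sum>k\<le>m. b k * weight_sum a (m - k) (\<lambda>c. hsum c (Suc n) / real (Suc n) ^ (k + 2)))" for n
    proof -
      have "F n $ m = of_real (1 / real (Suc n) ^ 2 * (\<Sum>k\<le>m. b k / real (Suc n) ^ k * weight_sum a (m - k) (\<lambda>c. hsum c (Suc n))))"
      proof -
        have "(scaled_fps b n * (\<Prod>i<n. scaled_fps a i)) $ m
            = (\<Sum>k\<le>m. scaled_fps b n $ k * (\<Prod>i<n. scaled_fps a i) $ (m - k))"
          by (simp only: fps_mult_nth atLeast0AtMost)
        also have "\<dots> = of_real (\<Sum>k\<le>m. b k / real (Suc n) ^ k * weight_sum a (m - k) (\<lambda>c. hsum c (Suc n)))"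
          unfolding prod_scaled_fps_nth[OF a0 a1] by (simp add: scaled_fps_def del: of_nat_Suc)
        finally show ?thesis by (simp add: F_def del: of_nat_Suc)
      qed
      then show ?thesis
        by (simp add: weight_sum_divide sum_distrib_left power_add power2_eq_square mult_ac del: of_nat_Suc)
    qed
    have "(\<lambda>n. \<Sum>k\<le>m. b k * weight_sum a (m - k) (\<lambda>c. hsum c (Suc n) / real (Suc n) ^ (k + 2)))
        sums (\<Sum>k\<le>m. b k * weight_sum a (m - k) (\<lambda>c. mzv ((k + 2) # c)))"
      by (intro sums_sum sums_mult weight_sum_sums mzv_sums admissible_composition) auto
    then have "(\<lambda>n. F n $ m) sums of_real (\<Sum>k\<le>m. b k * weight_sum a (m - k) (\<lambda>c. mzv ((k + 2) # c)))"
      unfolding F by (rule sums_of_real)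
    then show ?thesis by (simp add: sums_def fps_sum_nth)
  qed
  have "(\<lambda>z. \<Sum>n<N. s n z) holomorphic_on ball 0 (1 / 8)" for N
    by (intro holomorphic_on_sum s_holo)
  moreover have "(\<lambda>z. \<Sum>n<N. s n z) has_fps_expansion (\<Sum>n<N. F n)" for N
    by (intro has_fps_expansion_sum s_exp)
  ultimately have "h holomorphic_on ball 0 (1 / 8)"
    "h has_fps_expansion Abs_fps (\<lambda>m. of_real (\<Sum>k\<le>m. b k * weight_sum a (m - k) (\<lambda>c. mzv ((k + 2) # c))))"
    using has_fps_expansion_uniform_limit[OF h _ _ _ coeff] by auto
  moreover have "(\<lambda>n. psi (z / of_nat (Suc n)) / of_nat (Suc n) ^ 2 * partial n z) sums h z" if "norm z < 1 / 8" for z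
    using tendsto_uniform_limitI[OF h] that by (auto simp: sums_def s_def)
  ultimately show ?thesis by (rule that)
qed

end

subsection \<open>Rational factors\<close>

definition complex_fps :: "real fps \<Rightarrow> complex fps" where
  "complex_fps A = Abs_fps (\<lambda>m. of_real (A $ m))"

lemma complex_fps_nth [simp]: "complex_fps A $ m = of_real (A $ m)"
  by (simp add: complex_fps_def)

lemma complex_fps_mult: "complex_fps (A * B) = complex_fps A * complex_fps B"
  by (rule fps_ext) (simp add: fps_mult_nth)

lemma complex_fps_1 [simp]: "complex_fps 1 = 1"
  by (rule fps_ext) simp

definition lin_fps :: "real \<Rightarrow> real fps" where
  "lin_fps c = 1 + fps_const c * fps_X"

definition geo_fps :: "real \<Rightarrow> real fps" where
  "geo_fps c = Abs_fps (\<lambda>m. (- c) ^ m)"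

lemma lin_mult_nth: "(lin_fps c * F) $ m = F $ m + c * (if m = 0 then 0 else F $ (m - 1))"
  by (simp add: lin_fps_def distrib_right mult.assoc)

lemma lin_mult_geo: "lin_fps c * geo_fps c = 1"
proof (rule fps_ext)
  show "(lin_fps c * geo_fps c) $ m = 1 $ m" for m
    unfolding lin_mult_nth by (cases m) (simp_all add: geo_fps_def)
qed

lemma lin_expansion: "(\<lambda>t. 1 + of_real c * t) has_fps_expansion complex_fps (lin_fps c)"
proof -
  have "complex_fps (lin_fps c) = 1 + fps_const (of_real c) * fps_X"
    by (rule fps_ext) (simp add: lin_fps_def)
  then show ?thesis by (auto intro!: fps_expansion_intros)
qed

lemma geo_expansion: "(\<lambda>t. inverse (1 + of_real c * t)) has_fps_expansion complex_fps (geo_fps c)"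
proof -
  have "complex_fps (lin_fps c) * complex_fps (geo_fps c) = 1"
    by (simp add: complex_fps_mult[symmetric] lin_mult_geo)
  then have "complex_fps (geo_fps c) = inverse (complex_fps (lin_fps c))"
    by (simp add: fps_inverse_unique)
  moreover have "(\<lambda>t. inverse (1 + of_real c * t)) has_fps_expansion inverse (complex_fps (lin_fps c))"
    by (intro has_fps_expansion_inverse lin_expansion) (simp add: lin_fps_def)
  ultimately show ?thesis by simp
qed

text \<open>Multiplication by 1 + c t, and in \<open>mul_geo\<close> division by it, on lists of
  coefficients; p is the coefficient just before the list. This makes the low-order coefficients of
  rational functions computable by rewriting.\<close>

fun mul_lin :: "real \<Rightarrow> real \<Rightarrow> real list \<Rightarrow> real list" where
  "mul_lin c p [] = []"
| "mul_lin c p (x # xs) = (x + c * p) # mul_lin c x xs"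

fun mul_geo :: "real \<Rightarrow> real \<Rightarrow> real list \<Rightarrow> real list" where
  "mul_geo c p [] = []"
| "mul_geo c p (x # xs) = (x - c * p) # mul_geo c (x - c * p) xs"

definition coeffs_upto :: "nat \<Rightarrow> real fps \<Rightarrow> real list" where
  "coeffs_upto n F = map (fps_nth F) [0..<n]"

lemma mul_lin_snoc: "mul_lin c p (xs @ [x]) = mul_lin c p xs @ [x + c * (if xs = [] then p else last xs)]"
  by (induction xs arbitrary: p) auto

lemma mul_geo_snoc:
  "mul_geo c p (xs @ [x]) = mul_geo c p xs @ [x - c * (if xs = [] then p else last (mul_geo c p xs))]"
proof (induction xs arbitrary: p)
  case (Cons y ys)
  then show ?case by (cases ys) auto
qed auto

lemma coeffs_upto_lin: "coeffs_upto n (lin_fps c * F) = mul_lin c 0 (coeffs_upto n F)"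
  unfolding coeffs_upto_def by (induction n) (auto simp: mul_lin_snoc lin_mult_nth last_map)

lemma coeffs_upto_geo: "coeffs_upto n (geo_fps c * F) = mul_geo c 0 (coeffs_upto n F)"
proof (induction n)
  case (Suc n)
  have "F = lin_fps c * (geo_fps c * F)" by (simp add: mult.assoc[symmetric] lin_mult_geo)
  then have "F $ n = (geo_fps c * F) $ n + c * (if n = 0 then 0 else (geo_fps c * F) $ (n - 1))"
    by (metis lin_mult_nth)
  moreover have "last (mul_geo c 0 (coeffs_upto n F)) = (geo_fps c * F) $ (n - 1)" if "n > 0"
    unfolding Suc.IH[symmetric] using that by (simp add: coeffs_upto_def last_map)
  ultimately show ?case using Suc.IH
    by (simp add: coeffs_upto_def mul_geo_snoc)
qed (simp add: coeffs_upto_def)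

lemma nth_eq_coeffs_upto: "m < n \<Longrightarrow> F $ m = coeffs_upto n F ! m"
  by (simp add: coeffs_upto_def)

definition rat_fps :: "real list \<Rightarrow> real list \<Rightarrow> real fps" where
  "rat_fps ls gs = foldr (\<lambda>c F. lin_fps c * F) ls (foldr (\<lambda>c F. geo_fps c * F) gs 1)"

definition rat_fun :: "real list \<Rightarrow> real list \<Rightarrow> complex \<Rightarrow> complex" where
  "rat_fun ls gs t = (\<Prod>c\<leftarrow>ls. 1 + of_real c * t) / (\<Prod>c\<leftarrow>gs. 1 + of_real c * t)"

lemma coeffs_upto_rat_fps:
  "coeffs_upto n (rat_fps ls gs) = foldr (\<lambda>c. mul_lin c 0) ls (foldr (\<lambda>c. mul_geo c 0) gs (coeffs_upto n 1))"
proof -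
  have "coeffs_upto n (foldr (\<lambda>c F. geo_fps c * F) gs 1) = foldr (\<lambda>c. mul_geo c 0) gs (coeffs_upto n 1)"
    by (induction gs) (auto simp: coeffs_upto_geo)
  then show ?thesis
    unfolding rat_fps_def by (induction ls) (auto simp: coeffs_upto_lin)
qed

lemma rat_fun_expansion: "rat_fun ls gs has_fps_expansion complex_fps (rat_fps ls gs)"
proof -
  have g: "(\<lambda>t. inverse (\<Prod>c\<leftarrow>gs. 1 + of_real c * t)) has_fps_expansion complex_fps (foldr (\<lambda>c F. geo_fps c * F) gs 1)"
    by (induction gs) (auto simp: complex_fps_mult intro!: has_fps_expansion_mult geo_expansion)
  have "(\<lambda>t. (\<Prod>c\<leftarrow>ls. 1 + of_real c * t) * inverse (\<Prod>c\<leftarrow>gs. 1 + of_real c * t)) has_fps_expansion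
      complex_fps (rat_fps ls gs)"
    unfolding rat_fps_def using g
    by (induction ls) (auto simp: complex_fps_mult mult.assoc intro!: has_fps_expansion_mult lin_expansion)
  then show ?thesis by (simp add: rat_fun_def[abs_def] divide_inverse)
qed

text \<open>Here |c t| is at most 1/2. The value 4 is the largest c that occurs below, and it
  dictates the radius 1/8.\<close>

lemma one_plus_mult_nonzero:
  fixes t :: complex
  assumes "norm t \<le> 1 / 8" "\<bar>c\<bar> \<le> 4"
  shows "1 + of_real c * t \<noteq> 0"
proof
  assume "1 + of_real c * t = 0"
  then have "norm (of_real c * t) = 1" by (metis add_eq_0_iff norm_minus_cancel norm_one)
  moreover have "norm (of_real c * t) \<le> 4 * (1 / 8)"
    unfolding norm_mult norm_of_real using assms by (intro mult_mono) auto
  ultimately show False by simp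
qed

lemma rat_fun_holo:
  assumes "\<forall>c\<in>set gs. \<bar>c\<bar> \<le> 4"
  shows "rat_fun ls gs holomorphic_on cball 0 (1 / 8)"
proof -
  have "(\<lambda>t. \<Prod>c\<leftarrow>cs. 1 + of_real c * t) holomorphic_on cball 0 (1 / 8)" for cs
    by (induction cs) (auto intro!: holomorphic_intros)
  moreover have "(\<Prod>c\<leftarrow>gs. 1 + of_real c * t) \<noteq> 0" if "norm t \<le> 1 / 8" for t :: complex
    using assms that one_plus_mult_nonzero by (induction gs) auto
  ultimately show ?thesis
    unfolding rat_fun_def[abs_def] by (intro holomorphic_on_divide) auto
qed

text \<open>Numerator minus denominator is t^2 times p, and p divided by the denominator is
  continuous on the closed disc, hence bounded.\<close>

lemma rat_fun_quadratic_bound: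
  fixes p :: "complex \<Rightarrow> complex"
  assumes "\<forall>c\<in>set gs. \<bar>c\<bar> \<le> 4" "continuous_on UNIV p"
    and "\<And>t. (\<Prod>c\<leftarrow>ls. 1 + of_real c * t) = (\<Prod>c\<leftarrow>gs. 1 + of_real c * t) + t ^ 2 * p t"
  shows "\<exists>C. \<forall>t. norm t \<le> 1 / 8 \<longrightarrow> norm (rat_fun ls gs t - 1) \<le> C * norm t ^ 2"
proof -
  let ?d = "\<lambda>t. \<Prod>c\<leftarrow>gs. 1 + of_real c * t :: complex"
  have nz: "?d t \<noteq> 0" if "norm t \<le> 1 / 8" for t :: complex
    using assms(1) that one_plus_mult_nonzero by (induction gs) auto
  have d: "continuous_on UNIV ?d"
    by (induction gs) (auto intro!: continuous_intros)
  have "continuous_on (cball 0 (1 / 8)) (\<lambda>t. p t / ?d t)"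
    using nz by (intro continuous_on_divide continuous_on_subset[OF d] continuous_on_subset[OF assms(2)]) auto
  then have "bounded ((\<lambda>t. p t / ?d t) ` cball 0 (1 / 8))"
    by (intro compact_imp_bounded compact_continuous_image) auto
  then obtain C where C: "\<forall>x\<in>(\<lambda>t. p t / ?d t) ` cball 0 (1 / 8). norm x \<le> C"
    unfolding bounded_iff by blast
  have "norm (rat_fun ls gs t - 1) \<le> C * norm t ^ 2" if "norm t \<le> 1 / 8" for t
  proof -
    have "rat_fun ls gs t - 1 = t ^ 2 * (p t / ?d t)"
      using nz[OF that] by (simp add: rat_fun_def assms(3) add_divide_distrib)
    moreover have "norm (p t / ?d t) \<le> C" using C that by auto
    moreover have "norm (t ^ 2 * (p t / ?d t)) = norm (p t / ?d t) * norm t ^ 2"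
      by (simp only: norm_mult norm_power mult.commute)
    ultimately show ?thesis by (simp only: mult_right_mono zero_le_power norm_ge_zero)
  qed
  then show ?thesis by blast
qed

lemma coeffs_upto_one: "coeffs_upto 8 1 = [1, 0, 0, 0, 0, 0, 0, 0]"
  by (simp add: coeffs_upto_def upt_rec)

text \<open>Eight coefficients serve for seven derivatives. The second and the fifth function are
  the weights psi. For the other four the linear coefficient vanishes because the two lists have the
  same sum.\<close>

lemma rat_fps_coeffs:
  "coeffs_upto 8 (rat_fps [1, 1, 4] [2, 2, 2]) = [1, 0, -3, 14, -48, 144, -400, 1056]"
  "coeffs_upto 8 (rat_fps [4] [2, 2, 2]) = [1, -2, 0, 16, -80, 288, -896, 2560]"
  "coeffs_upto 8 (rat_fps [2, 2, 2, 2, 2, 2] [4, 1, 1, 1, 1, 1, 1, 1, 1]) = [1, 0, 0, -8, 42, -168, 652, -2568]"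
  "coeffs_upto 8 (rat_fps [2, 2, 2] [3, 3]) = [1, 0, 3, -10, 33, -108, 351, -1134]"
  "coeffs_upto 8 (rat_fps [] [3, 3]) = [1, -6, 27, -108, 405, -1458, 5103, -17496]"
  "coeffs_upto 8 (rat_fps [3, 3] [1, 1, 1, 1, 1, 1]) = [1, 0, -6, 16, -21, 0, 84, -288]"
  by (simp_all add: coeffs_upto_rat_fps coeffs_upto_one)

lemma quadratic_product_rat:
  assumes "\<forall>c\<in>set gs. \<bar>c\<bar> \<le> 4" "coeffs_upto 8 (rat_fps ls gs) = 1 # 0 # cs"
    and "\<exists>C. \<forall>t. norm t \<le> 1 / 8 \<longrightarrow> norm (rat_fun ls gs t - 1) \<le> C * norm t ^ 2"
  shows "\<exists>C. quadratic_product (rat_fun ls gs) (fps_nth (rat_fps ls gs)) C"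
proof -
  from assms(3) obtain C where "\<And>t. norm t \<le> 1 / 8 \<Longrightarrow> norm (rat_fun ls gs t - 1) \<le> C * norm t ^ 2"
    by blast
  then have "quadratic_product (rat_fun ls gs) (fps_nth (rat_fps ls gs)) C"
    using rat_fun_holo[OF assms(1)] rat_fun_expansion[unfolded complex_fps_def]
      nth_eq_coeffs_upto[of 0 8 "rat_fps ls gs"] nth_eq_coeffs_upto[of 1 8 "rat_fps ls gs"] assms(2)
    by unfold_locales auto
  then show ?thesis by blast
qed

text \<open>Each witness p is the difference of numerator and denominator divided by t^2.\<close>

lemma quadratic_product_instances:
  "\<exists>C. quadratic_product (rat_fun [1, 1, 4] [2, 2, 2]) (fps_nth (rat_fps [1, 1, 4] [2, 2, 2])) C"
  "\<exists>C. quadratic_product (rat_fun [2, 2, 2, 2, 2, 2] [4, 1, 1, 1, 1, 1, 1, 1, 1])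
     (fps_nth (rat_fps [2, 2, 2, 2, 2, 2] [4, 1, 1, 1, 1, 1, 1, 1, 1])) C"
  "\<exists>C. quadratic_product (rat_fun [2, 2, 2] [3, 3]) (fps_nth (rat_fps [2, 2, 2] [3, 3])) C"
  "\<exists>C. quadratic_product (rat_fun [3, 3] [1, 1, 1, 1, 1, 1]) (fps_nth (rat_fps [3, 3] [1, 1, 1, 1, 1, 1])) C"
proof -
  show "\<exists>C. quadratic_product (rat_fun [1, 1, 4] [2, 2, 2]) (fps_nth (rat_fps [1, 1, 4] [2, 2, 2])) C"
    by (rule quadratic_product_rat[OF _ rat_fps_coeffs(1) rat_fun_quadratic_bound[where p = "\<lambda>t. - 3 - 4 * t"]])
      (auto intro!: continuous_intros, algebra)
  show "\<exists>C. quadratic_product (rat_fun [2, 2, 2] [3, 3]) (fps_nth (rat_fps [2, 2, 2] [3, 3])) C"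
    by (rule quadratic_product_rat[OF _ rat_fps_coeffs(4) rat_fun_quadratic_bound[where p = "\<lambda>t. 3 + 8 * t"]])
      (auto intro!: continuous_intros, algebra)
  show "\<exists>C. quadratic_product (rat_fun [3, 3] [1, 1, 1, 1, 1, 1]) (fps_nth (rat_fps [3, 3] [1, 1, 1, 1, 1, 1])) C"
    by (rule quadratic_product_rat[OF _ rat_fps_coeffs(6)
          rat_fun_quadratic_bound[where p = "\<lambda>t. - 6 - 20 * t - 15 * t ^ 2 - 6 * t ^ 3 - t ^ 4"]])
      (auto intro!: continuous_intros, algebra)
  show "\<exists>C. quadratic_product (rat_fun [2, 2, 2, 2, 2, 2] [4, 1, 1, 1, 1, 1, 1, 1, 1])
     (fps_nth (rat_fps [2, 2, 2, 2, 2, 2] [4, 1, 1, 1, 1, 1, 1, 1, 1])) C"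
    by (rule quadratic_product_rat[OF _ rat_fps_coeffs(3) rat_fun_quadratic_bound[where p =
          "\<lambda>t. - 8 * t - 54 * t ^ 2 - 144 * t ^ 3 - 188 * t ^ 4 - 120 * t ^ 5 - 33 * t ^ 6 - 4 * t ^ 7"]])
      (auto intro!: continuous_intros, algebra)
qed

subsection \<open>The Taylor expansion of the accelerated sum\<close>

definition rat_real :: "real list \<Rightarrow> real list \<Rightarrow> real \<Rightarrow> real" where
  "rat_real ls gs t = (\<Prod>c\<leftarrow>ls. 1 + c * t) / (\<Prod>c\<leftarrow>gs. 1 + c * t)"

lemma rat_fun_of_real: "rat_fun ls gs (of_real t) = of_real (rat_real ls gs t)"
proof -
  have "(\<Prod>c\<leftarrow>cs. 1 + of_real c * of_real t) = (of_real (\<Prod>c\<leftarrow>cs. 1 + c * t) :: complex)" for cs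
    by (induction cs) auto
  then show ?thesis by (simp add: rat_fun_def rat_real_def)
qed

lemma Gamma_eq_prod:
  assumes "y \<ge> (0 :: real)"
  shows "Gamma (1 + y + real j) = Gamma (1 + y) * fact j * (\<Prod>i<j. 1 + y / real (Suc i))"
proof (induction j)
  case (Suc j)
  have 1: "Gamma (1 + y + real (Suc j)) = (1 + y + real j) * Gamma (1 + y + real j)"
    by (rule Gamma_real_rec) (use assms in auto)
  have 2: "1 + y + real j = real (Suc j) * (1 + y / real (Suc j))"
    by (simp add: distrib_left)
  show ?case unfolding 1 Suc.IH unfolding 2 by (simp add: mult_ac del: of_nat_Suc)
qed simp

text \<open>The product of 1 + c x / i over i <= n behaves like n^(c x) / Gamma(1 + c x). The powers
  of n cancel because the two lists have the same sum.\<close>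

lemma prod_rat_real_tendsto:
  assumes "\<forall>c\<in>set (ls @ gs). c \<ge> 0" "sum_list ls = sum_list gs" "x \<ge> 0"
  shows "(\<lambda>n. \<Prod>i<n. rat_real ls gs (x / real (Suc i))) \<longlonglongrightarrow>
    (\<Prod>c\<leftarrow>gs. Gamma (1 + c * x)) / (\<Prod>c\<leftarrow>ls. Gamma (1 + c * x))"
proof -
  define g where "g c j = Gamma (1 + c * x) * (\<Prod>i<j. 1 + c * x / real (Suc i)) / real j powr (c * x)" for c j
  have g: "g c \<longlonglongrightarrow> 1" if "c \<ge> 0" for c
  proof -
    have "g c = (\<lambda>j. Gamma (1 + c * x + real j) / (fact j * real j powr (1 + c * x - 1)))"
      using that assms(3) by (auto simp: g_def Gamma_eq_prod)
    moreover have "1 + c * x > 0" using that assms(3) by (intro add_pos_nonneg) auto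
    ultimately show ?thesis using Gamma_over_powr_tendsto[of "1 + c * x"] by (simp only:)
  qed
  have G: "(\<lambda>j. \<Prod>c\<leftarrow>cs. g c j) \<longlonglongrightarrow> 1" if "\<forall>c\<in>set cs. c \<ge> 0" for cs
    using that by (induction cs) (auto intro!: tendsto_eq_intros g)
  have pos: "(\<Prod>c\<leftarrow>cs. Gamma (1 + c * x)) > 0" if "\<forall>c\<in>set cs. c \<ge> 0" for cs
    using that assms(3) by (induction cs) (auto intro!: mult_pos_pos Gamma_real_pos add_pos_nonneg)
  have eq: "(\<Prod>c\<leftarrow>cs. g c j) = (\<Prod>c\<leftarrow>cs. Gamma (1 + c * x)) *
      (\<Prod>i<j. \<Prod>c\<leftarrow>cs. 1 + c * (x / real (Suc i))) / real j powr (sum_list cs * x)" if "j > 0" for cs j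
    using that
  proof (induction cs)
    case (Cons a cs)
    have "sum_list (a # cs) * x = a * x + sum_list cs * x" by (simp add: distrib_right)
    then show ?case using Cons by (simp add: g_def prod.distrib powr_add mult_ac del: of_nat_Suc)
  qed simp
  let ?P = "\<lambda>cs. \<Prod>c\<leftarrow>cs. Gamma (1 + c * x)"
  have "(\<lambda>j. (?P gs / ?P ls) * ((\<Prod>c\<leftarrow>ls. g c j) / (\<Prod>c\<leftarrow>gs. g c j))) \<longlonglongrightarrow> (?P gs / ?P ls) * (1 / 1)"
    using assms(1) by (intro tendsto_intros G) auto
  then show ?thesis
  proof (rule Lim_transform_eventually [OF tendsto_eq_rhs])
    show "\<forall>\<^sub>F j in sequentially. (?P gs / ?P ls) * ((\<Prod>c\<leftarrow>ls. g c j) / (\<Prod>c\<leftarrow>gs. g c j)) =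
      (\<Prod>i<j. rat_real ls gs (x / real (Suc i)))"
      using eventually_gt_at_top[of 0]
    proof eventually_elim
      case (elim j)
      have "?P ls \<noteq> 0" "?P gs \<noteq> 0" using pos[of ls] pos[of gs] assms(1) by auto
      then show ?case
        unfolding eq[OF elim] using elim assms(2)
        by (simp add: rat_real_def prod_dividef del: of_nat_Suc)
    qed
  qed simp
qed

lemma rat_real_values:
  assumes "y > 0" "x \<ge> 0"
  shows "rat_real [4] [2, 2, 2] (x / y) / y ^ 2 = (y + 4 * x) / (y + 2 * x) ^ 3"
    "rat_real [1, 1, 4] [2, 2, 2] (x / y) = (y + x) ^ 2 * (y + 4 * x) / (y + 2 * x) ^ 3"
    "rat_real [] [3, 3] (x / y) / y ^ 2 = 1 / (y + 3 * x) ^ 2"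
    "rat_real [2, 2, 2] [3, 3] (x / y) = (y + 2 * x) ^ 3 / (y * (y + 3 * x) ^ 2)"
proof -
  have l: "1 + c * (x / y) = (y + c * x) / y" for c using assms by (simp add: field_simps)
  have "y + 4 * x > 0" "y + 2 * x > 0" "y + 3 * x > 0" using assms by auto
  then show "rat_real [4] [2, 2, 2] (x / y) / y ^ 2 = (y + 4 * x) / (y + 2 * x) ^ 3"
    "rat_real [1, 1, 4] [2, 2, 2] (x / y) = (y + x) ^ 2 * (y + 4 * x) / (y + 2 * x) ^ 3"
    "rat_real [] [3, 3] (x / y) / y ^ 2 = 1 / (y + 3 * x) ^ 2"
    "rat_real [2, 2, 2] [3, 3] (x / y) = (y + 2 * x) ^ 3 / (y * (y + 3 * x) ^ 2)"
    using assms(1) unfolding rat_real_def by (simp_all only: list.map prod_list.Cons prod_list.Nil l)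
      (simp_all add: divide_simps eval_nat_numeral)
qed

text \<open>What is left of \<open>wz_summand x x x x\<close> after removing (1 + 4x) / (1 + 2x)^3.
  By \<open>prod_rat_real_tendsto\<close> it is itself an infinite product of a rational function,
  and so is \<open>thomae_prefactor\<close>.\<close>

definition wz_prefactor :: "real \<Rightarrow> real" where
  "wz_prefactor x = Gamma (1 + 4 * x) * Gamma (1 + x) ^ 8 / Gamma (1 + 2 * x) ^ 6"

definition thomae_prefactor :: "real \<Rightarrow> real" where
  "thomae_prefactor x = Gamma (1 + x) ^ 6 / Gamma (1 + 3 * x) ^ 2"

lemma wz_summand_eq_prod:
  assumes "x \<ge> 0"
  shows "wz_summand (x + real j) x x x = wz_prefactor x *
    (rat_real [4] [2, 2, 2] (x / real (Suc j)) / real (Suc j) ^ 2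
      * (\<Prod>i<j. rat_real [1, 1, 4] [2, 2, 2] (x / real (Suc i))))"
proof -
  have v: "rat_real [4] [2, 2, 2] (x / real (Suc j)) / real (Suc j) ^ 2 = (real (Suc j) + 4 * x) / (real (Suc j) + 2 * x) ^ 3"
    "rat_real [1, 1, 4] [2, 2, 2] (x / real (Suc j)) = (real (Suc j) + x) ^ 2 * (real (Suc j) + 4 * x) / (real (Suc j) + 2 * x) ^ 3" for j
    using rat_real_values[of "real (Suc j)" x] assms by auto
  show ?thesis unfolding v
  proof (induction j)
    case 0
    have r: "Gamma (2 + 4 * x) = (1 + 4 * x) * Gamma (1 + 4 * x)" "Gamma (2 + 2 * x) = (1 + 2 * x) * Gamma (1 + 2 * x)"
      by (rule Gamma_real_rec; use assms in simp)+
    have a: "2 + x + x + x + x = 2 + 4 * x" by simp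
    have b: "2 + x + x = 2 + 2 * x" "1 + x + x = 1 + 2 * x" by auto
    have "wz_summand x x x x = (1 + 4 * x) * Gamma (1 + 4 * x) * Gamma (1 + x) ^ 8
        / ((1 + 2 * x) ^ 3 * Gamma (1 + 2 * x) ^ 6)"
      unfolding wz_summand_def a unfolding b r by (simp add: eval_nat_numeral mult_ac)
    then show ?case by (simp add: wz_prefactor_def mult_ac)
  next
    case (Suc j)
    define y where "y = real (Suc j)"
    have y: "y > 0" "y + 4 * x > 0" "y + 2 * x > 0" "y + 1 + 2 * x > 0" using assms by (auto simp: y_def)
    have "wz_summand (x + real (Suc j)) x x x = wz_summand (x + real j) x x x
        * ((y + x)\<^sup>2 * (y + 1 + 4 * x) / (y + 1 + 2 * x) ^ 3)"
      using wz_summand_Suc[of "x + real j" x x x] assms by (simp add: y_def add_ac power3_eq_cube)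
    moreover have "real (Suc (Suc j)) = y + 1" by (simp add: y_def)
    ultimately show ?case
      unfolding Suc.IH y_def[symmetric] prod.lessThan_Suc using y
      by (simp add: y_def[symmetric] mult_ac del: of_nat_Suc)
  qed
qed

lemma thomae_summand_eq_prod:
  assumes "x \<ge> 0"
  shows "thomae_summand x x x j = thomae_prefactor x *
    (rat_real [] [3, 3] (x / real (Suc j)) / real (Suc j) ^ 2
      * (\<Prod>i<j. rat_real [2, 2, 2] [3, 3] (x / real (Suc i))))"
proof -
  have v: "rat_real [] [3, 3] (x / real (Suc j)) / real (Suc j) ^ 2 = 1 / (real (Suc j) + 3 * x) ^ 2"
    "rat_real [2, 2, 2] [3, 3] (x / real (Suc j)) = (real (Suc j) + 2 * x) ^ 3 / (real (Suc j) * (real (Suc j) + 3 * x) ^ 2)" for j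
    using rat_real_values[of "real (Suc j)" x] assms by auto
  have b: "1 + x + x = 1 + 2 * x" "2 + x + x + x = 2 + 3 * x" by auto
  show ?thesis unfolding v
  proof (induction j)
    case 0
    have r: "Gamma (2 + 3 * x) = (1 + 3 * x) * Gamma (1 + 3 * x)"
      by (rule Gamma_real_rec; use assms in simp)
    have "Gamma (1 + 2 * x) > 0" using assms by (intro Gamma_real_pos) auto
    then show ?case
      unfolding thomae_summand_def thomae_prefactor_def b of_nat_0 add_0_right r
      by (simp add: power_mult_distrib eval_nat_numeral mult_ac)
  next
    case (Suc j)
    define y where "y = real (Suc j)"
    have y: "y > 0" "y + 3 * x > 0" "y + 2 * x > 0" "y + 1 + 3 * x > 0" using assms by (auto simp: y_def)
    have r: "Gamma (1 + 2 * x + real (Suc j)) = (1 + 2 * x + real j) * Gamma (1 + 2 * x + real j)"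
      "Gamma (1 + real (Suc j)) = (1 + real j) * Gamma (1 + real j)"
      "Gamma (2 + 3 * x + real (Suc j)) = (2 + 3 * x + real j) * Gamma (2 + 3 * x + real j)"
      by (rule Gamma_real_rec; use assms in simp)+
    have e: "1 + 2 * x + real j = y + 2 * x" "1 + real j = y" "2 + 3 * x + real j = y + 1 + 3 * x"
      by (auto simp: y_def)
    have "thomae_summand x x x (Suc j) = thomae_summand x x x j * ((y + 2 * x) ^ 3 / (y * (y + 1 + 3 * x)\<^sup>2))"
      unfolding thomae_summand_def b r unfolding e by (simp add: power_mult_distrib power3_eq_cube mult_ac)
    moreover have "real (Suc (Suc j)) = y + 1" by (simp add: y_def)
    ultimately show ?case
      unfolding Suc.IH y_def[symmetric] prod.lessThan_Suc using y
      by (simp add: y_def[symmetric] mult_ac del: of_nat_Suc)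
  qed
qed

definition wz_coeff :: "nat \<Rightarrow> real" where
  "wz_coeff m = (\<Sum>k\<le>m. rat_fps [4] [2, 2, 2] $ k *
     weight_sum (fps_nth (rat_fps [1, 1, 4] [2, 2, 2])) (m - k) (\<lambda>c. mzv ((k + 2) # c)))"

definition thomae_coeff :: "nat \<Rightarrow> real" where
  "thomae_coeff m = (\<Sum>k\<le>m. rat_fps [] [3, 3] $ k *
     weight_sum (fps_nth (rat_fps [2, 2, 2] [3, 3])) (m - k) (\<lambda>c. mzv ((k + 2) # c)))"

definition wz_pre_coeff :: "nat \<Rightarrow> real" where
  "wz_pre_coeff m = weight_sum (fps_nth (rat_fps [2, 2, 2, 2, 2, 2] [4, 1, 1, 1, 1, 1, 1, 1, 1])) m mzv"

definition thomae_pre_coeff :: "nat \<Rightarrow> real" where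
  "thomae_pre_coeff m = weight_sum (fps_nth (rat_fps [3, 3] [1, 1, 1, 1, 1, 1])) m mzv"

text \<open>Each of the two series is a Gamma prefactor times a weighted sum, so the four instances
  of \<open>quadratic_product\<close> give holomorphic functions E, U, G, Z, and D is E U + G Z. The
  sum over i is the Cauchy product. The comparison with \<open>accel_sum\<close> is confined to real
  x >= 0, where the latter is controlled.\<close>

lemma accel_sum_expansion:
  obtains D where "D holomorphic_on ball 0 (1 / 8)"
    "D has_fps_expansion Abs_fps (\<lambda>m. of_real (\<Sum>i\<le>m. wz_pre_coeff i * wz_coeff (m - i)
       + thomae_pre_coeff i * thomae_coeff (m - i)))"
    "\<And>x. 0 \<le> x \<Longrightarrow> x < 1 / 8 \<Longrightarrow> D (of_real x) = of_real (accel_sum x)"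
proof -
  obtain C1 C2 C3 C4 where
    "quadratic_product (rat_fun [1, 1, 4] [2, 2, 2]) (fps_nth (rat_fps [1, 1, 4] [2, 2, 2])) C1"
    "quadratic_product (rat_fun [2, 2, 2, 2, 2, 2] [4, 1, 1, 1, 1, 1, 1, 1, 1])
      (fps_nth (rat_fps [2, 2, 2, 2, 2, 2] [4, 1, 1, 1, 1, 1, 1, 1, 1])) C2"
    "quadratic_product (rat_fun [2, 2, 2] [3, 3]) (fps_nth (rat_fps [2, 2, 2] [3, 3])) C3"
    "quadratic_product (rat_fun [3, 3] [1, 1, 1, 1, 1, 1]) (fps_nth (rat_fps [3, 3] [1, 1, 1, 1, 1, 1])) C4"
    using quadratic_product_instances by blast
  then interpret u: quadratic_product "rat_fun [1, 1, 4] [2, 2, 2]" "fps_nth (rat_fps [1, 1, 4] [2, 2, 2])" C1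
    + e: quadratic_product "rat_fun [2, 2, 2, 2, 2, 2] [4, 1, 1, 1, 1, 1, 1, 1, 1]"
      "fps_nth (rat_fps [2, 2, 2, 2, 2, 2] [4, 1, 1, 1, 1, 1, 1, 1, 1])" C2
    + z: quadratic_product "rat_fun [2, 2, 2] [3, 3]" "fps_nth (rat_fps [2, 2, 2] [3, 3])" C3
    + g: quadratic_product "rat_fun [3, 3] [1, 1, 1, 1, 1, 1]" "fps_nth (rat_fps [3, 3] [1, 1, 1, 1, 1, 1])" C4
    .
  have u_partial: "u.partial n (of_real x) = of_real (\<Prod>i<n. rat_real [1, 1, 4] [2, 2, 2] (x / real (Suc i)))"
    and e_partial: "e.partial n (of_real x) = of_real (\<Prod>i<n. rat_real [2, 2, 2, 2, 2, 2] [4, 1, 1, 1, 1, 1, 1, 1, 1] (x / real (Suc i)))"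
    and z_partial: "z.partial n (of_real x) = of_real (\<Prod>i<n. rat_real [2, 2, 2] [3, 3] (x / real (Suc i)))"
    and g_partial: "g.partial n (of_real x) = of_real (\<Prod>i<n. rat_real [3, 3] [1, 1, 1, 1, 1, 1] (x / real (Suc i)))"
    for n x
    unfolding u.partial_def e.partial_def z.partial_def g.partial_def
    by (simp_all add: rat_fun_of_real[symmetric] del: of_nat_Suc)
  obtain E where E: "E holomorphic_on ball 0 (1 / 8)"
    "E has_fps_expansion Abs_fps (\<lambda>m. of_real (wz_pre_coeff m))"
    "\<And>z. norm z < 1 / 8 \<Longrightarrow> (\<lambda>n. e.partial n z) \<longlonglongrightarrow> E z"
    using e.product_expansion unfolding wz_pre_coeff_def by blast
  obtain G where G: "G holomorphic_on ball 0 (1 / 8)"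
    "G has_fps_expansion Abs_fps (\<lambda>m. of_real (thomae_pre_coeff m))"
    "\<And>z. norm z < 1 / 8 \<Longrightarrow> (\<lambda>n. g.partial n z) \<longlonglongrightarrow> G z"
    using g.product_expansion unfolding thomae_pre_coeff_def by blast
  have psi: "rat_fun [4] [2, 2, 2] holomorphic_on cball 0 (1 / 8)" "rat_fun [] [3, 3] holomorphic_on cball 0 (1 / 8)"
    by (rule rat_fun_holo; simp)+
  obtain U where U: "U holomorphic_on ball 0 (1 / 8)"
    "U has_fps_expansion Abs_fps (\<lambda>m. of_real (wz_coeff m))"
    "\<And>z. norm z < 1 / 8 \<Longrightarrow> (\<lambda>n. rat_fun [4] [2, 2, 2] (z / of_nat (Suc n)) / of_nat (Suc n) ^ 2 * u.partial n z) sums U z"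
    using u.weighted_sum_expansion[OF psi(1) rat_fun_expansion[unfolded complex_fps_def]]
    unfolding wz_coeff_def by blast
  obtain Z where Z: "Z holomorphic_on ball 0 (1 / 8)"
    "Z has_fps_expansion Abs_fps (\<lambda>m. of_real (thomae_coeff m))"
    "\<And>z. norm z < 1 / 8 \<Longrightarrow> (\<lambda>n. rat_fun [] [3, 3] (z / of_nat (Suc n)) / of_nat (Suc n) ^ 2 * z.partial n z) sums Z z"
    using z.weighted_sum_expansion[OF psi(2) rat_fun_expansion[unfolded complex_fps_def]]
    unfolding thomae_coeff_def by blast
  show ?thesis
  proof
    show "(\<lambda>z. E z * U z + G z * Z z) holomorphic_on ball 0 (1 / 8)"
      using E G U Z by (intro holomorphic_intros)
    have "(\<lambda>z. E z * U z + G z * Z z) has_fps_expansion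
        Abs_fps (\<lambda>m. of_real (wz_pre_coeff m)) * Abs_fps (\<lambda>m. of_real (wz_coeff m)) +
        Abs_fps (\<lambda>m. of_real (thomae_pre_coeff m)) * Abs_fps (\<lambda>m. of_real (thomae_coeff m))"
      using E G U Z by (intro has_fps_expansion_add has_fps_expansion_mult)
    also have "\<dots> = Abs_fps (\<lambda>m. of_real (\<Sum>i\<le>m. wz_pre_coeff i * wz_coeff (m - i)
       + thomae_pre_coeff i * thomae_coeff (m - i)))"
      by (rule fps_ext) (simp add: fps_mult_nth atLeast0AtMost sum.distrib)
    finally show "(\<lambda>z. E z * U z + G z * Z z) has_fps_expansion Abs_fps (\<lambda>m. of_real (\<Sum>i\<le>m. wz_pre_coeff i * wz_coeff (m - i)
       + thomae_pre_coeff i * thomae_coeff (m - i)))" .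
    fix x :: real assume x: "0 \<le> x" "x < 1 / 8"
    then have nx: "norm (complex_of_real x) < 1 / 8" by simp
    have "E (of_real x) = of_real (wz_prefactor x)"
    proof (rule LIMSEQ_unique[OF E(3)[OF nx]])
      have "(\<lambda>n. \<Prod>i<n. rat_real [2, 2, 2, 2, 2, 2] [4, 1, 1, 1, 1, 1, 1, 1, 1] (x / real (Suc i))) \<longlonglongrightarrow> wz_prefactor x"
        using prod_rat_real_tendsto[of "[2, 2, 2, 2, 2, 2]" "[4, 1, 1, 1, 1, 1, 1, 1, 1]" x] x
        by (simp add: wz_prefactor_def eval_nat_numeral mult_ac)
      then show "(\<lambda>n. e.partial n (of_real x)) \<longlonglongrightarrow> of_real (wz_prefactor x)"
        unfolding e_partial by (rule tendsto_of_real)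
    qed
    moreover have "G (of_real x) = of_real (thomae_prefactor x)"
    proof (rule LIMSEQ_unique[OF G(3)[OF nx]])
      have "(\<lambda>n. \<Prod>i<n. rat_real [3, 3] [1, 1, 1, 1, 1, 1] (x / real (Suc i))) \<longlonglongrightarrow> thomae_prefactor x"
        using prod_rat_real_tendsto[of "[3, 3]" "[1, 1, 1, 1, 1, 1]" x] x
        by (simp add: thomae_prefactor_def eval_nat_numeral mult_ac)
      then show "(\<lambda>n. g.partial n (of_real x)) \<longlonglongrightarrow> of_real (thomae_prefactor x)"
        unfolding g_partial by (rule tendsto_of_real)
    qed
    moreover have "of_real (\<Sum>j. wz_summand (x + real j) x x x) = of_real (wz_prefactor x) * U (of_real x)"
    proof (rule sums_unique2)
      show "(\<lambda>j. complex_of_real (wz_summand (x + real j) x x x)) sums of_real (\<Sum>j. wz_summand (x + real j) x x x)"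
        using x by (intro sums_of_real summable_sums summable_wz_summand) auto
      have "(\<lambda>j. of_real (wz_prefactor x) * (rat_fun [4] [2, 2, 2] (of_real x / of_nat (Suc j)) / of_nat (Suc j) ^ 2
          * u.partial j (of_real x))) sums (of_real (wz_prefactor x) * U (of_real x))"
        by (intro sums_mult U(3) nx)
      then show "(\<lambda>j. complex_of_real (wz_summand (x + real j) x x x)) sums (of_real (wz_prefactor x) * U (of_real x))"
        unfolding wz_summand_eq_prod[OF x(1)] u_partial
        by (simp add: rat_fun_of_real[symmetric] del: of_nat_Suc)
    qed
    moreover have "of_real (\<Sum>j. thomae_summand x x x j) = of_real (thomae_prefactor x) * Z (of_real x)"
    proof (rule sums_unique2)
      show "(\<lambda>j. complex_of_real (thomae_summand x x x j)) sums of_real (\<Sum>j. thomae_summand x x x j)"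
        using x by (intro sums_of_real summable_sums summable_thomae_summand) auto
      have "(\<lambda>j. of_real (thomae_prefactor x) * (rat_fun [] [3, 3] (of_real x / of_nat (Suc j)) / of_nat (Suc j) ^ 2
          * z.partial j (of_real x))) sums (of_real (thomae_prefactor x) * Z (of_real x))"
        by (intro sums_mult Z(3) nx)
      then show "(\<lambda>j. complex_of_real (thomae_summand x x x j)) sums (of_real (thomae_prefactor x) * Z (of_real x))"
        unfolding thomae_summand_eq_prod[OF x(1)] z_partial
        by (simp add: rat_fun_of_real[symmetric] del: of_nat_Suc)
    qed
    ultimately show "E (of_real x) * U (of_real x) + G (of_real x) * Z (of_real x) = of_real (accel_sum x)"
      by (simp add: accel_sum_def)
  qed
qed

subsection \<open>Termwise differentiation\<close>

definition complex_f13 :: "complex \<Rightarrow> complex" where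
  "complex_f13 w = (60 * w\<^sup>2 - 43 * w + 8) * (Gamma (4 * w) * Gamma w ^ 8 / (16 * (4 * w - 1) * Gamma (2 * w) ^ 6))"

text \<open>The quadratic polynomial of \<open>complex_f13\<close> is left out: without it the
  quotient under w -> w + 1 is a product of simple linear factors, and the polynomial only
  contributes quadratic growth.\<close>

definition gamma_quotient :: "complex \<Rightarrow> complex" where
  "gamma_quotient w = Gamma (4 * w) * Gamma w ^ 8 / (16 * (4 * w - 1) * Gamma (2 * w) ^ 6)"

lemma not_nonpos_Int_if_Re_pos: "Re w > 0 \<Longrightarrow> w \<notin> \<int>\<^sub>\<le>\<^sub>0"
  by (auto elim!: nonpos_Ints_cases)

lemma quarter_half_plane:
  assumes "Re w > 1 / 4"
  shows "4 * w \<notin> \<int>\<^sub>\<le>\<^sub>0" "w \<notin> \<int>\<^sub>\<le>\<^sub>0" "2 * w \<notin> \<int>\<^sub>\<le>\<^sub>0" "4 * w - 1 \<noteq> 0" "Gamma (2 * w) \<noteq> 0"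
proof -
  show *: "4 * w \<notin> \<int>\<^sub>\<le>\<^sub>0" "w \<notin> \<int>\<^sub>\<le>\<^sub>0" "2 * w \<notin> \<int>\<^sub>\<le>\<^sub>0"
    using assms by (auto intro!: not_nonpos_Int_if_Re_pos)
  show "4 * w - 1 \<noteq> 0"
  proof
    assume "4 * w - 1 = 0"
    then have "Re (4 * w - 1) = 0" by simp
    then show False using assms by simp
  qed
  show "Gamma (2 * w) \<noteq> 0" using *(3) by (simp add: Gamma_eq_zero_iff)
qed

lemma gamma_quotient_holo: "gamma_quotient holomorphic_on {w. Re w > 1 / 4}"
  unfolding gamma_quotient_def[abs_def]
  by (intro holomorphic_intros) (use quarter_half_plane in auto)

lemma complex_f13_holo: "complex_f13 holomorphic_on {w. Re w > 1 / 4}"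
proof -
  have *: "complex_f13 = (\<lambda>w. (60 * w\<^sup>2 - 43 * w + 8) * gamma_quotient w)"
    by (simp add: fun_eq_iff complex_f13_def gamma_quotient_def)
  show ?thesis unfolding * by (intro holomorphic_intros gamma_quotient_holo)
qed

lemma complex_f13_of_real: "complex_f13 (of_real x) = of_real (f13 x)"
proof -
  have g: "Gamma (c * of_real x) = complex_of_real (Gamma (Re c * x))" if "Im c = 0" for c
    using that by (simp add: Gamma_complex_of_real[symmetric] complex_eq_iff[of c "of_real (Re c)"] complex_is_Real_iff)
  show ?thesis
    unfolding complex_f13_def f13_def using g[of 4] g[of 2] g[of 1] by simp
qed

text \<open>The complex derivative at a real point is also the derivative along the axis, and its
  imaginary part vanishes because the function is real there. The half-line x > 1/4 is open, so the
  induction hypothesis is available in a neighbourhood of x.\<close>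

lemma higher_deriv_complex_f13:
  assumes "x > 1 / 4"
  shows "(deriv ^^ m) complex_f13 (of_real x) = of_real ((deriv ^^ m) f13 x)"
  using assms
proof (induction m arbitrary: x)
  case 0
  show ?case by (simp add: complex_f13_of_real)
next
  case (Suc m)
  let ?F = "(deriv ^^ m) complex_f13" and ?f = "(deriv ^^ m) f13"
  have op: "open {w. Re w > 1 / 4}" by (rule open_halfspace_Re_gt)
  have "?F holomorphic_on {w. Re w > 1 / 4}"
    by (intro holomorphic_higher_deriv complex_f13_holo op)
  then have d: "(?F has_field_derivative deriv ?F (of_real x)) (at (of_real x))"
    using Suc.prems op by (intro holomorphic_derivI) auto
  have v: "((\<lambda>y. ?F (of_real y)) has_vector_derivative deriv ?F (of_real x)) (at x)"
    using has_vector_derivative_real_field[OF d] by (simp add: o_def)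
  have ev: "\<forall>\<^sub>F y in nhds x. ?F (of_real y) = of_real (?f y)"
    using Suc.IH eventually_nhds_in_open[of "{1/4<..}" x] Suc.prems
    by (auto elim!: eventually_mono)
  have v': "((\<lambda>y. complex_of_real (?f y)) has_vector_derivative deriv ?F (of_real x)) (at x)"
    using v ev by (subst (asm) has_vector_derivative_cong_ev[OF _ ]) (auto dest: eventually_nhds_x_imp_x elim: eventually_mono)
  have r: "(?f has_vector_derivative Re (deriv ?F (of_real x))) (at x)"
    using bounded_linear.has_vector_derivative[OF bounded_linear_Re v'] by simp
  then have r': "(?f has_real_derivative Re (deriv ?F (of_real x))) (at x)"
    by (simp add: has_real_derivative_iff_has_vector_derivative)
  have "((\<lambda>y. 0) has_vector_derivative Im (deriv ?F (of_real x))) (at x)"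
    using bounded_linear.has_vector_derivative[OF bounded_linear_Im v'] by simp
  then have "Im (deriv ?F (of_real x)) = 0"
    using vector_derivative_unique_at has_vector_derivative_const by blast
  with DERIV_imp_deriv[OF r'] show ?case
    by (simp add: complex_eq_iff)
qed

section \<open>Geometric decay of the terms, uniformly near the positive integers\<close>

lemma gamma_quotient_shift:
  assumes "Re w > 1 / 4"
  shows "gamma_quotient (w + 1) = gamma_quotient w *
    ((4 * w + 2) * (4 * w + 1) * (4 * w) * (4 * w - 1) * w ^ 8 / ((2 * w + 1) * (2 * w)) ^ 6)"
proof -
  have rec: "Gamma v = z * Gamma z" if "Re z > 0" "v = z + 1" for z v :: complex
    using Gamma_plus1[of z] not_nonpos_Int_if_Re_pos that by auto
  have r: "Gamma (4 * w + 4) = (4 * w + 3) * Gamma (4 * w + 3)" "Gamma (4 * w + 3) = (4 * w + 2) * Gamma (4 * w + 2)"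
    "Gamma (4 * w + 2) = (4 * w + 1) * Gamma (4 * w + 1)" "Gamma (4 * w + 1) = 4 * w * Gamma (4 * w)"
    "Gamma (w + 1) = w * Gamma w" "Gamma (2 * w + 2) = (2 * w + 1) * Gamma (2 * w + 1)"
    "Gamma (2 * w + 1) = 2 * w * Gamma (2 * w)"
    by (rule rec; use assms in simp)+
  have nz: "4 * w + 3 \<noteq> 0" "4 * w - 1 \<noteq> 0"
    using assms quarter_half_plane(4) by (auto simp: complex_eq_iff)
  have e: "4 * (w + 1) = 4 * w + 4" "2 * (w + 1) = 2 * w + 2" "4 * w + 4 - 1 = 4 * w + 3" by auto
  have "gamma_quotient (w + 1) = (4 * w + 3) * ((4 * w + 2) * ((4 * w + 1) * (4 * w * Gamma (4 * w)))) * (w * Gamma w) ^ 8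
      / (16 * (4 * w + 3) * ((2 * w + 1) * (2 * w * Gamma (2 * w))) ^ 6)"
    unfolding gamma_quotient_def e r(1) r(2) r(3) r(4) r(5) r(6) r(7) ..
  also have "\<dots> = gamma_quotient w *
    ((4 * w + 2) * (4 * w + 1) * (4 * w) * (4 * w - 1) * w ^ 8 / ((2 * w + 1) * (2 * w)) ^ 6)"
  proof -
    have *: "a * (c * (d * (e * G))) * (w * g) ^ 8 / (16 * a * (f * (h * k)) ^ 6) =
        G * g ^ 8 / (16 * b * k ^ 6) * (c * d * e * b * w ^ 8 / (f * h) ^ 6)"
      if "a \<noteq> 0" "b \<noteq> 0" for a b c d e f g h k w G :: complex
      using that by (simp add: power_mult_distrib mult_ac)
    show ?thesis unfolding gamma_quotient_def by (rule *[OF nz])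
  qed
  finally show ?thesis .
qed

text \<open>The shift factor tends to 4^4 / 2^12 = 1/16 at infinity, and it is already below 1/8 in
  the region considered.\<close>

lemma gamma_quotient_shift_bound:
  assumes "Re w \<ge> 8"
  shows "norm (gamma_quotient (w + 1)) \<le> norm (gamma_quotient w) * (1 / 8)"
proof -
  define n where "n = norm w"
  have n: "n \<ge> 8" using assms complex_Re_le_cmod[of w] by (simp add: n_def)
  have b: "norm (4 * w + 2) \<le> 5 * n" "norm (4 * w + 1) \<le> 5 * n" "norm (4 * w - 1) \<le> 5 * n"
    using norm_triangle_ineq[of "4 * w" 2] norm_triangle_ineq[of "4 * w" 1] norm_triangle_ineq4[of "4 * w" 1] n
    by (auto simp: n_def norm_mult)
  have l: "norm (2 * w + 1) \<ge> 15 / 8 * n"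
    using norm_diff_ineq[of "2 * w" 1] n by (auto simp: n_def norm_mult)
  have "norm ((4 * w + 2) * (4 * w + 1) * (4 * w) * (4 * w - 1) * w ^ 8 / ((2 * w + 1) * (2 * w)) ^ 6)
      = norm (4 * w + 2) * norm (4 * w + 1) * (4 * n) * norm (4 * w - 1) * n ^ 8 / (norm (2 * w + 1) * (2 * n)) ^ 6"
    by (simp add: norm_mult norm_divide norm_power n_def)
  also have "\<dots> \<le> (17 / 4 * n) * (33 / 8 * n) * (4 * n) * (33 / 8 * n) * n ^ 8 / (15 / 8 * n * (2 * n)) ^ 6"
  proof -
    \<comment> \<open>Since n >= 8: 4n + 2 is at most 17/4 n and 4n + 1 at most 33/8 n; likewise 2n
      - 1 is at least 15/8 n.\<close>
    have "norm (4 * w + 2) \<le> 17 / 4 * n" "norm (4 * w + 1) \<le> 33 / 8 * n" "norm (4 * w - 1) \<le> 33 / 8 * n"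
      using norm_triangle_ineq[of "4 * w" 2] norm_triangle_ineq[of "4 * w" 1] norm_triangle_ineq4[of "4 * w" 1] n
      by (auto simp: n_def norm_mult)
    then show ?thesis using n l
      by (intro frac_le mult_mono power_mono mult_nonneg_nonneg mult_pos_pos zero_less_power) auto
  qed
  also have "\<dots> = (17 / 4 * (33 / 8) * 4 * (33 / 8)) / (15 / 4) ^ 6"
    using n by (simp add: power_mult_distrib divide_simps eval_nat_numeral)
  also have "\<dots> \<le> 1 / 8" by (simp add: eval_nat_numeral)
  finally have "norm ((4 * w + 2) * (4 * w + 1) * (4 * w) * (4 * w - 1) * w ^ 8 / ((2 * w + 1) * (2 * w)) ^ 6) \<le> 1 / 8" .
  moreover have "Re w > 1 / 4" using assms by simp
  ultimately show ?thesis
    unfolding gamma_quotient_shift[OF \<open>Re w > 1 / 4\<close>] norm_mult by (intro mult_left_mono) auto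
qed

text \<open>The offset 9 keeps the real part of z + k + 9 above 8, where each step gains a factor
  1/8. The quadratic polynomial is absorbed by 4^k, which leaves (1/2)^k.\<close>

lemma complex_f13_uniform_bound:
  obtains M where "M > 0"
    "\<And>z k. norm z < 1 / 8 \<Longrightarrow> norm (complex_f13 (z + of_nat (k + 9))) \<le> M * (1 / 2) ^ k"
proof -
  have "compact ((\<lambda>z. gamma_quotient (z + 9)) ` cball 0 (1 / 8))"
  proof (intro compact_continuous_image holomorphic_on_imp_continuous_on holomorphic_on_compose_gen[OF _ gamma_quotient_holo, unfolded o_def])
    show "(\<lambda>z. z + 9) ` cball 0 (1 / 8) \<subseteq> {w. Re w > 1 / 4}"
    proof safe
      fix z :: complex assume "z \<in> cball 0 (1 / 8)"
      then have "- (1 / 8) \<le> Re z" using abs_Re_le_cmod[of z] by (simp add: abs_le_iff)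
      then show "Re (z + 9) > 1 / 4" by simp
    qed
  qed (auto intro!: holomorphic_intros)
  then obtain M where M: "M > 0" "\<And>z. norm z \<le> 1 / 8 \<Longrightarrow> norm (gamma_quotient (z + 9)) \<le> M"
    using compact_imp_bounded[of "(\<lambda>z. gamma_quotient (z + 9)) ` cball 0 (1 / 8)"] unfolding bounded_pos by auto
  have G: "norm (gamma_quotient (z + of_nat (k + 9))) \<le> M * (1 / 8) ^ k" if z: "norm z < 1 / 8" for z k
  proof (induction k)
    case 0
    show ?case using M(2)[of z] z by simp
  next
    case (Suc k)
    have "Re (z + of_nat (k + 9)) \<ge> 8" using abs_Re_le_cmod[of z] z by (auto simp: abs_le_iff)
    from gamma_quotient_shift_bound[OF this] Suc show ?case by (simp add: add_ac)
  qed
  \<comment> \<open>111 is the sum 60 + 43 + 8 of the absolute coefficients.\<close>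
  have P: "norm (60 * w\<^sup>2 - 43 * w + 8) \<le> 111 * (norm w + 1)\<^sup>2" for w :: complex
  proof -
    have "norm (60 * w\<^sup>2 - 43 * w + 8) \<le> norm (60 * w\<^sup>2) + norm (43 * w) + norm (8 :: complex)"
      by (intro order_trans[OF norm_triangle_ineq] add_mono norm_triangle_ineq4 order_refl)
    also have "\<dots> = 60 * (norm w)\<^sup>2 + 43 * norm w + 8" by (simp add: norm_mult norm_power)
    also have "\<dots> \<le> 111 * (norm w + 1)\<^sup>2" by (simp add: power2_eq_square algebra_simps)
    finally show ?thesis .
  qed
  \<comment> \<open>k + 11 bounds |z + k + 9| + 1 on the disc, and 121 is its square at k =
    0.\<close>
  have Q: "(real k + 11)\<^sup>2 \<le> 121 * 4 ^ k" for k
  proof -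
    have "real k + 11 \<le> 11 * 2 ^ k" by (induction k) auto
    then have "(real k + 11)\<^sup>2 \<le> (11 * 2 ^ k)\<^sup>2" by (intro power_mono) auto
    also have "\<dots> = 121 * 4 ^ k" by (simp add: power_mult_distrib power_mult[symmetric] mult.commute[of k] power_mult)
    finally show ?thesis .
  qed
  show ?thesis
  proof
    show "111 * 121 * M > 0" using M by simp
    fix z :: complex and k assume z: "norm z < 1 / 8"
    let ?w = "z + of_nat (k + 9)"
    have "norm ?w \<le> norm z + norm (of_nat (k + 9) :: complex)" by (rule norm_triangle_ineq)
    then have w: "norm ?w + 1 \<le> real k + 11" using z unfolding norm_of_nat by simp
    have "norm (complex_f13 ?w) = norm (60 * ?w\<^sup>2 - 43 * ?w + 8) * norm (gamma_quotient ?w)"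
      unfolding complex_f13_def gamma_quotient_def norm_mult ..
    also have "\<dots> \<le> 111 * (norm ?w + 1)\<^sup>2 * (M * (1 / 8) ^ k)"
      by (intro mult_mono P G[OF z]) auto
    also have "\<dots> \<le> 111 * (real k + 11)\<^sup>2 * (M * (1 / 8) ^ k)"
      using w M by (intro mult_right_mono mult_left_mono power_mono) auto
    also have "\<dots> \<le> 111 * (121 * 4 ^ k) * (M * (1 / 8) ^ k)"
      using Q M by (intro mult_right_mono mult_left_mono) auto
    also have "\<dots> = 111 * 121 * M * (4 ^ k * (1 / 8) ^ k)" by simp
    also have "(4 :: real) ^ k * (1 / 8) ^ k = (1 / 2) ^ k" by (simp add: power_mult_distrib[symmetric])
    finally show "norm (complex_f13 ?w) \<le> 111 * 121 * M * (1 / 2) ^ k" .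
  qed
qed

text \<open>The series of the functions complex_f13(z + k) converges uniformly on the disc and may
  be differentiated term by term at 0. Its sum agrees with the D of
  \<open>accel_sum_expansion\<close> for real z in [0, 1/8), since there both equal
  \<open>accel_sum\<close>, and hence on the whole disc by analytic continuation.\<close>

lemma f13_deriv_sums:
  "(\<lambda>k. (deriv ^^ m) f13 (real (Suc k))) sums (fact m * (\<Sum>i\<le>m. wz_pre_coeff i * wz_coeff (m - i)
       + thomae_pre_coeff i * thomae_coeff (m - i)))"
proof -
  let ?f = "\<lambda>k z. complex_f13 (z + of_nat (Suc k))"
  let ?T = "\<lambda>m. \<Sum>i\<le>m. wz_pre_coeff i * wz_coeff (m - i) + thomae_pre_coeff i * thomae_coeff (m - i)"
  obtain M where M: "M > 0" "\<And>z k. norm z < 1 / 8 \<Longrightarrow> norm (complex_f13 (z + of_nat (k + 9))) \<le> M * (1 / 2) ^ k"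
    using complex_f13_uniform_bound by blast
  have half: "Re (z + of_nat (Suc k)) > 1 / 4" if "norm z < 1 / 8" for z k
    using abs_Re_le_cmod[of z] that by (auto simp: abs_le_iff)
  have holo: "?f k holomorphic_on ball 0 (1 / 8)" for k
    by (rule holomorphic_on_compose_gen[OF _ complex_f13_holo, unfolded o_def])
      (use half in \<open>auto intro!: holomorphic_intros simp del: of_nat_Suc\<close>)
  have "uniformly_convergent_on (ball 0 (1 / 8)) (\<lambda>N z. \<Sum>k<N. ?f (k + 8) z)"
  proof (rule Weierstrass_m_test')
    show "norm (?f (k + 8) z) \<le> M * (1 / 2) ^ k" if "z \<in> ball 0 (1 / 8)" for k z
      using M(2)[of z k] that by (simp add: add_ac)
  qed (intro summable_mult summable_geometric, simp)
  then obtain S where S: "uniform_limit (ball 0 (1 / 8)) (\<lambda>N z. \<Sum>k<N. ?f (k + 8) z) S sequentially"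
    by (auto simp: uniformly_convergent_on_def)
  have Sh: "(\<lambda>z. \<Sum>k<N. ?f (k + 8) z) holomorphic_on ball 0 (1 / 8)" for N
    by (intro holomorphic_on_sum holo)
  \<comment> \<open>The first eight terms are kept apart because the geometric bound starts with the
    argument z + 9.\<close>
  define S8 where "S8 z = (\<Sum>k<8. ?f k z) + S z" for z
  have S_holo: "S holomorphic_on ball 0 (1 / 8)"
  proof (rule holomorphic_uniform_sequence[OF open_ball Sh])
    fix x :: complex assume "x \<in> ball 0 (1 / 8)"
    then obtain d where "d > 0" "cball x d \<subseteq> ball 0 (1 / 8)"
      using open_contains_cball[of "ball 0 (1 / 8) :: complex set"] open_ball by blast
    then show "\<exists>d>0. cball x d \<subseteq> ball 0 (1 / 8) \<and> uniform_limit (cball x d) (\<lambda>N z. \<Sum>k<N. ?f (k + 8) z) S sequentially"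
      using uniform_limit_on_subset[OF S] by blast
  qed
  have S8_holo: "S8 holomorphic_on ball 0 (1 / 8)"
    unfolding S8_def[abs_def] by (intro holomorphic_on_add holomorphic_on_sum holo S_holo)
  obtain D where D: "D holomorphic_on ball 0 (1 / 8)"
    "D has_fps_expansion Abs_fps (\<lambda>m. of_real (?T m))"
    "\<And>x. 0 \<le> x \<Longrightarrow> x < 1 / 8 \<Longrightarrow> D (of_real x) = of_real (accel_sum x)"
    using accel_sum_expansion by blast
  have S8_real: "S8 (of_real x) = D (of_real x)" if "0 \<le> x" "x < 1 / 8" for x
  proof -
    have "(\<lambda>k. complex_of_real (f13 (x + real (Suc k)))) sums of_real (accel_sum x)"
      by (intro sums_of_real f13_sums_accel_sum that)
    then have "(\<lambda>k. ?f k (of_real x)) sums of_real (accel_sum x)"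
      using complex_f13_of_real[of "x + real (Suc k)" for k] by (simp del: of_nat_Suc add: of_nat_Suc[symmetric])
    then have "(\<lambda>k. ?f (k + 8) (of_real x)) sums (of_real (accel_sum x) - (\<Sum>k<8. ?f k (of_real x)))"
      by (rule sums_split_initial_segment)
    moreover have "(\<lambda>k. ?f (k + 8) (of_real x)) sums S (of_real x)"
      unfolding sums_def using that by (intro tendsto_uniform_limitI[OF S]) auto
    ultimately have "S (of_real x) = of_real (accel_sum x) - (\<Sum>k<8. ?f k (of_real x))"
      by (metis sums_unique2)
    then show ?thesis using D(3)[OF that] by (simp add: S8_def)
  qed
  have S8_D: "S8 z = D z" if "norm z < 1 / 8" for z
  proof -
    have lp: "0 islimpt (complex_of_real ` {0<..<1 / 8})"
      unfolding islimpt_approachable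
    proof safe
      fix e :: real assume "e > 0"
      then show "\<exists>x'\<in>complex_of_real ` {0<..<1 / 8}. x' \<noteq> 0 \<and> dist x' 0 < e"
        by (intro bexI[of _ "complex_of_real (min (e / 2) (1 / 16))"]) auto
    qed
    have zero: "S8 w - D w = 0" if w: "w \<in> complex_of_real ` {0<..<1 / 8}" for w
    proof -
      from w obtain x where x: "w = of_real x" "0 < x" "x < 1 / 8" by auto
      show ?thesis unfolding x(1) using S8_real[of x] x(2,3) by simp
    qed
    have sub: "complex_of_real ` {0<..<1 / 8} \<subseteq> ball 0 (1 / 8)" by auto
    have h: "(\<lambda>z. S8 z - D z) holomorphic_on ball 0 (1 / 8)"
      by (intro holomorphic_on_diff S8_holo D(1))
    have "S8 z - D z = 0"
      by (rule analytic_continuation[OF h open_ball connected_ball sub _ lp zero]) (use that in auto)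
    then show ?thesis by simp
  qed
  have "(deriv ^^ m) S8 0 = (deriv ^^ m) D 0"
    by (rule higher_deriv_cong_ev)
      (use S8_D eventually_nhds_in_open[of "ball 0 (1 / 8)" "0 :: complex"] in \<open>auto elim!: eventually_mono\<close>)
  also have "\<dots> = fact m * of_real (?T m)"
    using fps_nth_fps_expansion[OF D(2), of m] by (simp add: field_simps)
  finally have S8_deriv: "(deriv ^^ m) S8 0 = of_real (fact m * ?T m)" by simp
  have f_deriv: "(deriv ^^ m) (?f k) 0 = of_real ((deriv ^^ m) f13 (real (Suc k)))" for k
  proof -
    have "(deriv ^^ m) (?f k) 0 = (deriv ^^ m) complex_f13 (of_nat (Suc k))"
      using higher_deriv_compose_linear'[OF complex_f13_holo open_ball open_halfspace_Re_gt, of 0 0 "1 / 8" 1 "of_nat (Suc k)" m]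
        half by (simp del: of_nat_Suc)
    also have "\<dots> = of_real ((deriv ^^ m) f13 (real (Suc k)))"
      using higher_deriv_complex_f13[of "real (Suc k)" m] by simp
    finally show ?thesis .
  qed
  have sum_deriv: "(deriv ^^ m) (\<lambda>z. \<Sum>k\<in>A. ?f (g k) z) 0 = (\<Sum>k\<in>A. (deriv ^^ m) (?f (g k)) 0)"
    if "finite A" for A and g :: "nat \<Rightarrow> nat"
    using that
  proof (induction A)
    case (insert a A)
    have "(deriv ^^ m) (\<lambda>z. ?f (g a) z + (\<Sum>k\<in>A. ?f (g k) z)) 0 =
        (deriv ^^ m) (?f (g a)) 0 + (deriv ^^ m) (\<lambda>z. \<Sum>k\<in>A. ?f (g k) z) 0"
      by (rule higher_deriv_add[of _ "ball 0 (1 / 8)"]) (auto intro!: holomorphic_on_sum holo simp del: of_nat_Suc)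
    then show ?case using insert by (simp del: of_nat_Suc)
  qed (simp add: higher_deriv_const)
  have "(\<lambda>N. (deriv ^^ m) (\<lambda>z. \<Sum>k<N. ?f (k + 8) z) 0) \<longlonglongrightarrow> (deriv ^^ m) S 0"
    by (rule higher_deriv_complex_uniform_limit[OF S always_eventually[OF allI[OF Sh]]]) auto
  then have "(\<lambda>k. (deriv ^^ m) (?f (k + 8)) 0) sums (deriv ^^ m) S 0"
    unfolding sums_def sum_deriv[of "{..<N}" "\<lambda>k. k + 8" for N, OF finite_lessThan] .
  moreover have "(deriv ^^ m) S8 0 = (\<Sum>k<8. (deriv ^^ m) (?f k) 0) + (deriv ^^ m) S 0"
    unfolding S8_def[abs_def] sum_deriv[of "{..<8}" "\<lambda>k. k", OF finite_lessThan, symmetric]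
    by (rule higher_deriv_add[of _ "ball 0 (1 / 8)"]) (auto intro!: holomorphic_on_sum holo S_holo simp del: of_nat_Suc)
  ultimately have "(\<lambda>k. (deriv ^^ m) (?f (k + 8)) 0) sums ((deriv ^^ m) S8 0 - (\<Sum>k<8. (deriv ^^ m) (?f k) 0))"
    by (simp only: add_diff_cancel_left')
  then have "(\<lambda>k. (deriv ^^ m) (?f k) 0) sums (deriv ^^ m) S8 0"
    by (rule sums_iff_shift'[where f = "\<lambda>k. (deriv ^^ m) (?f k) 0" and n = 8, THEN iffD1])
  then have "(\<lambda>k. complex_of_real ((deriv ^^ m) f13 (real (Suc k)))) sums of_real (fact m * ?T m)"
    unfolding f_deriv S8_deriv .
  then show ?thesis by (simp only: sums_of_real_iff)
qed

subsection \<open>Evaluation of the coefficients\<close>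

lemma compositions_upto_7:
  "compositions 1 = []"
  "compositions 2 = [[2]]"
  "compositions 3 = [[3]]"
  "compositions 4 = [[2, 2], [4]]"
  "compositions 5 = [[2, 3], [3, 2], [5]]"
  "compositions 6 = [[2, 2, 2], [2, 4], [3, 3], [4, 2], [6]]"
  "compositions 7 = [[2, 2, 3], [2, 3, 2], [2, 5], [3, 2, 2], [3, 4], [4, 3], [5, 2], [7]]"
  by (simp_all add: compositions.simps upt_rec)

lemma rat_fps_nth:
  "rat_fps [1, 1, 4] [2, 2, 2] $ 0 = 1" "rat_fps [1, 1, 4] [2, 2, 2] $ 1 = 0" "rat_fps [1, 1, 4] [2, 2, 2] $ 2 = -3" "rat_fps [1, 1, 4] [2, 2, 2] $ 3 = 14" "rat_fps [1, 1, 4] [2, 2, 2] $ 4 = -48" "rat_fps [1, 1, 4] [2, 2, 2] $ 5 = 144" "rat_fps [1, 1, 4] [2, 2, 2] $ 6 = -400" "rat_fps [1, 1, 4] [2, 2, 2] $ 7 = 1056"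
  "rat_fps [4] [2, 2, 2] $ 0 = 1" "rat_fps [4] [2, 2, 2] $ 1 = -2" "rat_fps [4] [2, 2, 2] $ 2 = 0" "rat_fps [4] [2, 2, 2] $ 3 = 16" "rat_fps [4] [2, 2, 2] $ 4 = -80" "rat_fps [4] [2, 2, 2] $ 5 = 288" "rat_fps [4] [2, 2, 2] $ 6 = -896" "rat_fps [4] [2, 2, 2] $ 7 = 2560"
  "rat_fps [2, 2, 2, 2, 2, 2] [4, 1, 1, 1, 1, 1, 1, 1, 1] $ 0 = 1" "rat_fps [2, 2, 2, 2, 2, 2] [4, 1, 1, 1, 1, 1, 1, 1, 1] $ 1 = 0" "rat_fps [2, 2, 2, 2, 2, 2] [4, 1, 1, 1, 1, 1, 1, 1, 1] $ 2 = 0" "rat_fps [2, 2, 2, 2, 2, 2] [4, 1, 1, 1, 1, 1, 1, 1, 1] $ 3 = -8" "rat_fps [2, 2, 2, 2, 2, 2] [4, 1, 1, 1, 1, 1, 1, 1, 1] $ 4 = 42" "rat_fps [2, 2, 2, 2, 2, 2] [4, 1, 1, 1, 1, 1, 1, 1, 1] $ 5 = -168" "rat_fps [2, 2, 2, 2, 2, 2] [4, 1, 1, 1, 1, 1, 1, 1, 1] $ 6 = 652" "rat_fps [2, 2, 2, 2, 2, 2] [4, 1, 1, 1, 1, 1, 1, 1, 1] $ 7 = -2568"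
  "rat_fps [2, 2, 2] [3, 3] $ 0 = 1" "rat_fps [2, 2, 2] [3, 3] $ 1 = 0" "rat_fps [2, 2, 2] [3, 3] $ 2 = 3" "rat_fps [2, 2, 2] [3, 3] $ 3 = -10" "rat_fps [2, 2, 2] [3, 3] $ 4 = 33" "rat_fps [2, 2, 2] [3, 3] $ 5 = -108" "rat_fps [2, 2, 2] [3, 3] $ 6 = 351" "rat_fps [2, 2, 2] [3, 3] $ 7 = -1134"
  "rat_fps [] [3, 3] $ 0 = 1" "rat_fps [] [3, 3] $ 1 = -6" "rat_fps [] [3, 3] $ 2 = 27" "rat_fps [] [3, 3] $ 3 = -108" "rat_fps [] [3, 3] $ 4 = 405" "rat_fps [] [3, 3] $ 5 = -1458" "rat_fps [] [3, 3] $ 6 = 5103" "rat_fps [] [3, 3] $ 7 = -17496"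
  "rat_fps [3, 3] [1, 1, 1, 1, 1, 1] $ 0 = 1" "rat_fps [3, 3] [1, 1, 1, 1, 1, 1] $ 1 = 0" "rat_fps [3, 3] [1, 1, 1, 1, 1, 1] $ 2 = -6" "rat_fps [3, 3] [1, 1, 1, 1, 1, 1] $ 3 = 16" "rat_fps [3, 3] [1, 1, 1, 1, 1, 1] $ 4 = -21" "rat_fps [3, 3] [1, 1, 1, 1, 1, 1] $ 5 = 0" "rat_fps [3, 3] [1, 1, 1, 1, 1, 1] $ 6 = 84" "rat_fps [3, 3] [1, 1, 1, 1, 1, 1] $ 7 = -288"
  by (simp_all add: nth_eq_coeffs_upto[where n = 8] rat_fps_coeffs)

lemma sum_atMost_upto_7:
  fixes f :: "nat \<Rightarrow> real"
  shows
  "(\<Sum>k\<le>0. f k) = f 0"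
  and "(\<Sum>k\<le>1. f k) = f 0 + f 1"
  and "(\<Sum>k\<le>2. f k) = f 0 + f 1 + f 2"
  and "(\<Sum>k\<le>3. f k) = f 0 + f 1 + f 2 + f 3"
  and "(\<Sum>k\<le>4. f k) = f 0 + f 1 + f 2 + f 3 + f 4"
  and "(\<Sum>k\<le>5. f k) = f 0 + f 1 + f 2 + f 3 + f 4 + f 5"
  and "(\<Sum>k\<le>6. f k) = f 0 + f 1 + f 2 + f 3 + f 4 + f 5 + f 6"
  and "(\<Sum>k\<le>7. f k) = f 0 + f 1 + f 2 + f 3 + f 4 + f 5 + f 6 + f 7"
  by (simp_all add: eval_nat_numeral)

lemma wz_coeff_upto_7:
  "wz_coeff 0 = mzv [2]"
  "wz_coeff 1 = - 2 * mzv [3]"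
  "wz_coeff 2 = - 3 * mzv [2, 2]"
  "wz_coeff 3 = 14 * mzv [2, 3] + 6 * mzv [3, 2] + 16 * mzv [5]"
  "wz_coeff 4 = 9 * mzv [2, 2, 2] - 48 * mzv [2, 4] - 28 * mzv [3, 3] - 80 * mzv [6]"
  "wz_coeff 5 = - 42 * mzv [2, 2, 3] - 42 * mzv [2, 3, 2] + 144 * mzv [2, 5] - 18 * mzv [3, 2, 2] + 96
    * mzv [3, 4] - 48 * mzv [5, 2] + 288 * mzv [7]"
  "wz_coeff 6 = - 27 * mzv [2, 2, 2, 2] + 144 * mzv [2, 2, 4] + 196 * mzv [2, 3, 3] + 144 * mzv [2, 4,
    2] - 400 * mzv [2, 6] + 84 * mzv [3, 2, 3] + 84 * mzv [3, 3, 2] - 288 * mzv [3, 5] + 224 * mzv [5,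
    3] + 240 * mzv [6, 2] - 896 * mzv [8]"
  "wz_coeff 7 = 126 * mzv [2, 2, 2, 3] + 126 * mzv [2, 2, 3, 2] - 432 * mzv [2, 2, 5] + 126 * mzv [2,
    3, 2, 2] - 672 * mzv [2, 3, 4] - 672 * mzv [2, 4, 3] - 432 * mzv [2, 5, 2] + 1056 * mzv [2, 7] + 54
    * mzv [3, 2, 2, 2] - 288 * mzv [3, 2, 4] - 392 * mzv [3, 3, 3] - 288 * mzv [3, 4, 2] + 800 * mzv [3,
    6] + 144 * mzv [5, 2, 2] - 768 * mzv [5, 4] - 1120 * mzv [6, 3] - 864 * mzv [7, 2] + 2560 * mzv [9]"
  unfolding wz_coeff_def sum_atMost_upto_7 weight_sum_def
  by (simp_all add: compositions_upto_7 compositions_upto_7[unfolded One_nat_def] rat_fps_nth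
      rat_fps_nth[unfolded One_nat_def] numeral_2_eq_2[symmetric] numeral_3_eq_3[symmetric])

lemma thomae_coeff_upto_7:
  "thomae_coeff 0 = mzv [2]"
  "thomae_coeff 1 = - 6 * mzv [3]"
  "thomae_coeff 2 = 3 * mzv [2, 2] + 27 * mzv [4]"
  "thomae_coeff 3 = - 10 * mzv [2, 3] - 18 * mzv [3, 2] - 108 * mzv [5]"
  "thomae_coeff 4 = 9 * mzv [2, 2, 2] + 33 * mzv [2, 4] + 60 * mzv [3, 3] + 81 * mzv [4, 2] + 405 * mzv
    [6]"
  "thomae_coeff 5 = - 30 * mzv [2, 2, 3] - 30 * mzv [2, 3, 2] - 108 * mzv [2, 5] - 54 * mzv [3, 2, 2] -
    198 * mzv [3, 4] - 270 * mzv [4, 3] - 324 * mzv [5, 2] - 1458 * mzv [7]"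
  "thomae_coeff 6 = 27 * mzv [2, 2, 2, 2] + 99 * mzv [2, 2, 4] + 100 * mzv [2, 3, 3] + 99 * mzv [2, 4,
    2] + 351 * mzv [2, 6] + 180 * mzv [3, 2, 3] + 180 * mzv [3, 3, 2] + 648 * mzv [3, 5] + 243 * mzv [4,
    2, 2] + 891 * mzv [4, 4] + 1080 * mzv [5, 3] + 1215 * mzv [6, 2] + 5103 * mzv [8]"
  "thomae_coeff 7 = - 90 * mzv [2, 2, 2, 3] - 90 * mzv [2, 2, 3, 2] - 324 * mzv [2, 2, 5] - 90 * mzv
    [2, 3, 2, 2] - 330 * mzv [2, 3, 4] - 330 * mzv [2, 4, 3] - 324 * mzv [2, 5, 2] - 1134 * mzv [2, 7] -
    162 * mzv [3, 2, 2, 2] - 594 * mzv [3, 2, 4] - 600 * mzv [3, 3, 3] - 594 * mzv [3, 4, 2] - 2106 *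
    mzv [3, 6] - 810 * mzv [4, 2, 3] - 810 * mzv [4, 3, 2] - 2916 * mzv [4, 5] - 972 * mzv [5, 2, 2] -
    3564 * mzv [5, 4] - 4050 * mzv [6, 3] - 4374 * mzv [7, 2] - 17496 * mzv [9]"
  unfolding thomae_coeff_def sum_atMost_upto_7 weight_sum_def
  by (simp_all add: compositions_upto_7 compositions_upto_7[unfolded One_nat_def] rat_fps_nth
      rat_fps_nth[unfolded One_nat_def] numeral_2_eq_2[symmetric] numeral_3_eq_3[symmetric])

lemma wz_pre_coeff_upto_7:
  "wz_pre_coeff 0 = 1"
  "wz_pre_coeff 1 = 0"
  "wz_pre_coeff 2 = 0"
  "wz_pre_coeff 3 = - 8 * mzv [3]"
  "wz_pre_coeff 4 = 42 * mzv [4]"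
  "wz_pre_coeff 5 = - 168 * mzv [5]"
  "wz_pre_coeff 6 = 64 * mzv [3, 3] + 652 * mzv [6]"
  "wz_pre_coeff 7 = - 336 * mzv [3, 4] - 336 * mzv [4, 3] - 2568 * mzv [7]"
  unfolding wz_pre_coeff_def weight_sum_def
  by (simp_all add: compositions_upto_7 compositions_upto_7[unfolded One_nat_def] rat_fps_nth)

lemma thomae_pre_coeff_upto_7:
  "thomae_pre_coeff 0 = 1"
  "thomae_pre_coeff 1 = 0"
  "thomae_pre_coeff 2 = - 6 * mzv [2]"
  "thomae_pre_coeff 3 = 16 * mzv [3]"
  "thomae_pre_coeff 4 = 36 * mzv [2, 2] - 21 * mzv [4]"
  "thomae_pre_coeff 5 = - 96 * mzv [2, 3] - 96 * mzv [3, 2]"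
  "thomae_pre_coeff 6 = - 216 * mzv [2, 2, 2] + 126 * mzv [2, 4] + 256 * mzv [3, 3] + 126 * mzv [4, 2]
    + 84 * mzv [6]"
  "thomae_pre_coeff 7 = 576 * mzv [2, 2, 3] + 576 * mzv [2, 3, 2] + 576 * mzv [3, 2, 2] - 336 * mzv [3,
    4] - 336 * mzv [4, 3] - 288 * mzv [7]"
  unfolding thomae_pre_coeff_def weight_sum_def
  by (simp_all add: compositions_upto_7 compositions_upto_7[unfolded One_nat_def] rat_fps_nth)

text \<open>Relations are stored as expressions that vanish. A value can then be proved in two
  moves: a polynomial identity in the symbols \<open>mzv u\<close>, stating that the coefficient
  equals the target plus a combination of defects, and the removal of the defects.\<close>

definition stuffle_defect :: "nat list \<Rightarrow> nat list \<Rightarrow> real" where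
  "stuffle_defect u v = mzv u * mzv v - (\<Sum>w\<leftarrow>stuffle u v. mzv w)"

definition shuffle_defect :: "nat list \<Rightarrow> nat list \<Rightarrow> real" where
  "shuffle_defect u v =
     mzv u * mzv v - (\<Sum>w\<leftarrow>shuffle (word_of u) (word_of v). mzv (index_of w))"

definition hoffman_defect :: "nat list \<Rightarrow> real" where
  "hoffman_defect u = (\<Sum>w\<leftarrow>tl (shuffle [True] (word_of u)). mzv (index_of w))
     - (\<Sum>w\<leftarrow>tl (stuffle [1] u). mzv w)"

lemma stuffle_defect_eq_0: "admissible u \<Longrightarrow> admissible v \<Longrightarrow> stuffle_defect u v = 0"
  by (simp add: stuffle_defect_def mzv_stuffle)

lemma shuffle_defect_eq_0: "admissible u \<Longrightarrow> admissible v \<Longrightarrow> shuffle_defect u v = 0"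
  by (simp add: shuffle_defect_def mzv_shuffle)

lemma hoffman_defect_eq_0: "admissible u \<Longrightarrow> u \<noteq> [] \<Longrightarrow> hoffman_defect u = 0"
  by (simp add: hoffman_defect_def mzv_hoffman)

section \<open>Double zeta values up to weight 7\<close>

lemma replicate_upto_8:
  "replicate 1 x = [x]" "replicate 2 x = [x, x]" "replicate 3 x = [x, x, x]"
  "replicate 4 x = [x, x, x, x]" "replicate 5 x = [x, x, x, x, x]"
  "replicate 6 x = [x, x, x, x, x, x]" "replicate 7 x = [x, x, x, x, x, x, x]"
  "replicate 8 x = [x, x, x, x, x, x, x, x]"
  by (simp_all add: numeral_eq_Suc)

lemmas mzv_defects = stuffle_defect_def shuffle_defect_def hoffman_defect_def replicate_upto_8

text \<open>One stuffle, one shuffle and one Hoffman relation determine three unknowns over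
  zeta(2)^2. This yields zeta(4) = 2/5 zeta(2)^2 without evaluating either side.\<close>

lemma mzv_values_4:
  "mzv [4] = 2 / 5 * mzv [2] ^ 2"
  "mzv [2, 2] = 3 / 10 * mzv [2] ^ 2"
  "mzv [3, 1] = 1 / 10 * mzv [2] ^ 2"
  using stuffle_defect_eq_0[of "[2]" "[2]"] shuffle_defect_eq_0[of "[2]" "[2]"]
    hoffman_defect_eq_0[of "[3]"]
  by (simp_all add: mzv_defects  power2_eq_square power3_eq_cube algebra_simps
      del: One_nat_def)

lemma mzv_values_5:
  "mzv [2, 3] = 9 / 2 * mzv [5] - 2 * mzv [2] * mzv [3]"
  "mzv [3, 2] = - 11 / 2 * mzv [5] + 3 * mzv [2] * mzv [3]"
  "mzv [4, 1] = 2 * mzv [5] - mzv [2] * mzv [3]"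
  using stuffle_defect_eq_0[of "[2]" "[3]"] shuffle_defect_eq_0[of "[2]" "[3]"]
    hoffman_defect_eq_0[of "[4]"]
  by (simp_all add: mzv_defects mzv_values_4 power2_eq_square power3_eq_cube algebra_simps
      del: One_nat_def)

text \<open>Five relations for five unknowns, with zeta(3)^2 and zeta(2)^3 as parameters.\<close>

lemma mzv_values_6:
  "mzv [6] = 8 / 35 * mzv [2] ^ 3"
  "mzv [2, 4] = - (mzv [3] ^ 2) + 10 / 21 * mzv [2] ^ 3"
  "mzv [3, 3] = 1 / 2 * mzv [3] ^ 2 - 4 / 35 * mzv [2] ^ 3"
  "mzv [4, 2] = mzv [3] ^ 2 - 32 / 105 * mzv [2] ^ 3"
  "mzv [5, 1] = - 1 / 2 * mzv [3] ^ 2 + 6 / 35 * mzv [2] ^ 3"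
  using stuffle_defect_eq_0[of "[2]" "[4]"] stuffle_defect_eq_0[of "[3]" "[3]"]
    shuffle_defect_eq_0[of "[2]" "[4]"] shuffle_defect_eq_0[of "[3]" "[3]"]
    hoffman_defect_eq_0[of "[5]"]
  by (simp_all add: mzv_defects mzv_values_4 mzv_values_5 power2_eq_square power3_eq_cube algebra_simps
      del: One_nat_def)

lemma mzv_values_7:
  "mzv [2, 5] = 10 * mzv [7] - 4 * mzv [2] * mzv [5] - 4 / 5 * mzv [2] ^ 2 * mzv [3]"
  "mzv [3, 4] = - 18 * mzv [7] + 10 * mzv [2] * mzv [5] + 2 / 5 * mzv [2] ^ 2 * mzv [3]"
  "mzv [4, 3] = 17 * mzv [7] - 10 * mzv [2] * mzv [5]"
  "mzv [5, 2] = - 11 * mzv [7] + 5 * mzv [2] * mzv [5] + 4 / 5 * mzv [2] ^ 2 * mzv [3]"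
  "mzv [6, 1] = 3 * mzv [7] - mzv [2] * mzv [5] - 2 / 5 * mzv [2] ^ 2 * mzv [3]"
proof -
  \<comment> \<open>Linear arithmetic treats each monomial as an atom, so the link between these two
    monomials has to be supplied.\<close>
  have *: "mzv [3] * mzv [4] = 2 / 5 * mzv [2] ^ 2 * mzv [3]"
    by (simp add: mzv_values_4)
  moreover have "mzv [2] * mzv [5] - mzv [2, 5] - mzv [5, 2] - mzv [7] = 0"
    using mzv_stuffle[of "[2]" "[5]"] by (simp add: numeral_eq_Suc)
  moreover have "mzv [3] * mzv [4] - mzv [3, 4] - mzv [4, 3] - mzv [7] = 0"
    using mzv_stuffle[of "[3]" "[4]"] by (simp add: numeral_eq_Suc)
  moreover have "mzv [2] * mzv [5] - mzv [2, 5] - 2 * mzv [3, 4] - 3 * mzv [4, 3] - 5 * mzv [5, 2] -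
      10 * mzv [6, 1] = 0"
    using mzv_shuffle[of "[2]" "[5]"] by (simp add: numeral_eq_Suc)
  moreover have "mzv [3] * mzv [4] - mzv [3, 4] - 4 * mzv [4, 3] - 10 * mzv [5, 2] - 20 * mzv [6, 1] =
      0"
    using mzv_shuffle[of "[3]" "[4]"] by (simp add: numeral_eq_Suc)
  moreover have "mzv [2, 5] + mzv [3, 4] + mzv [4, 3] + mzv [5, 2] + mzv [6, 1] - mzv [7] = 0"
    using mzv_hoffman[of "[6]"] by (simp add: numeral_eq_Suc)
  ultimately show
    "mzv [2, 5] = 10 * mzv [7] - 4 * mzv [2] * mzv [5] - 4 / 5 * mzv [2] ^ 2 * mzv [3]"
    "mzv [3, 4] = - 18 * mzv [7] + 10 * mzv [2] * mzv [5] + 2 / 5 * mzv [2] ^ 2 * mzv [3]"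
    "mzv [4, 3] = 17 * mzv [7] - 10 * mzv [2] * mzv [5]"
    "mzv [5, 2] = - 11 * mzv [7] + 5 * mzv [2] * mzv [5] + 4 / 5 * mzv [2] ^ 2 * mzv [3]"
    "mzv [6, 1] = 3 * mzv [7] - mzv [2] * mzv [5] - 2 / 5 * mzv [2] ^ 2 * mzv [3]"
    by linarith+
qed

section \<open>The first seven Taylor coefficients of the accelerated sum\<close>

lemmas accel_coeffs = sum_atMost_upto_7 wz_coeff_upto_7 thomae_coeff_upto_7 wz_pre_coeff_upto_7
  thomae_pre_coeff_upto_7 mzv_values_4 mzv_values_5 mzv_values_6 mzv_values_7

definition accel_coeff :: "nat \<Rightarrow> real" where
  "accel_coeff n = (\<Sum>i\<le>n. wz_pre_coeff i * wz_coeff (n - i) + thomae_pre_coeff i * thomae_coeff (n - i))"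

lemma accel_coeff_1: "accel_coeff 1 = - 8 * mzv [3]"
  unfolding accel_coeff_def
  by (simp add: accel_coeffs accel_coeffs[unfolded One_nat_def] power2_eq_square algebra_simps del: One_nat_def)

lemma accel_coeff_2: "accel_coeff 2 = 12 * mzv [4]"
  unfolding accel_coeff_def
  by (simp add: accel_coeffs accel_coeffs[unfolded One_nat_def] power2_eq_square algebra_simps del: One_nat_def)

lemma accel_coeff_3: "accel_coeff 3 = - 8 * mzv [5]"
  unfolding accel_coeff_def
  by (simp add: accel_coeffs accel_coeffs[unfolded One_nat_def] power2_eq_square algebra_simps del: One_nat_def)

text \<open>The only value of depth three that occurs is \<open>mzv [2, 2, 2]\<close>, and a single
  stuffle relation removes it.\<close>

lemma accel_coeff_4: "accel_coeff 4 = 32 * mzv [3] ^ 2 - 50 * mzv [6]"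
proof -
  have "accel_coeff 4 = 32 * mzv [3] ^ 2 - 50 * mzv [6] - 6 * stuffle_defect [2] [2, 2]"
    unfolding accel_coeff_def
    by (simp add: accel_coeffs accel_coeffs[unfolded One_nat_def] mzv_defects del: One_nat_def, algebra)
  then show ?thesis
    by (simp add: stuffle_defect_eq_0 shuffle_defect_eq_0 hoffman_defect_eq_0)
qed

text \<open>The values of depth three, \<open>mzv [2, 2, 3]\<close>, \<open>mzv [2, 3, 2]\<close>
  and \<open>mzv [3, 2, 2]\<close>, all enter with total coefficient -72, so one stuffle relation
  removes them together.\<close>

lemma accel_coeff_5: "accel_coeff 5 = 24 * (19 * mzv [7] - 14 * mzv [3] * mzv [4])"
proof -
  have "accel_coeff 5 = 24 * (19 * mzv [7] - 14 * mzv [3] * mzv [4]) + 72 * stuffle_defect [3] [2, 2]"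
    unfolding accel_coeff_def
    by (simp add: accel_coeffs accel_coeffs[unfolded One_nat_def] mzv_defects del: One_nat_def, algebra)
  then show ?thesis
    by (simp add: stuffle_defect_eq_0 shuffle_defect_eq_0 hoffman_defect_eq_0)
qed

text \<open>The coefficients of the relations in the next two proofs solve a rational linear system whose
  unknowns are the multiple zeta values of weight 8 and 9, respectively.\<close>

lemma accel_coeff_6: "accel_coeff 6 = 8 * (32 * mzv [5, 3] + 168 * mzv [3] * mzv [5] - 215 * mzv [8])"
proof -
  have "accel_coeff 6 = 8 * (32 * mzv [5, 3] + 168 * mzv [3] * mzv [5] - 215 * mzv [8]) - 108 * stuffle_defect [3] [3,
      2] - 24 * shuffle_defect [2] [2, 4] - 3297 / 10 * hoffman_defect [7] - 23457 / 20 *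
      stuffle_defect [2] [6] - 156 * stuffle_defect [3] [2, 3] - 52219 / 20 * stuffle_defect [3] [5] +
      48 * stuffle_defect [2] [4, 2] + 90 * stuffle_defect [2] [2, 2] * mzv [2] + 192 * stuffle_defect
      [3] [4, 1] - 96 * hoffman_defect [3, 4] - 291 * stuffle_defect [4] [2, 2] - 64 * shuffle_defect
      [2] [3, 3] - 3627 / 2 * stuffle_defect [4] [4] + 16 * shuffle_defect [3] [2, 3] + 26783 / 20 *
      shuffle_defect [2] [6] - 96 * hoffman_defect [4, 3] - 11061 / 20 * shuffle_defect [3] [5]"
    unfolding accel_coeff_def
    by (simp add: accel_coeffs accel_coeffs[unfolded One_nat_def] mzv_defects del: One_nat_def, algebra)
  then show ?thesis
    by (simp add: stuffle_defect_eq_0 shuffle_defect_eq_0 hoffman_defect_eq_0)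
qed

lemma accel_coeff_7: "accel_coeff 7 = 8 / 3 * (2489 * mzv [9] - 1860 * mzv [3] * mzv [6] - 32 * mzv [3] ^ 3 - 126 * mzv [4] * mzv [5])"
proof -
  have "accel_coeff 7 = 8 / 3 * (2489 * mzv [9] - 1860 * mzv [3] * mzv [6] - 32 * mzv [3] ^ 3 - 126 * mzv [4] * mzv [5])
      + 2404632 / 625 * hoffman_defect [8] - 144 / 5 * stuffle_defect [3] [3, 1] * mzv [2] - 920712 /
      625 * shuffle_defect [4] [5] + 24 / 5 * shuffle_defect [3] [2, 2, 2] - 92 / 5 * stuffle_defect
      [2] [2, 2, 3] - 96 / 5 * hoffman_defect [3, 3, 2] - 288 / 5 * stuffle_defect [2] [3, 2] *
      mzv [2] + 96 / 5 * hoffman_defect [3, 3] * mzv [2] + 2273628 / 625 * shuffle_defect [3] [6] +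
      4139508 / 625 * stuffle_defect [4] [5] + 4368 / 25 * hoffman_defect [6, 2] + 629662 / 625 *
      stuffle_defect [4] [2, 3] + 152832 / 625 * hoffman_defect [3, 5] + 186532 / 375 * stuffle_defect
      [3] [3, 3] + 3231388 / 625 * stuffle_defect [2] [7] - 164 / 5 * stuffle_defect [2] [2, 3, 2] +
      54312 / 625 * stuffle_defect [3] [2, 4] - 96 / 125 * stuffle_defect [3] [5, 1] + 96264 / 625 *
      hoffman_defect [4, 4] + 31284 / 625 * shuffle_defect [3] [4, 2] - 26724 / 625 * shuffle_defect
      [4] [3, 2] + 144 / 5 * stuffle_defect [3] [3, 1, 2] + 36 / 5 * shuffle_defect [2] [2, 2] *
      mzv [3] + 144 / 5 * stuffle_defect [3] [2, 3, 1] - 48 * stuffle_defect [2] [3, 1, 3] + 34632 /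
      625 * stuffle_defect [2] [2, 5] + 567568 / 625 * stuffle_defect [5] [2, 2] + 21356 / 625 *
      shuffle_defect [3] [3, 3] + 124 / 5 * stuffle_defect [2] [3, 2, 2] - 3728 / 5 * stuffle_defect
      [3] [2, 2] * mzv [2] + 164832 / 625 * stuffle_defect [5] [3, 1] - 28224 / 625 * shuffle_defect
      [2] [4, 3] - 2308 / 5 * stuffle_defect [2] [2, 2] * mzv [3] + 24 / 5 * shuffle_defect [2] [2, 2,
      3] + 144 / 5 * hoffman_defect [4, 2, 2] - 576 / 5 * stuffle_defect [2] [3, 3, 1] - 412836 / 125
      * shuffle_defect [2] [7] + 144 / 5 * stuffle_defect [3] [3, 2, 1] + 698218 / 625 *
      stuffle_defect [4] [3, 2] + 8208 / 125 * stuffle_defect [2] [3, 4] - 144 / 5 * hoffman_defect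
      [4, 2] * mzv [2] - 24 / 5 * shuffle_defect [3] [2, 2] * mzv [2] - 144 / 5 * stuffle_defect [2]
      [2, 4, 1] + 96264 / 625 * stuffle_defect [4] [4, 1] + 11123416 / 1875 * stuffle_defect [3] [6]"
    unfolding accel_coeff_def
    by (simp add: accel_coeffs accel_coeffs[unfolded One_nat_def] mzv_defects del: One_nat_def, algebra)
  then show ?thesis
    by (simp add: stuffle_defect_eq_0 shuffle_defect_eq_0 hoffman_defect_eq_0)
qed

section \<open>Identification with zeta and double zeta values, and the conclusion\<close>

lemma zeta_eq_mzv:
  assumes "n \<ge> 2"
  shows "zeta (real n) = mzv [n]"
proof -
  have "(\<lambda>k. hsum [] (Suc k) / real (Suc k) ^ n) sums mzv [n]"
    using mzv_sums[of n "[]"] assms by simp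
  also have "(\<lambda>k. hsum [] (Suc k) / real (Suc k) ^ n) = (\<lambda>k. real (Suc k) powr - real n)"
    by (simp add: powr_minus powr_realpow divide_inverse del: of_nat_Suc)
  finally show ?thesis
    by (simp add: zeta_def sums_iff)
qed

text \<open>The larger index is summed on the outside. All terms are nonnegative, so the ordered
  series and the unordered double sum agree.\<close>

lemma double_zeta_eq_mzv:
  assumes "a \<ge> 2" "b > 0"
  shows "double_zeta a b = mzv [a, b]"
proof -
  define f where "f = (\<lambda>(k, l). 1 / (real k ^ a * real l ^ b))"
  let ?g = "\<lambda>k. hsum [b] k / real k ^ a"
  have eq: "{(k, l). l < k \<and> 0 < l} = Sigma UNIV (\<lambda>k::nat. {1..<k})"
    by auto
  have "(\<lambda>k. ?g (Suc k)) sums mzv [a, b]"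
    using assms by (intro mzv_sums) auto
  then have "?g sums mzv [a, b]"
    by (subst (asm) sums_Suc_iff) simp
  then have g: "(?g has_sum mzv [a, b]) UNIV"
    by (intro sums_nonneg_imp_has_sum) (auto simp: hsum_nonneg)
  have f: "((\<lambda>l. f (k, l)) has_sum ?g k) {1..<k}" for k
    by (auto simp: f_def hsum.simps(2) sum_divide_distrib mult.commute intro!: has_sum_finiteI)
  have "f summable_on Sigma UNIV (\<lambda>k. {1..<k})"
    by (rule summable_on_SigmaI[OF f])
      (use g in \<open>auto simp: f_def has_sum_imp_summable\<close>)
  then have "(f has_sum mzv [a, b]) (Sigma UNIV (\<lambda>k. {1..<k}))"
    using f g by (intro has_sum_SigmaI) auto
  then show ?thesis
    unfolding double_zeta_def eq f_def by (rule infsumI)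
qed

theorem theorem1p15:
  shows "(\<forall>m\<in>{1..7::nat}. summable (\<lambda>k. (deriv ^^ m) f13 (real (Suc k)))) \<and>
    (\<Sum>k. deriv f13 (real (Suc k))) = - 8 * zeta 3 \<and>
    (\<Sum>k. (deriv ^^ 2) f13 (real (Suc k))) = 24 * zeta 4 \<and>
    (\<Sum>k. (deriv ^^ 3) f13 (real (Suc k))) = - 48 * zeta 5 \<and>
    1 / 48 * (\<Sum>k. (deriv ^^ 4) f13 (real (Suc k))) = 16 * (zeta 3)\<^sup>2 - 25 * zeta 6 \<and>
    1 / 2880 * (\<Sum>k. (deriv ^^ 5) f13 (real (Suc k))) = 19 * zeta 7 - 14 * zeta 3 * zeta 4 \<and>
    1 / 5760 * (\<Sum>k. (deriv ^^ 6) f13 (real (Suc k)))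
      = 32 * double_zeta 5 3 + 168 * zeta 3 * zeta 5 - 215 * zeta 8 \<and>
    1 / 13440 * (\<Sum>k. (deriv ^^ 7) f13 (real (Suc k)))
      = 2489 * zeta 9 - 1860 * zeta 3 * zeta 6 - 32 * zeta 3 ^ 3 - 126 * zeta 4 * zeta 5"
proof -
  have sums: "(\<lambda>k. (deriv ^^ m) f13 (real (Suc k))) sums (fact m * accel_coeff m)" for m
    unfolding accel_coeff_def by (rule f13_deriv_sums)
  have suminf: "(\<Sum>k. (deriv ^^ m) f13 (real (Suc k))) = fact m * accel_coeff m" for m
    using sums by (rule sums_unique[symmetric])
  have z: "zeta (numeral k) = mzv [numeral k]" if "numeral k \<ge> (2 :: nat)" for k
    using zeta_eq_mzv[of "numeral k"] that by simp
  have z53: "double_zeta 5 3 = mzv [5, 3]"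
    by (simp add: double_zeta_eq_mzv)
  have "deriv f13 = (deriv ^^ 1) f13"
    by simp
  \<comment> \<open>The normalising constants match the factorials: 48 = 2 * 4!, 2880 = 24 * 5!,
    5760 = 8 * 6! and 13440 = 8/3 * 7!.\<close>
  then show ?thesis
    using sums
    by (simp only: suminf accel_coeff_1 accel_coeff_2 accel_coeff_3 accel_coeff_4 accel_coeff_5
        accel_coeff_6 accel_coeff_7 z53) (simp add: z fact_numeral sums_iff power2_eq_square)
qed

end
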